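(* Let $n\ge2$ and let $H:=\{(x,y)\in\mathbb{R}^2:Q(x,y)=0\}$ be a hyperbola. For a real sequence $\beta\equiv\beta^{(2n)}=\{\beta_{ij}\}_{i,j\ge0,\,i+j\le2n}$ with $\beta_{00}>0$, assume that $\mathcal{M}(n)\equiv\mathcal{M}(n)(\beta)$ is positive, recursively generated, and satisfies $Q(X,Y)=0$ in $\mathcal{C}_{\mathcal{M}(n)}$. Then $\operatorname{rank}\mathcal{M}(n)\le 2n+1$, and the following statements are equivalent. (i) $\beta$ admits a representing measure (necessarily supported in $H$). (ii) $\beta$ admits a representing measure (necessarily supported in $H$) with convergent moments of degree up to $2n+2$. (iii) $\beta$ admits a representing measure $\mu$ (necessarily supported in $H$) satisfying $\operatorname{card}\operatorname{supp}\mu\le 1+\operatorname{rank}\mathcal{M}(n)$. If $\operatorname{rank}\mathcal{M}(n)\le2n$, then $\mu$ can be taken so that $\operatorname{card}\operatorname{supp}\mu=\operatorname{rank}\mathcal{M}(n)$. (iv) $\mathcal{M}(n)$ admits a positive, recursively generated moment matrix extension $\mathcal{M}(n+1)$. (v) $\mathcal{M}(n)$ admits a positive, recursively generated extension $\mathcal{M}(n+1)$, with $\operatorname{rank}\mathcal{M}(n+1)\le1+\operatorname{rank}\mathcal{M}(n)$, and $\mathcal{M}(n+1)$ admits a flat extension $\mathcal{M}(n+2)$. If $\operatorname{rank}\mathcal{M}(n)\le2n$, then $\mathcal{M}(n)$ admits a flat extension $\mathcal{M}(n+1)$. (vi) $\operatorname{rank}\mathcal{M}(n)\le\operatorname{c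ard}\mathcal{V}(\mathcal{M}(n))$.
   Context: A hyperbola $Q(x,y)=0$ is given by a real polynomial $Q$ of degree 2 whose quadratic part is indefinite and nondegenerate, i.e. $Q=Ax^2+Bxy+Cy^2+Dx+Ey+F$ with $B^2-4AC>0$; equivalently an invertible affine change of variables carries $Q$ to a nonzero scalar multiple of $yx-1$ (nondegenerate case) or $yx$ (degenerate case: two intersecting lines). Both cases are included. A representing measure for $\beta=\beta^{(2n)}$ is a positive Borel measure $\mu$ on $\mathbb{R}^2$ with convergent moments up to degree $2n$ such that $\beta_{ij}=\int y^ix^j\,d\mu$ for $i,j\ge0$, $i+j\le 2n$. $\mathbb{R}_n[x,y]$ is the space of real polynomials of degree at most $n$. The moment matrix $\mathcal{M}(n)(\beta)$ is the real symmetric matrix of size $(n+1)(n+2)/2$ with rows and columns indexed by $1,X,Y,X^2,YX,Y^2,\dots,X^n,YX^{n-1},\dots,Y^n$, whose entry in row $Y^iX^j$, column $Y^kX^\ell$ is $\beta_{i+k,j+\ell}$. "Positive" means positive semi-definite. $\mathcal{C}_{\mathcal{M}(n)}$ is the column space. For $p(x,y)=\sum a_{ij}y^ix^j\in\mathbb{R}_n[x,y]$, $p(X,Y):=\sum a_{ij}Y^iX^j\in\mathcal{C}_{\mathcal{M}(n)}$, where $Y^iX^j$ denotes the corresponding column. $\mathcal{M}(n)$ is recursively generated if whenever $p,q,pq\in\mathbb{R}_n[x,y]$ and $p(X,Y)=0$, then $(pq)(X,Y)=0$. The variety is $\mathcal{V}(\mathcal{M}(n)):=\bigcap\{\mathcal{Z}(p):p\in\mathbb{R}_n[x,y],\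 p(X,Y)=0\}$, with $\mathcal{Z}(p)$ the real zero set of $p$. A (moment matrix) extension $\mathcal{M}(n+1)$ of $\mathcal{M}(n)(\beta)$ is a moment matrix $\mathcal{M}(n+1)(\check\beta)$ of a real sequence $\check\beta=\check\beta^{(2n+2)}$ with $\check\beta_{ij}=\beta_{ij}$ for $i+j\le2n$. For a positive $\mathcal{M}(n)$, it is a flat extension if $\operatorname{rank}\mathcal{M}(n+1)=\operatorname{rank}\mathcal{M}(n)$ and $\mathcal{M}(n+1)$ is positive (for moment matrix extensions of a positive $\mathcal{M}(n)$, the rank condition already forces positivity). Similarly with $n$ replaced by $n+1$. *)

theory Defs
  imports
    "HOL-Analysis.Analysis"
    "HOL-Computational_Algebra.Polynomial"
    "HOL-Library.Extended_Nat"
    "Jordan_Normal_Form.DL_Rank"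
begin

(* A polynomial p(x,y) = sum a_ij y^i x^j is an element of R[x][y]: the outer variable is y and
   the inner one is x, so that a_ij = coeff (coeff p i) j. *)
type_synonym bipoly = "real poly poly"

definition eval2 :: "bipoly \<Rightarrow> real \<Rightarrow> real \<Rightarrow> real" where
  "eval2 p x y = poly (poly p [:y:]) x"

definition polys_upto :: "nat \<Rightarrow> bipoly set" where
  "polys_upto n = {p. \<forall>i j. coeff (coeff p i) j \<noteq> 0 \<longrightarrow> i + j \<le> n}"

definition zero_set :: "bipoly \<Rightarrow> (real \<times> real) set" where
  "zero_set p = {(x, y). eval2 p x y = 0}"

(* Q = A x^2 + B x y + C y^2 + D x + E y + F with B^2 - 4 A C > 0; pairs of intersecting lines
   are included. *)
definition hyperbola_poly :: "bipoly \<Rightarrow> bool" where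
  "hyperbola_poly Q \<longleftrightarrow>
     (\<exists>A B C D E F. Q = [: [:F, D, A:], [:E, B:], [:C:] :] \<and> B\<^sup>2 - 4 * A * C > 0)"

lemma eval2_quadratic:
  "eval2 [: [:F, D, A:], [:E, B:], [:C:] :] x y
     = A * x\<^sup>2 + B * x * y + C * y\<^sup>2 + D * x + E * y + F"
  by (simp add: eval2_def algebra_simps power2_eq_square)

(* A truncated sequence of degree 2n is a function of two indices of which only the values at
   i + j \<le> 2n are ever used. The pair (i, j) stands for the monomial y^i x^j; the order is
   1, X, Y, X^2, YX, Y^2, ... *)
definition monomials :: "nat \<Rightarrow> (nat \<times> nat) list" where
  "monomials n = concat (map (\<lambda>d. map (\<lambda>i. (i, d - i)) [0..<Suc d]) [0..<Suc n])"

definition msize :: "nat \<Rightarrow> nat" where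
  "msize n = (n + 1) * (n + 2) div 2"

lemma length_monomials: "length (monomials n) = msize n"
proof -
  have "2 * length (monomials n) = (n + 1) * (n + 2)"
    by (induction n) (simp_all add: monomials_def algebra_simps)
  then show ?thesis
    by (simp add: msize_def)
qed

definition moment_matrix :: "nat \<Rightarrow> (nat \<Rightarrow> nat \<Rightarrow> real) \<Rightarrow> real mat" where
  "moment_matrix n \<beta> = mat (msize n) (msize n)
     (\<lambda>(r, c). let (i, j) = monomials n ! r; (k, l) = monomials n ! c in \<beta> (i + k) (j + l))"

definition mrank :: "nat \<Rightarrow> (nat \<Rightarrow> nat \<Rightarrow> real) \<Rightarrow> nat" where
  "mrank n \<beta> = vec_space.rank (msize n) (moment_matrix n \<beta>)"

definition positive_semidefinite :: "real mat \<Rightarrow> bool" where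
  "positive_semidefinite A \<longleftrightarrow> square_mat A \<and> transpose_mat A = A \<and>
     (\<forall>v \<in> carrier_vec (dim_row A). scalar_prod v (mult_mat_vec A v) \<ge> 0)"

definition coeff_vec :: "nat \<Rightarrow> bipoly \<Rightarrow> real Matrix.vec" where
  "coeff_vec n p = Matrix.vec (msize n)
     (\<lambda>c. let (i, j) = monomials n ! c in coeff (coeff p i) j)"

(* The element p(X,Y) = sum a_ij Y^i X^j of the column space, i.e. the linear combination of the
   columns of the moment matrix with coefficients a_ij; meaningful for p of degree at most n. *)
definition poly_column :: "nat \<Rightarrow> (nat \<Rightarrow> nat \<Rightarrow> real) \<Rightarrow> bipoly \<Rightarrow> real Matrix.vec" where
  "poly_column n \<beta> p = mult_mat_vec (moment_matrix n \<beta>) (coeff_vec n p)"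

definition column_relation :: "nat \<Rightarrow> (nat \<Rightarrow> nat \<Rightarrow> real) \<Rightarrow> bipoly \<Rightarrow> bool" where
  "column_relation n \<beta> p \<longleftrightarrow> p \<in> polys_upto n \<and> poly_column n \<beta> p = zero_vec (msize n)"

definition recursively_generated :: "nat \<Rightarrow> (nat \<Rightarrow> nat \<Rightarrow> real) \<Rightarrow> bool" where
  "recursively_generated n \<beta> \<longleftrightarrow>
     (\<forall>p q. p \<in> polys_upto n \<and> q \<in> polys_upto n \<and> p * q \<in> polys_upto n \<and>
        column_relation n \<beta> p \<longrightarrow> column_relation n \<beta> (p * q))"

definition variety :: "nat \<Rightarrow> (nat \<Rightarrow> nat \<Rightarrow> real) \<Rightarrow> (real \<times> real) set" where
  "variety n \<beta> = \<Inter> (zero_set ` {p. column_relation n \<beta> p})"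

(* The moment matrix of order m of \<beta>' extends the one of order n of \<beta> (for m > n). *)
definition extends_moments :: "nat \<Rightarrow> (nat \<Rightarrow> nat \<Rightarrow> real) \<Rightarrow> (nat \<Rightarrow> nat \<Rightarrow> real) \<Rightarrow> bool" where
  "extends_moments n \<beta> \<beta>' \<longleftrightarrow> (\<forall>i j. i + j \<le> 2 * n \<longrightarrow> \<beta>' i j = \<beta> i j)"

definition flat_extension :: "nat \<Rightarrow> (nat \<Rightarrow> nat \<Rightarrow> real) \<Rightarrow> (nat \<Rightarrow> nat \<Rightarrow> real) \<Rightarrow> bool" where
  "flat_extension n \<beta> \<beta>' \<longleftrightarrow> extends_moments n \<beta> \<beta>' \<and>
     positive_semidefinite (moment_matrix (n + 1) \<beta>') \<and> mrank (n + 1) \<beta>' = mrank n \<beta>"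

definition convergent_moments :: "nat \<Rightarrow> (real \<times> real) measure \<Rightarrow> bool" where
  "convergent_moments d \<mu> \<longleftrightarrow> (\<forall>i j. i + j \<le> d \<longrightarrow> integrable \<mu> (\<lambda>(x, y). y ^ i * x ^ j))"

definition representing_measure ::
    "nat \<Rightarrow> (nat \<Rightarrow> nat \<Rightarrow> real) \<Rightarrow> (real \<times> real) measure \<Rightarrow> bool" where
  "representing_measure n \<beta> \<mu> \<longleftrightarrow> sets \<mu> = sets borel \<and> convergent_moments (2 * n) \<mu> \<and>
     (\<forall>i j. i + j \<le> 2 * n \<longrightarrow> \<beta> i j = (\<integral>(x, y). y ^ i * x ^ j \<partial>\<mu>))"

definition supp :: "'a::topological_space measure \<Rightarrow> 'a set" where
  "supp \<mu> = {z. \<forall>U. open U \<and> z \<in> U \<longrightarrow> emeasure \<mu> U > 0}"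

(* Infinite sets must not get cardinality 0, as they do under card. *)
definition ecard :: "'a set \<Rightarrow> enat" where
  "ecard S = (if finite S then enat (card S) else \<infinity>)"

definition all_equivalent :: "bool list \<Rightarrow> bool" where
  "all_equivalent Ps \<longleftrightarrow> (\<forall>P \<in> set Ps. \<forall>R \<in> set Ps. P \<longleftrightarrow> R)"

end

theory Submission
  imports Defs "Jordan_Normal_Form.Spectral_Radius"
begin

text \<open>Let \<open>L\<close> be the linear functional on polynomials given by \<open>\<beta>\<close>. In affine coordinates with
  \<open>Q\<close> proportional to \<open>u v - c\<close>, a polynomial of degree at most \<open>n\<close> is modulo \<open>Q\<close> a combination of the
  \<open>2n + 1\<close> monomials \<open>1, u, \<dots>, u\<^sup>n, v, \<dots>, v\<^sup>n\<close>, so extending \<open>L\<close> by one degree means choosing its values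
  on the next two powers of \<open>u\<close> and of \<open>v\<close>. This is possible as soon as multiplication by \<open>u\<close> or \<open>v\<close>
  preserves null polynomials whenever the product still has degree at most \<open>n\<close> modulo \<open>Q\<close>. If the rank is
  at most \<open>2n\<close>, the mixed moment of the two new top monomials automatically has the value that makes the
  extension flat; in full rank the extension gains at most one dimension and the next one is flat. The
  preservation property follows from a recursively generated extension, and also from a variety with at
  least as many points as the rank: unless it contains a line, such points impose independent conditions,
  so the null polynomials are exactly those vanishing there.

  A flat functional is finitely atomic: a joint eigenvector of the multiplication operators represents a
  point evaluation, and subtracting the right multiple of it lowers the rank by one.\<close>

subsection \<open>Linear dependence, rank and eigenvectors\<close>

text \<open>Recursive generation controls a product only if its actual degree is at most
  \<open>n\<close>, whereas \<open>u * f\<close> may have degree \<open>n + 1\<close> and still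
  reduce to degree \<open>n\<close> modulo \<open>Q\<close>; \<open>u_recursive\<close> and
  \<open>v_recursive\<close> close this gap. Modulo \<open>Q\<close> the degrees
  \<open>2 n + 1\<close> and \<open>2 n + 2\<close> each bring only two new monomials, pure powers
  of \<open>u\<close> and \<open>v\<close>, while \<open>u ^ (n + 1) * v ^ (n + 1)\<close> is
  congruent to the constant \<open>c ^ (n + 1)\<close>. So in the two by two Schur complement of the
  extension the diagonal is free and the off-diagonal entry \<open>\<tau>\<close> is forced. A null
  polynomial \<open>g\<close> with a \<open>u ^ n\<close> term forces \<open>\<tau> = 0\<close>: up
  to scaling \<open>u * g\<close> is \<open>u ^ (n + 1) + h\<close>, orthogonal to degree
  \<open>n\<close>, and its product with \<open>v ^ (n + 1)\<close> reduces to
  \<open>c * v ^ n * g\<close>, where the functional vanishes. In full rank no such \<open>g\<close>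
  exists; there the diagonal entries \<open>\<bar>\<tau>\<bar>\<close> leave a null vector that
  involves both new monomials, and the same mechanism works one degree higher.\<close>

lemma exists_dependency_nat:
  fixes a :: "nat \<Rightarrow> nat \<Rightarrow> real"
  assumes "r < k"
  shows "\<exists>x. (\<exists>i<k. x i \<noteq> 0) \<and> (\<forall>j<r. (\<Sum>i<k. x i * a i j) = 0)"
proof -
  \<comment> \<open>Rows from \<open>r\<close> on are zero; expanding along row \<open>r\<close>
    gives determinant 0, hence a kernel vector.\<close>
  define A where "A = mat k k (\<lambda>(j, i). if j < r then a i j else 0)"
  have A: "A \<in> carrier_mat k k"
    by (simp add: A_def)
  have "det A = (\<Sum>j<k. A $$ (r, j) * cofactor A r j)"
    by (rule laplace_expansion_row[OF A \<open>r < k\<close>])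
  also have "\<dots> = 0"
    using \<open>r < k\<close> by (intro sum.neutral) (simp add: A_def)
  finally obtain v where v: "v \<in> carrier_vec k" "v \<noteq> 0\<^sub>v k" "A *\<^sub>v v = 0\<^sub>v k"
    using det_0_iff_vec_prod_zero_field[OF A] by blast
  have "\<exists>i<k. vec_index v i \<noteq> 0"
    using v(1,2) by (metis carrier_vecD eq_vecI index_zero_vec(1,2))
  moreover have "(\<Sum>i<k. vec_index v i * a i j) = 0" if "j < r" for j
  proof -
    have "vec_index (A *\<^sub>v v) j = 0"
      using v(3) that \<open>r < k\<close> by simp
    moreover have "vec_index (A *\<^sub>v v) j = (\<Sum>i<k. vec_index v i * a i j)"
      using that \<open>r < k\<close> v(1)
      by (auto simp: A_def scalar_prod_def lessThan_atLeast0 intro!: sum.cong)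
    ultimately show ?thesis by simp
  qed
  ultimately show ?thesis
    by (intro exI[of _ "\<lambda>i. vec_index v i"]) blast
qed

lemma exists_dependency:
  fixes a :: "'a \<Rightarrow> 'b \<Rightarrow> real"
  assumes "finite I" "finite J" "card J < card I"
  shows "\<exists>x. (\<exists>i\<in>I. x i \<noteq> 0) \<and> (\<forall>j\<in>J. (\<Sum>i\<in>I. x i * a i j) = 0)"
proof -
  obtain f g where f: "bij_betw f {..<card I} I" and g: "bij_betw g {..<card J} J"
    using assms ex_bij_betw_nat_finite by (metis lessThan_atLeast0)
  obtain x where x: "\<exists>i<card I. x i \<noteq> 0"
      "\<forall>j<card J. (\<Sum>i<card I. x i * a (f i) (g j)) = 0"
    using exists_dependency_nat[OF assms(3), of "\<lambda>i j. a (f i) (g j)"] by blast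
  let ?x = "\<lambda>i. x (inv_into {..<card I} f i)"
  have inv: "?x (f i) = x i" if "i < card I" for i
    using f that by (simp add: bij_betw_def inv_into_f_f)
  have "\<exists>i\<in>I. ?x i \<noteq> 0"
    using x(1) inv f by (metis bij_betwE lessThan_iff)
  moreover have "(\<Sum>i\<in>I. ?x i * a i j) = 0" if "j \<in> J" for j
  proof -
    have "j \<in> g ` {..<card J}"
      using bij_betw_imp_surj_on[OF g] that by simp
    then obtain j' where j': "j' < card J" "j = g j'"
      by auto
    have "(\<Sum>i\<in>I. ?x i * a i j) = (\<Sum>i<card I. ?x (f i) * a (f i) j)"
      by (rule sum.reindex_bij_betw[OF f, symmetric])
    also have "\<dots> = (\<Sum>i<card I. x i * a (f i) (g j'))"
      by (intro sum.cong) (auto simp: inv j')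
    finally show ?thesis
      using x(2) j' by simp
  qed
  ultimately show ?thesis
    by (intro exI[of _ ?x]) blast
qed

text \<open>The \<open>dual\<close> family makes the \<open>r\<close> vectors \<open>b k\<close>
  independent, so \<open>M\<close> is a Gram-type product of full rank \<open>r\<close>. This is the
  only place where the column rank itself is analysed; afterwards ranks are lengths of orthonormal
  systems.\<close>

lemma rank_eq_if_symmetric_factorization:
  fixes M :: "real mat"
  assumes M: "M \<in> carrier_mat m m"
    and factor: "\<And>i j. i < m \<Longrightarrow> j < m \<Longrightarrow> M $$ (i, j) = (\<Sum>k<r. b k i * b k j)"
    and dual: "\<And>k l. k < r \<Longrightarrow> l < r \<Longrightarrow> (\<Sum>i<m. C k i * b l i) = (if k = l then 1 else 0)"
  shows "vec_space.rank m M = r"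
proof -
  interpret vec_space "TYPE(real)" m .
  have indpt_empty: "lin_indpt {}"
    by (auto simp: lin_dep_def)
  have sub: "set (cols M) \<subseteq> carrier_vec m"
    using cols_dim M by blast
  obtain S where S: "maximal S (\<lambda>T. T \<subseteq> set (cols M) \<and> lin_indpt T)" "finite S"
    using maximal_exists_superset[of "set (cols M)" "\<lambda>T. T \<subseteq> set (cols M) \<and> lin_indpt T" "{}"]
    using indpt_empty by auto
  have rank: "rank M = card S"
    by (rule rank_card_indpt[OF M S(1)])
  have Scols: "S \<subseteq> set (cols M)" and indpt: "lin_indpt S"
    using S(1) by (auto simp: maximal_def)
  then have Scarr: "S \<subseteq> carrier_vec m"
    using sub by blast
  have "\<exists>t. \<forall>i<m. M $$ (i, j) = (\<Sum>s\<in>S. t s * vec_index s i)" if "j < m" for j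
  proof -
    have colj: "col M j \<in> set (cols M)"
      using M that by (auto simp: cols_def)
    have "col M j \<in> span S"
    proof (cases "col M j \<in> S")
      case True
      then show ?thesis using Scarr by (meson span_mem)
    next
      case False
      then have "lin_dep (insert (col M j) S)"
        using S(1) colj Scols unfolding maximal_def by blast
      then show ?thesis
        using lin_dep_iff_in_span[OF Scarr indpt _ False] colj sub by (simp add: subset_iff)
    qed
    then obtain t where t: "lincomb t S = col M j"
      using finite_in_span[OF S(2) Scarr] by blast
    have "M $$ (i, j) = (\<Sum>s\<in>S. t s * vec_index s i)" if "i < m" for i
    proof -
      have "M $$ (i, j) = vec_index (lincomb t S) i"
        using t that \<open>j < m\<close> M by simp
      then show ?thesis
        using lincomb_index[OF \<open>i < m\<close> Scarr] by simp
    qed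
    then show ?thesis by blast
  qed
  then obtain t where t: "\<And>i j. i < m \<Longrightarrow> j < m \<Longrightarrow> M $$ (i, j) = (\<Sum>s\<in>S. t j s * vec_index s i)"
    by metis
  \<comment> \<open>Pairing the columns of \<open>M\<close> with \<open>C k\<close> returns
    \<open>b k\<close>, so every \<open>b k\<close> lies in the span of \<open>S\<close>; too small
    an \<open>S\<close> would make the \<open>b k\<close> dependent.\<close>
  have "\<not> card S < r"
  proof
    assume "card S < r"
    then obtain y where y: "\<exists>k<r. y k \<noteq> 0"
        "\<And>s. s \<in> S \<Longrightarrow> (\<Sum>k<r. y k * (\<Sum>j<m. C k j * t j s)) = 0"
      using exists_dependency[of "{..<r}" S "\<lambda>k s. \<Sum>j<m. C k j * t j s"] S(2) by auto
    have zero: "(\<Sum>k<r. y k * b k i) = 0" if "i < m" for i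
    proof -
      have 1: "(\<Sum>j<m. C k j * M $$ (i, j)) = b k i" if "k < r" for k
      proof -
        have "(\<Sum>j<m. C k j * M $$ (i, j)) = (\<Sum>j<m. \<Sum>l<r. b l i * (C k j * b l j))"
          using \<open>i < m\<close> by (simp add: factor sum_distrib_left algebra_simps)
        also have "\<dots> = (\<Sum>l<r. b l i * (\<Sum>j<m. C k j * b l j))"
          by (subst sum.swap) (simp add: sum_distrib_left)
        also have "\<dots> = (\<Sum>l<r. if k = l then b l i else 0)"
          using that dual by (intro sum.cong) auto
        also have "\<dots> = b k i" using that by simp
        finally show ?thesis .
      qed
      have "(\<Sum>k<r. y k * b k i) = (\<Sum>k<r. y k * (\<Sum>j<m. C k j * (\<Sum>s\<in>S. t j s * vec_index s i)))"
        using 1 t \<open>i < m\<close> by (intro sum.cong) auto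
      also have "\<dots> = (\<Sum>k<r. \<Sum>j<m. \<Sum>s\<in>S. y k * C k j * t j s * vec_index s i)"
        by (simp add: sum_distrib_left mult.assoc)
      also have "\<dots> = (\<Sum>k<r. \<Sum>s\<in>S. \<Sum>j<m. y k * C k j * t j s * vec_index s i)"
        by (intro sum.cong sum.swap refl)
      also have "\<dots> = (\<Sum>s\<in>S. \<Sum>k<r. \<Sum>j<m. y k * C k j * t j s * vec_index s i)"
        by (rule sum.swap)
      also have "\<dots> = (\<Sum>s\<in>S. (\<Sum>k<r. y k * (\<Sum>j<m. C k j * t j s)) * vec_index s i)"
        by (simp add: sum_distrib_left sum_distrib_right mult.assoc)
      also have "\<dots> = 0" using y(2) by simp
      finally show ?thesis .
    qed
    have "y l = 0" if "l < r" for l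
    proof -
      have "0 = (\<Sum>i<m. C l i * (\<Sum>k<r. y k * b k i))"
        using zero by simp
      also have "\<dots> = (\<Sum>i<m. \<Sum>k<r. y k * (C l i * b k i))"
        by (simp add: sum_distrib_left algebra_simps)
      also have "\<dots> = (\<Sum>k<r. y k * (\<Sum>i<m. C l i * b k i))"
        by (subst sum.swap) (simp add: sum_distrib_left)
      also have "\<dots> = (\<Sum>k<r. if l = k then y k else 0)"
        using that dual by (intro sum.cong) auto
      also have "\<dots> = y l" using that by simp
      finally show ?thesis by simp
    qed
    then show False using y(1) by blast
  qed
  \<comment> \<open>Conversely each column of \<open>M\<close> is a combination of the
    \<open>r\<close> vectors \<open>b k\<close>, so more than \<open>r\<close> of them are
    dependent.\<close>
  moreover have "\<not> r < card S"
  proof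
    assume less: "r < card S"
    have "\<forall>s\<in>S. \<exists>j<m. s = col M j"
      using Scols M by (fastforce simp: cols_def)
    then obtain f where f: "\<And>s. s \<in> S \<Longrightarrow> f s < m \<and> s = col M (f s)"
      by metis
    obtain y where y: "\<exists>s\<in>S. y s \<noteq> 0"
        "\<And>k. k < r \<Longrightarrow> (\<Sum>s\<in>S. y s * b k (f s)) = 0"
      using exists_dependency[of S "{..<r}" "\<lambda>s k. b k (f s)"] S(2) less by auto
    have "lincomb y S = 0\<^sub>v m"
    proof (rule eq_vecI)
      show "dim_vec (lincomb y S) = dim_vec (0\<^sub>v m)"
        using lincomb_dim[OF S(2) Scarr] by simp
    next
      fix i assume "i < dim_vec (0\<^sub>v m :: real Matrix.vec)"
      then have i: "i < m" by simp
      have entry: "vec_index s i = (\<Sum>k<r. b k i * b k (f s))" if "s \<in> S" for s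
      proof -
        have fs: "f s < m" and s: "s = col M (f s)"
          using f that by auto
        have "vec_index (col M (f s)) i = M $$ (i, f s)"
          using M i fs by simp
        then show ?thesis
          using factor[OF i fs] s by metis
      qed
      have "vec_index (lincomb y S) i = (\<Sum>s\<in>S. y s * vec_index s i)"
        by (rule lincomb_index[OF i Scarr])
      also have "\<dots> = (\<Sum>s\<in>S. \<Sum>k<r. b k i * (y s * b k (f s)))"
        using entry by (simp add: sum_distrib_left algebra_simps)
      also have "\<dots> = (\<Sum>k<r. b k i * (\<Sum>s\<in>S. y s * b k (f s)))"
        by (subst sum.swap) (simp add: sum_distrib_left)
      also have "\<dots> = 0" using y(2) by simp
      finally show "vec_index (lincomb y S) i = vec_index (0\<^sub>v m) i" using i by simp
    qed
    then have "lin_dep S"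
      using y(1) S(2) unfolding lin_dep_def by auto
    then show False using indpt by simp
  qed
  ultimately show ?thesis using rank by simp
qed

text \<open>Real and imaginary parts of \<open>(A + iB) (s + it) = (a + ib) (s + it)\<close>,
  spelled out because polynomials and functionals stay real; a complex matrix of positive size has
  nonempty spectrum.\<close>

lemma exists_complex_eigenvector:
  fixes A B :: "nat \<Rightarrow> nat \<Rightarrow> real"
  assumes "r > 0"
  shows "\<exists>a b s t. (\<exists>i<r. s i \<noteq> 0 \<or> t i \<noteq> 0) \<and>
    (\<forall>i<r. (\<Sum>j<r. A i j * s j - B i j * t j) = a * s i - b * t i \<and>
           (\<Sum>j<r. A i j * t j + B i j * s j) = a * t i + b * (s i :: real))"
proof -
  define T where "T = mat r r (\<lambda>(i, j). Complex (A i j) (B i j))"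
  have T: "T \<in> carrier_mat r r" by (simp add: T_def)
  obtain e where "eigenvalue T e"
    using spectrum_non_empty[OF T \<open>r > 0\<close>] by (auto simp: spectrum_def)
  then obtain w where w: "w \<in> carrier_vec r" "w \<noteq> 0\<^sub>v r" "T *\<^sub>v w = e \<cdot>\<^sub>v w"
    using T by (auto simp: eigenvalue_def eigenvector_def)
  have "\<exists>i<r. vec_index w i \<noteq> 0"
    using w(1,2) by (metis carrier_vecD eq_vecI index_zero_vec(1,2))
  then have nonzero: "\<exists>i<r. Re (vec_index w i) \<noteq> 0 \<or> Im (vec_index w i) \<noteq> 0"
    by (metis complex_eq_iff zero_complex.simps)
  have "(\<Sum>j<r. Complex (A i j) (B i j) * vec_index w j) = e * vec_index w i" if "i < r" for i
  proof -
    have "vec_index (T *\<^sub>v w) i = (\<Sum>j<r. Complex (A i j) (B i j) * vec_index w j)"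
      using that w(1) by (auto simp: T_def scalar_prod_def lessThan_atLeast0 intro!: sum.cong)
    then show ?thesis using that w(1,3) by simp
  qed
  note eigen = this
  have re: "(\<Sum>j<r. A i j * Re (vec_index w j) - B i j * Im (vec_index w j))
      = Re e * Re (vec_index w i) - Im e * Im (vec_index w i)" if "i < r" for i
    using arg_cong[OF eigen[OF that], of Re] by simp
  have im: "(\<Sum>j<r. A i j * Im (vec_index w j) + B i j * Re (vec_index w j))
      = Re e * Im (vec_index w i) + Im e * Re (vec_index w i)" if "i < r" for i
    using arg_cong[OF eigen[OF that], of Im] by simp
  show ?thesis
    by (rule exI[of _ "Re e"], rule exI[of _ "Im e"], rule exI[of _ "\<lambda>i. Re (vec_index w i)"],
        rule exI[of _ "\<lambda>i. Im (vec_index w i)"]) (intro conjI nonzero allI impI re im)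
qed

subsection \<open>Bivariate polynomials and linear functionals\<close>

definition cst :: "real \<Rightarrow> bipoly" where
  "cst a = [:[:a:]:]"

definition mon :: "nat \<Rightarrow> nat \<Rightarrow> bipoly" where
  "mon i j = monom (monom 1 j) i"

definition idx :: "nat \<Rightarrow> (nat \<times> nat) set" where
  "idx n = {(i, j). i + j \<le> n}"

lemma cst_simps [simp]:
  "cst 0 = 0" "cst 1 = 1" "cst (a + b) = cst a + cst b" "cst (a * b) = cst a * cst b"
  "cst (- a) = - cst a" "cst (a - b) = cst a - cst b"
  by (simp_all add: cst_def one_pCons)

lemma coeff_cst_mult [simp]: "coeff (coeff (cst a * p) i) j = a * coeff (coeff p i) j"
  by (simp add: cst_def)

lemma coeff_cst: "coeff (coeff (cst a) i) j = (if i = 0 \<and> j = 0 then a else 0)"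
  by (simp add: cst_def coeff_pCons split: nat.split)

lemma coeff_mon: "coeff (coeff (mon i j) k) l = (if k = i \<and> l = j then 1 else 0)"
  by (auto simp: mon_def)

lemma mon_mult: "mon i j * mon k l = mon (i + k) (j + l)"
  by (simp add: mon_def mult_monom)

text \<open>Fill the first factor greedily with powers of \<open>y\<close>, then of
  \<open>x\<close>. Claims about a functional in degree \<open>m + n\<close> thereby become claims
  about products.\<close>

lemma mon_split:
  assumes "i + j \<le> m + n"
  obtains i1 j1 i2 j2 where "mon i j = mon i1 j1 * mon i2 j2" "i1 + j1 \<le> m" "i2 + j2 \<le> n"
proof -
  define k where "k = min i m"
  define l where "l = min j (m - k)"
  show ?thesis
    by (rule that[of k l "i - k" "j - l"]) (use assms in \<open>auto simp: mon_mult k_def l_def\<close>)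
qed

lemma mon_0 [simp]: "mon 0 0 = 1"
  by (simp add: mon_def)

lemma finite_idx [simp]: "finite (idx n)"
  by (rule finite_subset[of _ "{..n} \<times> {..n}"]) (auto simp: idx_def)

lemma bipoly_eqI:
  fixes p q :: bipoly
  assumes "\<And>i j. coeff (coeff p i) j = coeff (coeff q i) j"
  shows "p = q"
  using assms by (intro poly_eqI) auto

lemma polys_upto_0 [simp]: "0 \<in> polys_upto n"
  and polys_upto_add: "p \<in> polys_upto n \<Longrightarrow> q \<in> polys_upto n \<Longrightarrow> p + q \<in> polys_upto n"
  and polys_upto_diff: "p \<in> polys_upto n \<Longrightarrow> q \<in> polys_upto n \<Longrightarrow> p - q \<in> polys_upto n"
  and polys_upto_scale: "p \<in> polys_upto n \<Longrightarrow> cst a * p \<in> polys_upto n"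
  and cst_polys_upto: "cst a \<in> polys_upto n"
  and mon_polys_upto: "i + j \<le> n \<Longrightarrow> mon i j \<in> polys_upto n"
  by (auto simp: polys_upto_def coeff_cst coeff_mon) (metis add.right_neutral, metis diff_zero)

lemma polys_upto_sum: "(\<And>i. i \<in> I \<Longrightarrow> f i \<in> polys_upto n) \<Longrightarrow> sum f I \<in> polys_upto n"
  by (induction I rule: infinite_finite_induct) (auto intro: polys_upto_add)

lemma polys_upto_mono: "p \<in> polys_upto m \<Longrightarrow> m \<le> n \<Longrightarrow> p \<in> polys_upto n"
  by (auto simp: polys_upto_def intro: order_trans)

lemma polys_upto_Suc: "p \<in> polys_upto n \<Longrightarrow> p \<in> polys_upto (Suc n)"
  by (rule polys_upto_mono[OF _ le_SucI[OF order_refl]])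

lemma one_polys_upto [simp]: "1 \<in> polys_upto n"
  using cst_polys_upto[of 1] by simp

lemma polys_upto_mult:
  assumes "p \<in> polys_upto m" "q \<in> polys_upto n"
  shows "p * q \<in> polys_upto (m + n)"
proof -
  have "i + j \<le> m + n" if "coeff (coeff (p * q) i) j \<noteq> 0" for i j
  proof -
    have "(\<Sum>k\<le>i. \<Sum>l\<le>j. coeff (coeff p k) l * coeff (coeff q (i - k)) (j - l)) \<noteq> 0"
      using that by (simp add: coeff_mult coeff_sum)
    from sum.not_neutral_contains_not_neutral[OF this] obtain k where k: "k \<le> i"
        "(\<Sum>l\<le>j. coeff (coeff p k) l * coeff (coeff q (i - k)) (j - l)) \<noteq> 0"
      by auto
    obtain l where "l \<le> j" "coeff (coeff p k) l * coeff (coeff q (i - k)) (j - l) \<noteq> 0"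
      using sum.not_neutral_contains_not_neutral[OF k(2)] by auto
    then have "coeff (coeff p k) l \<noteq> 0" "coeff (coeff q (i - k)) (j - l) \<noteq> 0"
      by auto
    with assms have "k + l \<le> m" "(i - k) + (j - l) \<le> n"
      unfolding polys_upto_def mem_Collect_eq by blast+
    then show ?thesis using k(1) \<open>l \<le> j\<close> by linarith
  qed
  then show ?thesis by (auto simp: polys_upto_def)
qed

lemma polys_upto_mult':
  "p \<in> polys_upto a \<Longrightarrow> q \<in> polys_upto b \<Longrightarrow> a + b \<le> n \<Longrightarrow> p * q \<in> polys_upto n"
  using polys_upto_mult polys_upto_mono by blast

lemma polys_upto_power: "p \<in> polys_upto 1 \<Longrightarrow> p ^ k \<in> polys_upto k"
  by (induction k) (auto intro: polys_upto_mult')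

lemma bipoly_expansion:
  assumes "p \<in> polys_upto n"
  shows "p = (\<Sum>ij\<in>idx n. cst (coeff (coeff p (fst ij)) (snd ij)) * mon (fst ij) (snd ij))"
proof (rule bipoly_eqI)
  fix k l
  have "coeff (coeff (\<Sum>ij\<in>idx n. cst (coeff (coeff p (fst ij)) (snd ij)) * mon (fst ij) (snd ij)) k) l
      = (\<Sum>ij\<in>idx n. coeff (coeff p (fst ij)) (snd ij) * (if k = fst ij \<and> l = snd ij then 1 else 0))"
    by (simp add: coeff_sum coeff_mon)
  also have "\<dots> = (\<Sum>ij\<in>idx n. if ij = (k, l) then coeff (coeff p k) l else 0)"
    by (intro sum.cong) auto
  also have "\<dots> = (if (k, l) \<in> idx n then coeff (coeff p k) l else 0)"
    by (rule sum.delta) simp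
  also have "\<dots> = coeff (coeff p k) l"
    using assms by (auto simp: idx_def polys_upto_def)
  finally show "coeff (coeff p k) l
      = coeff (coeff (\<Sum>ij\<in>idx n. cst (coeff (coeff p (fst ij)) (snd ij)) * mon (fst ij) (snd ij)) k) l" ..
qed

lemma polys_upto_induct [consumes 1, case_names zero add mon]:
  assumes "p \<in> polys_upto n" and "R 0"
    and "\<And>p q. p \<in> polys_upto n \<Longrightarrow> q \<in> polys_upto n \<Longrightarrow> R p \<Longrightarrow> R q \<Longrightarrow> R (p + q)"
    and "\<And>a i j. i + j \<le> n \<Longrightarrow> R (cst a * mon i j)"
  shows "R p"
proof -
  let ?f = "\<lambda>ij. cst (coeff (coeff p (fst ij)) (snd ij)) * mon (fst ij) (snd ij)"
  have "(\<Sum>ij\<in>I. ?f ij) \<in> polys_upto n \<and> R (\<Sum>ij\<in>I. ?f ij)" if "I \<subseteq> idx n" for I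
    using finite_subset[OF that finite_idx] that
  proof (induction I rule: finite_induct)
    case empty
    then show ?case using assms(2) by simp
  next
    case (insert ij I)
    then have "fst ij + snd ij \<le> n"
      by (auto simp: idx_def)
    then show ?case
      using insert
      by (auto intro!: assms(3,4) polys_upto_add polys_upto_scale mon_polys_upto)
  qed
  from this[of "idx n"] bipoly_expansion[OF assms(1)] show ?thesis
    by simp
qed

lemma finite_support_bipoly: "finite {(i, j). coeff (coeff (p :: bipoly) i) j \<noteq> 0}"
proof (rule finite_subset)
  show "{(i, j). coeff (coeff p i) j \<noteq> 0} \<subseteq> (SIGMA i:{..degree p}. {..degree (coeff p i)})"
    by (auto intro: le_degree)
qed auto

lemma exists_polys_upto: "\<exists>n. (p :: bipoly) \<in> polys_upto n"
proof -
  let ?S = "{(i, j). coeff (coeff p i) j \<noteq> 0}"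
  have "p \<in> polys_upto (\<Sum>(i, j)\<in>?S. i + j)"
    unfolding polys_upto_def
  proof (clarify)
    fix i j assume "coeff (coeff p i) j \<noteq> 0"
    then have "(i, j) \<in> ?S" by simp
    from member_le_sum[OF this, of "\<lambda>(i, j). i + j"] finite_support_bipoly[of p]
    show "i + j \<le> (\<Sum>(i, j)\<in>?S. i + j)" by simp
  qed
  then show ?thesis ..
qed

lemma eval2_simps [simp]:
  "eval2 0 x y = 0" "eval2 1 x y = 1" "eval2 (cst a) x y = a" "eval2 (mon i j) x y = y ^ i * x ^ j"
  "eval2 (p + q) x y = eval2 p x y + eval2 q x y"
  "eval2 (p - q) x y = eval2 p x y - eval2 q x y"
  "eval2 (- p) x y = - eval2 p x y"
  "eval2 (p * q) x y = eval2 p x y * eval2 q x y"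
  "eval2 (p ^ k) x y = eval2 p x y ^ k"
proof -
  show "eval2 (p ^ k) x y = eval2 p x y ^ k"
    by (induction k) (simp_all add: eval2_def)
qed (simp_all add: eval2_def cst_def mon_def poly_monom)

definition linear_functional :: "(bipoly \<Rightarrow> real) \<Rightarrow> bool" where
  "linear_functional L \<longleftrightarrow> (\<forall>p q. L (p + q) = L p + L q) \<and> (\<forall>a p. L (cst a * p) = a * L p)"

lemma
  assumes "linear_functional L"
  shows linear_functional_add: "L (p + q) = L p + L q"
    and linear_functional_scale: "L (cst a * p) = a * L p"
    and linear_functional_0: "L 0 = 0"
    and linear_functional_uminus: "L (- p) = - L p"
    and linear_functional_diff: "L (p - q) = L p - L q"
    and linear_functional_sum: "L (sum f I) = (\<Sum>i\<in>I. L (f i))"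
proof -
  show add: "L (p + q) = L p + L q" and scale: "L (cst a * p) = a * L p" for p q a
    using assms by (auto simp: linear_functional_def)
  show zero: "L 0 = 0"
    using scale[of 0 0] by simp
  show minus: "L (- p) = - L p" for p
    using scale[of "-1" p] by simp
  show "L (p - q) = L p - L q"
    using add[of p "- q"] minus[of q] by simp
  show "L (sum f I) = (\<Sum>i\<in>I. L (f i))"
    by (induction I rule: infinite_finite_induct) (auto simp: zero add)
qed

lemmas linear_functional_simps = linear_functional_add linear_functional_scale linear_functional_0
  linear_functional_uminus linear_functional_diff linear_functional_sum

lemma linear_functional_combine:
  assumes "linear_functional L" "linear_functional K"
  shows "linear_functional (\<lambda>p. L p + a * K p)"
  using assms by (simp add: linear_functional_def algebra_simps)

lemma linear_functional_eval2: "linear_functional (\<lambda>p. eval2 p x y)"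
  by (simp add: linear_functional_def)

lemma linear_functional_mult: "linear_functional L \<Longrightarrow> linear_functional (\<lambda>p. L (q * p))"
  unfolding linear_functional_def by (metis distrib_left mult.left_commute)

lemma linear_functional_eqI:
  assumes "linear_functional L" "linear_functional K" "p \<in> polys_upto n"
    and "\<And>i j. i + j \<le> n \<Longrightarrow> L (mon i j) = K (mon i j)"
  shows "L p = K p"
  using assms(3)
  by (induction rule: polys_upto_induct)
    (simp_all add: linear_functional_simps[OF assms(1)] linear_functional_simps[OF assms(2)] assms(4))

text \<open>Total on all polynomials, so above the truncation degree it depends on entries of
  \<open>\<beta>\<close> that carry no information; for this reason functionals are compared only up
  to degree \<open>2 * n\<close>.\<close>

definition riesz :: "(nat \<Rightarrow> nat \<Rightarrow> real) \<Rightarrow> bipoly \<Rightarrow> real" where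
  "riesz \<beta> p = (\<Sum>(i, j)\<in>{(i, j). coeff (coeff p i) j \<noteq> 0}. coeff (coeff p i) j * \<beta> i j)"

lemma riesz_upto:
  assumes "p \<in> polys_upto n"
  shows "riesz \<beta> p = (\<Sum>(i, j)\<in>idx n. coeff (coeff p i) j * \<beta> i j)"
  unfolding riesz_def using assms
  by (intro sum.mono_neutral_left[OF finite_idx]) (auto simp: idx_def polys_upto_def)

lemma linear_functional_riesz: "linear_functional (riesz \<beta>)"
  unfolding linear_functional_def
proof (intro conjI allI)
  fix p q :: bipoly and a
  obtain n m where "p \<in> polys_upto n" "q \<in> polys_upto m"
    using exists_polys_upto by blast
  then have p: "p \<in> polys_upto (max n m)" and q: "q \<in> polys_upto (max n m)"
    by (auto intro: polys_upto_mono)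
  show "riesz \<beta> (p + q) = riesz \<beta> p + riesz \<beta> q"
    using riesz_upto[OF p, of \<beta>] riesz_upto[OF q, of \<beta>] riesz_upto[OF polys_upto_add[OF p q], of \<beta>]
    by (simp add: case_prod_beta distrib_right sum.distrib)
  show "riesz \<beta> (cst a * p) = a * riesz \<beta> p"
    using riesz_upto[OF p, of \<beta>] riesz_upto[OF polys_upto_scale[OF p], of \<beta> a]
    by (simp add: case_prod_beta sum_distrib_left mult.assoc)
qed

lemma riesz_mon [simp]: "riesz \<beta> (mon i j) = \<beta> i j"
proof -
  have "{(k, l). coeff (coeff (mon i j) k) l \<noteq> 0} = {(i, j)}"
    by (auto simp: coeff_mon)
  then show ?thesis by (simp add: riesz_def coeff_mon)
qed

definition moments :: "(bipoly \<Rightarrow> real) \<Rightarrow> nat \<Rightarrow> nat \<Rightarrow> real" where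
  "moments L i j = L (mon i j)"

lemma riesz_moments:
  assumes "linear_functional L"
  shows "riesz (moments L) = L"
proof
  fix p :: bipoly
  obtain n where "p \<in> polys_upto n" using exists_polys_upto by blast
  then show "riesz (moments L) p = L p"
    by (rule linear_functional_eqI[OF linear_functional_riesz assms]) (simp add: moments_def)
qed

lemma riesz_cong:
  assumes "extends_moments n \<beta> \<beta>'" "p \<in> polys_upto (2 * n)"
  shows "riesz \<beta>' p = riesz \<beta> p"
  using assms(2)
  by (rule linear_functional_eqI[OF linear_functional_riesz linear_functional_riesz])
    (use assms(1) in \<open>simp add: extends_moments_def\<close>)

lemma moments_riesz: "moments (riesz \<beta>) = \<beta>"
  by (intro ext) (simp add: moments_def)

definition psd :: "nat \<Rightarrow> (bipoly \<Rightarrow> real) \<Rightarrow> bool" where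
  "psd n L \<longleftrightarrow> (\<forall>p\<in>polys_upto n. L (p * p) \<ge> 0)"

text \<open>The radical of the bilinear form \<open>L (p * q)\<close> in degree \<open>n\<close>;
  for \<open>riesz \<beta>\<close> it consists of the column relations of the moment matrix.\<close>

definition null_polys :: "nat \<Rightarrow> (bipoly \<Rightarrow> real) \<Rightarrow> bipoly set" where
  "null_polys n L = {p \<in> polys_upto n. \<forall>q\<in>polys_upto n. L (p * q) = 0}"

definition multiplicative_null :: "nat \<Rightarrow> (bipoly \<Rightarrow> real) \<Rightarrow> bool" where
  "multiplicative_null n L \<longleftrightarrow>
    (\<forall>p\<in>null_polys n L. \<forall>q\<in>polys_upto n. p * q \<in> polys_upto n \<longrightarrow> p * q \<in> null_polys n L)"

subsection \<open>Moment matrices as bilinear forms\<close>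

lemma set_monomials: "set (monomials n) = idx n"
proof -
  have "(i, j) \<in> (\<lambda>k. (k, i + j - k)) ` {0..<Suc (i + j)}" for i j :: nat
    by (intro image_eqI[of _ _ i]) auto
  then have "(i, j) \<in> (\<Union>d\<in>{0..<Suc n}. (\<lambda>k. (k, d - k)) ` {0..<Suc d})" if "i + j \<le> n" for i j
    using that by (intro UN_I[of "i + j"]) auto
  then show ?thesis
    unfolding monomials_def idx_def set_concat set_map image_image set_upt by auto
qed

lemma distinct_monomials: "distinct (monomials n)"
  unfolding monomials_def
  by (rule distinct_concat)
    (auto simp: distinct_map inj_on_def, metis eq_diff_iff less_imp_le)

lemma sum_monomials: "(\<Sum>c<msize n. f (monomials n ! c)) = sum f (idx n)"
proof -
  have "bij_betw ((!) (monomials n)) {..<msize n} (idx n)"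
    using bij_betw_nth[OF distinct_monomials, of "{..<msize n}" n "idx n"]
    by (simp add: length_monomials set_monomials)
  from sum.reindex_bij_betw[OF this] show ?thesis .
qed

lemma moment_matrix_carrier [simp]: "moment_matrix n \<beta> \<in> carrier_mat (msize n) (msize n)"
  and dim_moment_matrix [simp]: "dim_row (moment_matrix n \<beta>) = msize n" "dim_col (moment_matrix n \<beta>) = msize n"
  by (simp_all add: moment_matrix_def)

abbreviation mon_at :: "nat \<Rightarrow> nat \<Rightarrow> bipoly" where
  "mon_at n c \<equiv> mon (fst (monomials n ! c)) (snd (monomials n ! c))"

lemma mon_at_polys_upto: "c < msize n \<Longrightarrow> mon_at n c \<in> polys_upto n"
  using nth_mem[of c "monomials n"]
  by (auto simp: length_monomials set_monomials idx_def intro!: mon_polys_upto)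

lemma moment_matrix_index:
  "r < msize n \<Longrightarrow> c < msize n \<Longrightarrow> moment_matrix n \<beta> $$ (r, c) = riesz \<beta> (mon_at n r * mon_at n c)"
  by (simp add: moment_matrix_def mon_mult case_prod_beta Let_def)

lemma coeff_vec_index:
  "c < msize n \<Longrightarrow> vec_index (coeff_vec n p) c = coeff (coeff p (fst (monomials n ! c))) (snd (monomials n ! c))"
  by (simp add: coeff_vec_def case_prod_beta Let_def)

lemma coeff_vec_carrier [simp]: "coeff_vec n p \<in> carrier_vec (msize n)"
  and dim_coeff_vec [simp]: "dim_vec (coeff_vec n p) = msize n"
  by (simp_all add: coeff_vec_def)

lemma bipoly_expansion_at:
  assumes "p \<in> polys_upto n"
  shows "p = (\<Sum>c<msize n. cst (vec_index (coeff_vec n p) c) * mon_at n c)"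
proof -
  have "p = (\<Sum>c<msize n. cst (coeff (coeff p (fst (monomials n ! c))) (snd (monomials n ! c))) * mon_at n c)"
    by (rule trans[OF bipoly_expansion[OF assms] sum_monomials[symmetric]])
  also have "\<dots> = (\<Sum>c<msize n. cst (vec_index (coeff_vec n p) c) * mon_at n c)"
    by (intro sum.cong) (simp_all add: coeff_vec_index)
  finally show ?thesis .
qed

lemma poly_column_index:
  assumes "p \<in> polys_upto n" "r < msize n"
  shows "vec_index (poly_column n \<beta> p) r = riesz \<beta> (mon_at n r * p)"
proof -
  have "vec_index (poly_column n \<beta> p) r
      = (\<Sum>c<msize n. moment_matrix n \<beta> $$ (r, c) * vec_index (coeff_vec n p) c)"
    using assms(2) by (simp add: poly_column_def scalar_prod_def lessThan_atLeast0)
  also have "\<dots> = (\<Sum>c<msize n. vec_index (coeff_vec n p) c * riesz \<beta> (mon_at n r * mon_at n c))"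
    using assms(2) by (intro sum.cong) (simp_all add: moment_matrix_index)
  also have "\<dots> = riesz \<beta> (mon_at n r * (\<Sum>c<msize n. cst (vec_index (coeff_vec n p) c) * mon_at n c))"
    by (simp add: sum_distrib_left linear_functional_sum[OF linear_functional_riesz]
        mult.left_commute[of _ "cst _"] linear_functional_scale[OF linear_functional_riesz])
  also have "\<dots> = riesz \<beta> (mon_at n r * p)"
    using bipoly_expansion_at[OF assms(1)] by simp
  finally show ?thesis .
qed

lemma scalar_prod_poly_column:
  assumes "p \<in> polys_upto n" "q \<in> polys_upto n"
  shows "scalar_prod (coeff_vec n p) (poly_column n \<beta> q) = riesz \<beta> (p * q)"
proof -
  have "dim_vec (poly_column n \<beta> q) = msize n"
    by (simp add: poly_column_def moment_matrix_def)
  then have "scalar_prod (coeff_vec n p) (poly_column n \<beta> q)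
      = (\<Sum>c<msize n. vec_index (coeff_vec n p) c * riesz \<beta> (mon_at n c * q))"
    by (simp add: scalar_prod_def lessThan_atLeast0 poly_column_index[OF assms(2)])
  also have "\<dots> = riesz \<beta> ((\<Sum>c<msize n. cst (vec_index (coeff_vec n p) c) * mon_at n c) * q)"
    by (simp add: sum_distrib_right linear_functional_sum[OF linear_functional_riesz]
        mult.assoc linear_functional_scale[OF linear_functional_riesz])
  also have "\<dots> = riesz \<beta> (p * q)"
    using bipoly_expansion_at[OF assms(1)] by simp
  finally show ?thesis .
qed

text \<open>The entries of a column are the values of the functional against the monomials, which
  span degree \<open>n\<close>.\<close>

lemma column_relation_iff: "column_relation n \<beta> p \<longleftrightarrow> p \<in> null_polys n (riesz \<beta>)"
proof (cases "p \<in> polys_upto n")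
  case p: True
  have dim: "dim_vec (poly_column n \<beta> p) = msize n"
    by (simp add: poly_column_def moment_matrix_def)
  show ?thesis
  proof
    assume "column_relation n \<beta> p"
    then have "poly_column n \<beta> p = 0\<^sub>v (msize n)"
      by (simp add: column_relation_def)
    then have "riesz \<beta> (q * p) = 0" if "q \<in> polys_upto n" for q
      using scalar_prod_poly_column[OF that p, of \<beta>] coeff_vec_carrier[of n q] by simp
    then show "p \<in> null_polys n (riesz \<beta>)"
      using p by (simp add: null_polys_def mult.commute[of p])
  next
    assume "p \<in> null_polys n (riesz \<beta>)"
    then have "riesz \<beta> (mon_at n c * p) = 0" if "c < msize n" for c
      using mon_at_polys_upto[OF that] by (simp add: null_polys_def mult.commute[of _ p])
    then have "poly_column n \<beta> p = 0\<^sub>v (msize n)"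
      using poly_column_index[OF p] dim by (intro eq_vecI) auto
    then show "column_relation n \<beta> p"
      using p by (simp add: column_relation_def)
  qed
qed (simp add: column_relation_def null_polys_def)

lemma positive_semidefinite_iff: "positive_semidefinite (moment_matrix n \<beta>) \<longleftrightarrow> psd n (riesz \<beta>)"
proof
  assume *: "positive_semidefinite (moment_matrix n \<beta>)"
  show "psd n (riesz \<beta>)"
    unfolding psd_def
  proof
    fix p assume p: "p \<in> polys_upto n"
    have "dim_row (moment_matrix n \<beta>) = msize n" by (simp add: moment_matrix_def)
    then have "scalar_prod (coeff_vec n p) (poly_column n \<beta> p) \<ge> 0"
      using * by (simp add: positive_semidefinite_def poly_column_def)
    then show "riesz \<beta> (p * p) \<ge> 0"
      using scalar_prod_poly_column[OF p p] by simp
  qed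
next
  assume *: "psd n (riesz \<beta>)"
  have "moment_matrix n \<beta> $$ (i, j) = moment_matrix n \<beta> $$ (j, i)" if "i < msize n" "j < msize n" for i j
    using that by (simp add: moment_matrix_index mult.commute)
  then have "transpose_mat (moment_matrix n \<beta>) = moment_matrix n \<beta>"
    by (intro eq_matI) (auto simp: moment_matrix_def)
  moreover have "scalar_prod v (moment_matrix n \<beta> *\<^sub>v v) \<ge> 0" if v: "v \<in> carrier_vec (msize n)" for v
  proof -
    define p where "p = (\<Sum>c<msize n. cst (vec_index v c) * mon_at n c)"
    have p: "p \<in> polys_upto n"
      unfolding p_def by (intro polys_upto_sum polys_upto_scale mon_at_polys_upto) auto
    have "coeff_vec n p = v"
    proof (rule eq_vecI)
      fix c assume "c < dim_vec v"
      then have c: "c < msize n" using v by simp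
      have "vec_index (coeff_vec n p) c
          = (\<Sum>d<msize n. vec_index v d * (if monomials n ! c = monomials n ! d then 1 else 0))"
        by (auto simp: coeff_vec_index[OF c] p_def coeff_sum coeff_mon prod_eq_iff intro!: sum.cong)
      also have "\<dots> = (\<Sum>d<msize n. if c = d then vec_index v d else 0)"
        using c by (intro sum.cong) (auto simp: nth_eq_iff_index_eq[OF distinct_monomials] length_monomials)
      finally show "vec_index (coeff_vec n p) c = vec_index v c" using c by simp
    qed (use v in \<open>simp add: coeff_vec_def\<close>)
    then show ?thesis
      using * p scalar_prod_poly_column[OF p p, of \<beta>] by (simp add: psd_def poly_column_def)
  qed
  ultimately show "positive_semidefinite (moment_matrix n \<beta>)"
    by (simp add: positive_semidefinite_def moment_matrix_def)
qed

lemma recursively_generated_iff: "recursively_generated n \<beta> \<longleftrightarrow> multiplicative_null n (riesz \<beta>)"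
  unfolding recursively_generated_def column_relation_iff multiplicative_null_def
  by (auto simp: null_polys_def)

lemma variety_iff: "(x, y) \<in> variety n \<beta> \<longleftrightarrow> (\<forall>p\<in>null_polys n (riesz \<beta>). eval2 p x y = 0)"
  by (auto simp: variety_def zero_set_def column_relation_iff)

subsection \<open>Orthonormal systems and the rank of a moment matrix\<close>

definition orthonormal :: "nat \<Rightarrow> (bipoly \<Rightarrow> real) \<Rightarrow> nat \<Rightarrow> (nat \<Rightarrow> bipoly) \<Rightarrow> bool" where
  "orthonormal n L r q \<longleftrightarrow> (\<forall>i<r. q i \<in> polys_upto n) \<and>
    (\<forall>i<r. \<forall>j<r. L (q i * q j) = (if i = j then 1 else 0))"

text \<open>A basis modulo the radical, with the Fourier expansion as spanning condition; its length
  is the rank (\<open>mrank_moments\<close>).\<close>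

definition orthonormal_basis :: "nat \<Rightarrow> (bipoly \<Rightarrow> real) \<Rightarrow> nat \<Rightarrow> (nat \<Rightarrow> bipoly) \<Rightarrow> bool" where
  "orthonormal_basis n L r q \<longleftrightarrow> orthonormal n L r q \<and>
    (\<forall>p\<in>polys_upto n. p - (\<Sum>i<r. cst (L (p * q i)) * q i) \<in> null_polys n L)"

lemma null_polys_memD: "p \<in> null_polys n L \<Longrightarrow> p \<in> polys_upto n"
  and null_polysD: "p \<in> null_polys n L \<Longrightarrow> q \<in> polys_upto n \<Longrightarrow> L (p * q) = 0"
  and null_polysD': "p \<in> null_polys n L \<Longrightarrow> q \<in> polys_upto n \<Longrightarrow> L (q * p) = 0"
  by (auto simp: null_polys_def mult.commute[of q p])

context
  fixes L :: "bipoly \<Rightarrow> real"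
  assumes lin: "linear_functional L"
begin

lemmas lin_simps = linear_functional_simps[OF lin]

lemma mult_cst_right: "L (p * (cst a * q)) = a * L (p * q)"
  and mult_cst_left: "L ((cst a * p) * q) = a * L (p * q)"
  and mult_sum_left: "L ((\<Sum>i\<in>I. cst (c i) * f i) * p) = (\<Sum>i\<in>I. c i * L (f i * p))"
  by (simp_all add: sum_distrib_right lin_simps mult.left_commute[of p "cst _"] mult.assoc)

lemma null_polys_0 [simp]: "0 \<in> null_polys n L"
  and null_polys_add: "p \<in> null_polys n L \<Longrightarrow> q \<in> null_polys n L \<Longrightarrow> p + q \<in> null_polys n L"
  and null_polys_diff: "p \<in> null_polys n L \<Longrightarrow> q \<in> null_polys n L \<Longrightarrow> p - q \<in> null_polys n L"
  and null_polys_scale: "p \<in> null_polys n L \<Longrightarrow> cst a * p \<in> null_polys n L"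
  by (auto simp: null_polys_def lin_simps polys_upto_add polys_upto_diff polys_upto_scale
      distrib_right left_diff_distrib mult_cst_left)

lemma null_polys_psdI:
  assumes psd: "psd n L" and p: "p \<in> polys_upto n" and zero: "L (p * p) = 0"
  shows "p \<in> null_polys n L"
proof -
  have "L (p * q) = 0" if q: "q \<in> polys_upto n" for q
  proof (rule ccontr)
    assume nz: "L (p * q) \<noteq> 0"
    \<comment> \<open>Since \<open>L (p * p) = 0\<close>, the value at the square of
      \<open>q + t p\<close> is affine in \<open>t\<close>; this \<open>t\<close> makes it
      -1.\<close>
    define t where "t = - (L (q * q) + 1) / (2 * L (p * q))"
    have "(q + cst t * p) * (q + cst t * p) = q * q + cst t * (p * q) + cst t * (p * q) + cst t * (cst t * (p * p))"
      by (simp add: algebra_simps)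
    note expand = this
    have "L ((q + cst t * p) * (q + cst t * p)) = L (q * q) + 2 * t * L (p * q)"
      unfolding expand lin_simps zero by simp
    also have "\<dots> = - 1"
      using nz by (simp add: t_def field_simps)
    finally show False
      using psd polys_upto_add[OF q polys_upto_scale[OF p, of t]] unfolding psd_def by fastforce
  qed
  then show ?thesis using p by (simp add: null_polys_def)
qed

text \<open>Under positivity, membership in the radical amounts to \<open>L (p * p) = 0\<close>,
  which does not see the order.\<close>

lemma null_polys_psd_mono:
  assumes "psd n L" "m \<le> n" "p \<in> null_polys m L"
  shows "p \<in> null_polys n L"
proof (rule null_polys_psdI[OF assms(1)])
  show "p \<in> polys_upto n"
    using assms null_polys_memD polys_upto_mono by blast
  show "L (p * p) = 0"
    using assms(3) null_polysD null_polys_memD by blast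
qed

lemma orthonormal_coeff:
  assumes "orthonormal n L r q" "j < r"
  shows "L ((\<Sum>i<r. cst (y i) * q i) * q j) = y j"
proof -
  have "L ((\<Sum>i<r. cst (y i) * q i) * q j) = (\<Sum>i<r. if i = j then y i else 0)"
    unfolding mult_sum_left using assms by (intro sum.cong) (auto simp: orthonormal_def)
  then show ?thesis using assms(2) by simp
qed

text \<open>With too few functionals some nontrivial combination of the \<open>q i\<close> is killed
  by all of them, hence orthogonal to everything; but pairing with \<open>q j\<close> recovers its
  coefficients. Applied to polynomial coefficients, to the coordinates \<open>\<rho> k\<close> and
  to point evaluations.\<close>

lemma orthonormal_le_card:
  assumes on: "orthonormal n L r q" and J: "finite J" "\<And>j. j \<in> J \<Longrightarrow> linear_functional (\<phi> j)"
    and sep: "\<And>h p. h \<in> polys_upto n \<Longrightarrow> (\<And>j. j \<in> J \<Longrightarrow> \<phi> j h = 0) \<Longrightarrow> p \<in> polys_upto n \<Longrightarrow> L (h * p) = 0"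
  shows "r \<le> card J"
proof (rule ccontr)
  assume "\<not> r \<le> card J"
  then have "card J < card {..<r}" by simp
  from exists_dependency[OF finite_lessThan J(1) this, of "\<lambda>i j. \<phi> j (q i)"]
  obtain x where x: "(\<exists>i\<in>{..<r}. x i \<noteq> 0) \<and> (\<forall>j\<in>J. (\<Sum>i<r. x i * \<phi> j (q i)) = 0)"
    by (elim exE)
  have q: "q i \<in> polys_upto n" if "i < r" for i
    using on that by (simp add: orthonormal_def)
  have "x j = 0" if j: "j < r" for j
  proof -
    have "L ((\<Sum>i<r. cst (x i) * q i) * q j) = 0"
      using q j x J(2)
      by (intro sep) (auto simp: linear_functional_sum linear_functional_scale intro!: polys_upto_sum polys_upto_scale)
    then show ?thesis using orthonormal_coeff[OF on j, of x] by simp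
  qed
  then show False using x by blast
qed

lemma orthonormal_le_msize:
  assumes "orthonormal n L r q"
  shows "r \<le> msize n"
proof -
  have "r \<le> card (idx n)"
  proof (rule orthonormal_le_card[OF assms])
    show "linear_functional (\<lambda>p. coeff (coeff p (fst kl)) (snd kl))" for kl
      by (simp add: linear_functional_def)
    fix h p assume h: "h \<in> polys_upto n" "\<And>kl. kl \<in> idx n \<Longrightarrow> coeff (coeff h (fst kl)) (snd kl) = 0"
    have "h = 0"
      using h(2) by (subst bipoly_expansion[OF h(1)]) simp
    then show "L (h * p) = 0" by (simp add: lin_simps)
  qed simp
  then show ?thesis
    using distinct_card[OF distinct_monomials[of n]] by (simp add: set_monomials length_monomials)
qed

text \<open>Gram-Schmidt; it stops because an orthonormal system has at most \<open>msize n\<close>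
  members. Keeping the given members allows a prescribed vector to come first in the basis.\<close>

lemma orthonormal_extend:
  assumes "psd n L" "orthonormal n L r q"
  shows "\<exists>r' q'. orthonormal_basis n L r' q' \<and> r \<le> r' \<and> (\<forall>i<r. q' i = q i)"
  using assms(2)
proof (induction "msize n - r" arbitrary: r q rule: less_induct)
  case less
  show ?case
  proof (cases "orthonormal_basis n L r q")
    case True
    then show ?thesis by blast
  next
    case False
    then obtain p where p: "p \<in> polys_upto n"
        "p - (\<Sum>i<r. cst (L (p * q i)) * q i) \<notin> null_polys n L"
      using less.prems by (auto simp: orthonormal_basis_def)
    define d where "d = p - (\<Sum>i<r. cst (L (p * q i)) * q i)"
    have q: "\<And>i. i < r \<Longrightarrow> q i \<in> polys_upto n"
      using less.prems by (simp add: orthonormal_def)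
    have d: "d \<in> polys_upto n"
      unfolding d_def using p(1) q
      by (auto intro!: polys_upto_diff polys_upto_sum polys_upto_scale)
    have orth: "L (d * q j) = 0" if "j < r" for j
      using orthonormal_coeff[OF less.prems that] by (simp add: d_def left_diff_distrib lin_simps)
    have "L (d * d) \<noteq> 0"
      using null_polys_psdI[OF assms(1) d] p(2) by (auto simp: d_def)
    moreover have "L (d * d) \<ge> 0"
      using assms(1) d by (simp add: psd_def)
    ultimately have pos: "L (d * d) > 0" by simp
    define e where "e = cst (1 / sqrt (L (d * d))) * d"
    have ee: "L (e * e) = 1"
      unfolding e_def mult_cst_left mult_cst_right
      using pos by (simp add: real_div_sqrt flip: divide_divide_eq_left)
    have eq: "L (e * q j) = 0" "L (q j * e) = 0" if "j < r" for j
      using orth[OF that] by (simp_all add: e_def mult_cst_left mult_cst_right mult.commute[of "q j"])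
    define q' where "q' = q(r := e)"
    have on: "orthonormal n L (Suc r) q'"
      unfolding orthonormal_def
    proof (intro conjI allI impI)
      fix i assume "i < Suc r"
      then show "q' i \<in> polys_upto n"
        using q d by (auto simp: q'_def e_def less_Suc_eq intro: polys_upto_scale)
    next
      fix i j assume "i < Suc r" "j < Suc r"
      then show "L (q' i * q' j) = (if i = j then 1 else 0)"
        using less.prems ee eq by (auto simp: q'_def orthonormal_def less_Suc_eq)
    qed
    from orthonormal_le_msize[OF on] have "msize n - Suc r < msize n - r" by simp
    from less.hyps[OF this on] obtain r' q'' where
      "orthonormal_basis n L r' q''" "Suc r \<le> r'" "\<forall>i<Suc r. q'' i = q' i" by blast
    then show ?thesis
      by (intro exI[of _ r'] exI[of _ q'']) (auto simp: q'_def)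
  qed
qed

lemma orthonormal_basis_exists:
  assumes "psd n L"
  obtains r q where "orthonormal_basis n L r q"
  using orthonormal_extend[OF assms, of 0 "\<lambda>_. 0"] by (auto simp: orthonormal_def)

lemma orthonormal_basis_parseval:
  assumes "orthonormal_basis n L r q" "p \<in> polys_upto n" "p' \<in> polys_upto n"
  shows "L (p * p') = (\<Sum>i<r. L (p * q i) * L (q i * p'))"
proof -
  have "L ((p - (\<Sum>i<r. cst (L (p * q i)) * q i)) * p') = 0"
    using assms null_polysD unfolding orthonormal_basis_def by blast
  then show ?thesis
    by (simp add: left_diff_distrib lin_simps mult_sum_left)
qed

lemma orthonormal_basis_null:
  assumes "orthonormal_basis n L r q" "p \<in> polys_upto n" "\<And>i. i < r \<Longrightarrow> L (p * q i) = 0"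
  shows "p \<in> null_polys n L"
proof -
  have "p - (\<Sum>i<r. cst (L (p * q i)) * q i) \<in> null_polys n L"
    using assms(1,2) by (simp add: orthonormal_basis_def)
  moreover have "(\<Sum>i<r. cst (L (p * q i)) * q i) = 0"
    by (intro sum.neutral) (simp add: assms(3))
  ultimately show ?thesis by simp
qed

text \<open>By Parseval the matrix factors through \<open>L (mon_at n i * q k)\<close>, and the
  coefficient vectors of the \<open>q k\<close> form the dual family.\<close>

lemma mrank_moments:
  assumes "orthonormal_basis n L r q"
  shows "mrank n (moments L) = r"
  unfolding mrank_def
proof (rule rank_eq_if_symmetric_factorization)
  show "moment_matrix n (moments L) \<in> carrier_mat (msize n) (msize n)" by simp
next
  fix i j assume "i < msize n" "j < msize n"
  then show "moment_matrix n (moments L) $$ (i, j)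
      = (\<Sum>k<r. L (mon_at n i * q k) * L (mon_at n j * q k))"
    using orthonormal_basis_parseval[OF assms mon_at_polys_upto mon_at_polys_upto, of i j]
    by (simp add: moment_matrix_index riesz_moments[OF lin] mult.commute[of "q _"])
next
  fix k l assume kl: "k < r" "l < r"
  have on: "orthonormal n L r q" using assms by (simp add: orthonormal_basis_def)
  then have qk: "q k \<in> polys_upto n" using kl by (simp add: orthonormal_def)
  have "(\<Sum>i<msize n. vec_index (coeff_vec n (q k)) i * L (mon_at n i * q l)) = L (q k * q l)"
    unfolding mult_sum_left[symmetric] using bipoly_expansion_at[OF qk] by simp
  then show "(\<Sum>i<msize n. vec_index (coeff_vec n (q k)) i * L (mon_at n i * q l))
      = (if k = l then 1 else 0)"
    using on kl by (simp add: orthonormal_def)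
qed

end

lemma mrank_riesz:
  assumes "orthonormal_basis n (riesz \<beta>) r q"
  shows "mrank n \<beta> = r"
  using mrank_moments[OF linear_functional_riesz assms] by (simp add: moments_riesz)

lemma null_polys_cong:
  assumes "\<And>p. p \<in> polys_upto (2 * n) \<Longrightarrow> L p = K p"
  shows "null_polys n L = null_polys n K"
  using assms polys_upto_mult'[of _ n _ n "2 * n"] by (auto simp: null_polys_def)

lemma psd_cong:
  assumes "\<And>p. p \<in> polys_upto (2 * n) \<Longrightarrow> L p = K p"
  shows "psd n L = psd n K"
  using assms polys_upto_mult'[of _ n _ n "2 * n"] by (auto simp: psd_def)

lemma multiplicative_null_cong:
  assumes "\<And>p. p \<in> polys_upto (2 * n) \<Longrightarrow> L p = K p"
  shows "multiplicative_null n L = multiplicative_null n K"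
  using null_polys_cong[of n L K] assms by (simp add: multiplicative_null_def)

lemma psd_mono: "psd n L \<Longrightarrow> m \<le> n \<Longrightarrow> psd m L"
  using polys_upto_mono by (auto simp: psd_def)

lemma mrank_moments_cong:
  assumes "\<And>p. p \<in> polys_upto (2 * n) \<Longrightarrow> L p = K p"
  shows "mrank n (moments L) = mrank n (moments K)"
proof -
  have "moments L i j = moments K i j" if "i + j \<le> 2 * n" for i j
    using assms mon_polys_upto[OF that] by (simp add: moments_def)
  moreover have bound: "fst (monomials n ! c) + snd (monomials n ! c) \<le> n" if "c < msize n" for c
    using nth_mem[of c "monomials n"] that by (auto simp: length_monomials set_monomials idx_def)
  have "fst (monomials n ! r) + fst (monomials n ! c) + (snd (monomials n ! r) + snd (monomials n ! c)) \<le> 2 * n"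
    if "r < msize n" "c < msize n" for r c
    using bound[OF that(1)] bound[OF that(2)] by linarith
  ultimately have "moment_matrix n (moments L) = moment_matrix n (moments K)"
    unfolding moment_matrix_def
    by (intro cong_mat) (simp_all add: case_prod_beta Let_def)
  then show ?thesis by (simp add: mrank_def)
qed

subsection \<open>Flat functionals are finitely atomic\<close>

abbreviation eval_at :: "bipoly \<Rightarrow> real \<times> real \<Rightarrow> real" where
  "eval_at p z \<equiv> eval2 p (fst z) (snd z)"

text \<open>Flatness without ranks: the quotient by the radical does not grow from order
  \<open>n\<close> to \<open>n + 1\<close>. \<open>flat_orthonormal_basis\<close> turns this into
  equality of ranks.\<close>

definition flat :: "nat \<Rightarrow> (bipoly \<Rightarrow> real) \<Rightarrow> bool" where
  "flat n L \<longleftrightarrow> (\<forall>p\<in>polys_upto (Suc n). \<exists>p'\<in>polys_upto n. p - p' \<in> null_polys (Suc n) L)"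

text \<open>The operators of multiplication by \<open>x\<close> and \<open>y\<close> on the quotient by the null polynomials are
  commuting and self-adjoint, so an eigenvector of the normal operator \<open>x + \<i> y\<close> is a joint
  eigenvector; its real or imaginary part represents a point evaluation.\<close>

lemma flat_point_evaluation:
  assumes lin: "linear_functional L" and psd: "psd (Suc n) L" and flat: "flat n L"
    and onb: "orthonormal_basis (Suc n) L r q" and r: "r > 0"
  shows "\<exists>z. \<exists>f\<in>polys_upto n. \<forall>p\<in>polys_upto (Suc n). L (f * p) = eval_at p z"
proof -
  let ?X = "mon 0 1" and ?Y = "mon 1 0"
  note ls = linear_functional_simps[OF lin]
  note ml = mult_cst_left[OF lin] and mr = mult_cst_right[OF lin]
  have q: "q i \<in> polys_upto (Suc n)" if "i < r" for i
    using onb that by (simp add: orthonormal_basis_def orthonormal_def)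
  \<comment> \<open>Representatives of degree \<open>n\<close> leave room for one multiplication by
    \<open>x\<close> or \<open>y\<close> inside degree \<open>Suc n\<close>.\<close>
  then have "\<forall>i. \<exists>p. i < r \<longrightarrow> p \<in> polys_upto n \<and> q i - p \<in> null_polys (Suc n) L"
    using flat unfolding flat_def by blast
  then obtain g where g: "\<And>i. i < r \<Longrightarrow> g i \<in> polys_upto n"
      and qg: "\<And>i. i < r \<Longrightarrow> q i - g i \<in> null_polys (Suc n) L"
    by metis
  have g': "g i \<in> polys_upto (Suc n)" if "i < r" for i
    by (rule polys_upto_Suc[OF g[OF that]])
  have g_eq: "L (p * q i) = L (p * g i)" if "i < r" "p \<in> polys_upto (Suc n)" for i p
    using null_polysD'[OF qg[OF that(1)] that(2)] by (simp add: right_diff_distrib ls)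
  have orth: "L (g i * g j) = (if i = j then 1 else 0)" if "i < r" "j < r" for i j
  proof -
    have "L (g i * g j) = L (q j * g i)"
      using g_eq[OF that(2) g'[OF that(1)]] by (simp add: mult.commute)
    also have "\<dots> = L (q j * q i)"
      using g_eq[OF that(1) q[OF that(2)]] by simp
    finally show ?thesis
      using onb that by (auto simp: orthonormal_basis_def orthonormal_def)
  qed
  have null: "p \<in> null_polys (Suc n) L"
    if "p \<in> polys_upto (Suc n)" "\<And>i. i < r \<Longrightarrow> L (p * g i) = 0" for p
    using orthonormal_basis_null[OF lin onb that(1)] that(2) g_eq[OF _ that(1)] by simp
  \<comment> \<open>These are the matrices of multiplication by \<open>x\<close> and
    \<open>y\<close> in the basis \<open>g\<close>; \<open>S\<close> and \<open>T\<close> below are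
    the real and imaginary parts of an eigenvector for the eigenvalue \<open>a + ib\<close>.\<close>
  obtain a b s t where st: "(\<exists>i<r. s i \<noteq> 0 \<or> t i \<noteq> 0) \<and> (\<forall>i<r.
      (\<Sum>j<r. L (?X * g j * g i) * s j - L (?Y * g j * g i) * t j) = a * s i - b * t i \<and>
      (\<Sum>j<r. L (?X * g j * g i) * t j + L (?Y * g j * g i) * s j) = a * t i + b * s i)"
    using exists_complex_eigenvector[OF r, of "\<lambda>i j. L (?X * g j * g i)" "\<lambda>i j. L (?Y * g j * g i)"]
    by (elim exE)
  then have nz: "\<exists>i<r. s i \<noteq> 0 \<or> t i \<noteq> 0"
    and e1: "\<And>i. i < r \<Longrightarrow>
      (\<Sum>j<r. L (?X * g j * g i) * s j - L (?Y * g j * g i) * t j) = a * s i - b * t i"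
    and e2: "\<And>i. i < r \<Longrightarrow>
      (\<Sum>j<r. L (?X * g j * g i) * t j + L (?Y * g j * g i) * s j) = a * t i + b * s i"
    by simp_all
  define S where "S = (\<Sum>j<r. cst (s j) * g j)"
  define T where "T = (\<Sum>j<r. cst (t j) * g j)"
  have ST: "S \<in> polys_upto n" "T \<in> polys_upto n"
    unfolding S_def T_def using g by (auto intro!: polys_upto_sum polys_upto_scale)
  have coord: "L (S * g i) = s i" "L (T * g i) = t i" if "i < r" for i
    using orthonormal_coeff[OF lin, of n r g i] orth g that
    by (simp_all add: S_def T_def orthonormal_def)
  have shifted: "L (m * (\<Sum>j<r. cst (y j) * g j) * p) = (\<Sum>j<r. L (m * g j * p) * y j)" for m p y
  proof -
    have "m * (\<Sum>j<r. cst (y j) * g j) * p = (\<Sum>j<r. cst (y j) * (m * g j * p))"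
      by (simp add: sum_distrib_left sum_distrib_right mult_ac)
    then show ?thesis by (simp only: ls mult.commute[of "y _"])
  qed
  define X where "X = ?X - cst a"
  define Y where "Y = ?Y - cst b"
  have XY: "X \<in> polys_upto 1" "Y \<in> polys_upto 1"
    by (auto simp: X_def Y_def intro!: polys_upto_diff mon_polys_upto cst_polys_upto)
  have XYST: "X * S \<in> polys_upto (Suc n)" "X * T \<in> polys_upto (Suc n)"
      "Y * S \<in> polys_upto (Suc n)" "Y * T \<in> polys_upto (Suc n)"
    using XY ST by (auto intro: polys_upto_mult')
  \<comment> \<open>\<open>d\<close> and \<open>e\<close> are the real and imaginary parts of the
    eigenvector equation \<open>(X + iY) (S + iT) = 0\<close> modulo the radical.\<close>
  have d: "X * S - Y * T \<in> null_polys (Suc n) L"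
  proof (rule null)
    fix i assume i: "i < r"
    have "L ((X * S - Y * T) * g i)
        = (L (?X * S * g i) - L (?Y * T * g i)) - (a * L (S * g i) - b * L (T * g i))"
      by (simp add: X_def Y_def left_diff_distrib ls mult.assoc)
    also have "\<dots> = 0"
      using e1[OF i] unfolding coord[OF i] unfolding S_def T_def shifted sum_subtractf by simp
    finally show "L ((X * S - Y * T) * g i) = 0" .
  qed (use XYST in \<open>auto intro: polys_upto_diff\<close>)
  have e: "X * T + Y * S \<in> null_polys (Suc n) L"
  proof (rule null)
    fix i assume i: "i < r"
    have "L ((X * T + Y * S) * g i)
        = (L (?X * T * g i) + L (?Y * S * g i)) - (a * L (T * g i) + b * L (S * g i))"
      by (simp add: X_def Y_def left_diff_distrib distrib_right ls mult.assoc)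
    also have "\<dots> = 0"
      using e2[OF i] unfolding coord[OF i] unfolding S_def T_def shifted sum.distrib by simp
    finally show "L ((X * T + Y * S) * g i) = 0" .
  qed (use XYST in \<open>auto intro: polys_upto_add\<close>)
  have sum0: "p \<in> null_polys (Suc n) L \<and> p' \<in> null_polys (Suc n) L"
    if "p \<in> polys_upto (Suc n)" "p' \<in> polys_upto (Suc n)" "L (p * p) + L (p' * p') = 0" for p p'
  proof -
    have "L (p * p) \<ge> 0" "L (p' * p') \<ge> 0"
      using psd that by (auto simp: psd_def)
    with that show ?thesis
      by (auto intro!: null_polys_psdI[OF lin psd])
  qed
  \<comment> \<open>Here commutativity acts as normality: the mixed terms
    \<open>X * Y * S * T\<close> cancel, the sum of squares is null, and so each of \<open>X\<close>
    and \<open>Y\<close> kills \<open>S\<close> separately.\<close>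
  have "L (X * S * (X * S)) + L (Y * S * (Y * S)) = 0"
  proof -
    have "X * S * (X * S) + Y * S * (Y * S) = (X * S - Y * T) * (X * S) + (X * T + Y * S) * (Y * S)"
      by (simp add: algebra_simps)
    from arg_cong[OF this, of L] show ?thesis
      using null_polysD[OF d XYST(1)] null_polysD[OF e XYST(3)] by (simp add: ls)
  qed
  then have nS: "X * S \<in> null_polys (Suc n) L" "Y * S \<in> null_polys (Suc n) L"
    using sum0 XYST by blast+
  have "L (X * T * (X * T)) + L (Y * T * (Y * T)) = 0"
  proof -
    have "X * T * (X * T) + Y * T * (Y * T) = (X * T + Y * S) * (X * T) - (X * S - Y * T) * (Y * T)"
      by (simp add: algebra_simps)
    from arg_cong[OF this, of L] show ?thesis
      using null_polysD[OF e XYST(2)] null_polysD[OF d XYST(4)] by (simp add: ls)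
  qed
  then have nT: "X * T \<in> null_polys (Suc n) L" "Y * T \<in> null_polys (Suc n) L"
    using sum0 XYST by blast+
  have "\<exists>i<r. L (S * g i) \<noteq> 0 \<or> L (T * g i) \<noteq> 0"
    using nz coord by auto
  then obtain h i where h: "h \<in> polys_upto n" "X * h \<in> null_polys (Suc n) L"
      "Y * h \<in> null_polys (Suc n) L" and i: "i < r" "L (h * g i) \<noteq> 0"
    using ST nS nT by blast
  \<comment> \<open>A factor \<open>x\<close> may be traded for \<open>a\<close>, or
    \<open>y\<close> for \<open>b\<close>: \<open>X * h\<close> and \<open>Y * h\<close> are null,
    and the rest of the monomial has degree at most \<open>n\<close>.\<close>
  have mon_h: "L (h * mon k l) = b ^ k * a ^ l * L h" if "k + l \<le> Suc n" for k l
    using that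
  proof (induction "k + l" arbitrary: k l)
    case 0
    then show ?case by simp
  next
    case (Suc m)
    show ?case
    proof (cases k)
      case 0
      then obtain l' where l: "l = Suc l'" using Suc.hyps(2) by (cases l) auto
      have m: "mon k l' \<in> polys_upto (Suc n)"
        using Suc.prems l by (intro mon_polys_upto) simp
      have "h * mon k l = X * h * mon k l' + cst a * (h * mon k l')"
        using mon_mult[of 0 1 k l'] by (simp add: X_def l algebra_simps)
      then have "L (h * mon k l) = a * L (h * mon k l')"
        using null_polysD[OF h(2) m] by (simp add: ls)
      then show ?thesis using Suc.hyps(1)[of k l'] Suc.hyps(2) Suc.prems l by simp
    next
      case k: (Suc k')
      have m: "mon k' l \<in> polys_upto (Suc n)"
        using Suc.prems k by (intro mon_polys_upto) simp
      have "h * mon k l = Y * h * mon k' l + cst b * (h * mon k' l)"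
        using mon_mult[of 1 0 k' l] by (simp add: Y_def k algebra_simps)
      then have "L (h * mon k l) = b * L (h * mon k' l)"
        using null_polysD[OF h(3) m] by (simp add: ls)
      then show ?thesis using Suc.hyps(1)[of k' l] Suc.hyps(2) Suc.prems k by simp
    qed
  qed
  have eval_h: "L (h * p) = L h * eval2 p a b" if "p \<in> polys_upto (Suc n)" for p
  proof (rule linear_functional_eqI[OF _ _ that])
    show "linear_functional (\<lambda>p. L (h * p))"
      by (rule linear_functional_mult[OF lin])
    show "linear_functional (\<lambda>p. L h * eval2 p a b)"
      by (simp add: linear_functional_def algebra_simps)
  qed (simp add: mon_h)
  \<comment> \<open>Otherwise \<open>eval_h\<close> would make \<open>h\<close> orthogonal to
    \<open>g i\<close>; dividing \<open>h\<close> by \<open>L h\<close> yields the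
    evaluation.\<close>
  have "L h \<noteq> 0"
    using eval_h[OF g'[OF i(1)]] i(2) by auto
  then have "L (cst (1 / L h) * h * p) = eval_at p (a, b)" if "p \<in> polys_upto (Suc n)" for p
    using eval_h[OF that] by (simp add: ml)
  then show ?thesis
    using polys_upto_scale[OF h(1)] by blast
qed

text \<open>The mass to split off at \<open>z\<close> is \<open>1 / \<kappa>\<close> with
  \<open>\<kappa> = f(z)\<close>: Cauchy-Schwarz gives
  \<open>p(z)^2 = L (f * p)^2 \<le> \<kappa> * L (p * p)\<close>, so positivity survives, and
  equality at \<open>p = f\<close> makes \<open>f\<close> null, which costs one dimension.\<close>

theorem flat_finitely_atomic:
  assumes "linear_functional L" "psd (Suc n) L" "flat n L" "orthonormal_basis (Suc n) L r q"
  shows "\<exists>S w. finite S \<and> card S \<le> r \<and> (\<forall>z\<in>S. w z > 0) \<and>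
    (\<forall>p\<in>polys_upto (2 * Suc n). L p = (\<Sum>z\<in>S. w z * eval_at p z))"
  using assms
proof (induction r arbitrary: L q)
  case 0
  have null: "L (p * p') = 0" if "p \<in> polys_upto (Suc n)" "p' \<in> polys_upto (Suc n)" for p p'
    using orthonormal_basis_parseval[OF 0(1) 0(4) that] by simp
  have "L p = 0" if "p \<in> polys_upto (2 * Suc n)" for p
  proof (rule linear_functional_eqI[OF 0(1) _ that])
    show "linear_functional (\<lambda>_. 0)" by (simp add: linear_functional_def)
    fix i j assume ij: "i + j \<le> 2 * Suc n"
    then have "i + j \<le> Suc n + Suc n" by simp
    then show "L (mon i j) = 0"
      by (rule mon_split) (simp add: null mon_polys_upto)
  qed
  then show ?case by (intro exI[of _ "{}"]) simp
next
  case (Suc r)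
  note lin = Suc.prems(1) and psd = Suc.prems(2)
  note ls = linear_functional_simps[OF lin]
  note ml = mult_cst_left[OF lin] and mr = mult_cst_right[OF lin]
  obtain z f where f: "f \<in> polys_upto n"
      and ev: "\<And>p. p \<in> polys_upto (Suc n) \<Longrightarrow> L (f * p) = eval_at p z"
    using flat_point_evaluation[OF Suc.prems] by auto
  have f': "f \<in> polys_upto (Suc n)"
    by (rule polys_upto_Suc[OF f])
  define \<kappa> where "\<kappa> = eval_at f z"
  have "L (f * f) = \<kappa>" using ev[OF f'] by (simp add: \<kappa>_def)
  have "\<kappa> \<noteq> 0"
  proof
    assume "\<kappa> = 0"
    then have "f \<in> null_polys (Suc n) L"
      using null_polys_psdI[OF lin psd f'] \<open>L (f * f) = \<kappa>\<close> by simp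
    then show False using ev[of 1] null_polysD[of f "Suc n" L 1] by simp
  qed
  moreover have "\<kappa> \<ge> 0"
    using psd f' \<open>L (f * f) = \<kappa>\<close> by (auto simp: psd_def)
  ultimately have \<kappa>: "\<kappa> > 0" by simp
  define c where "c = 1 / sqrt \<kappa>"
  have cc: "c * c = 1 / \<kappa>" using \<kappa> by (simp add: c_def)
  have "L (cst c * f * (cst c * f)) = c * c * \<kappa>"
    unfolding ml mr \<open>L (f * f) = \<kappa>\<close> by simp
  \<comment> \<open>With the normalized \<open>f\<close> as first basis element, all others vanish
    at \<open>z\<close>, and dropping index 0 leaves a basis for \<open>K\<close>.\<close>
  then have "orthonormal (Suc n) L 1 (\<lambda>_. cst c * f)"
    using f' \<kappa> cc by (simp add: orthonormal_def polys_upto_scale)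
  then obtain r' e where e: "orthonormal_basis (Suc n) L r' e" "e 0 = cst c * f"
    using orthonormal_extend[OF lin psd] by (metis less_numeral_extra(1))
  have "r' = Suc r"
    using mrank_moments[OF lin e(1)] mrank_moments[OF lin Suc.prems(4)] by simp
  note e = e[unfolded this]
  have on: "orthonormal (Suc n) L (Suc r) e" using e(1) by (simp add: orthonormal_basis_def)
  then have eP: "e i \<in> polys_upto (Suc n)" if "i < Suc r" for i
    using that by (simp add: orthonormal_def)
  define K where "K = (\<lambda>p. L p + (- (1 / \<kappa>)) * eval_at p z)"
  have K: "linear_functional K"
    unfolding K_def by (rule linear_functional_combine[OF lin linear_functional_eval2])
  have psdK: "psd (Suc n) K"
    unfolding psd_def
  proof
    fix p assume p: "p \<in> polys_upto (Suc n)"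
    \<comment> \<open>\<open>d * f\<close> is the projection of \<open>p\<close> onto
      \<open>f\<close>; the square of the remainder has \<open>L\<close>-value
      \<open>K (p * p)\<close>.\<close>
    define d where "d = eval_at p z / \<kappa>"
    have "(p - cst d * f) * (p - cst d * f)
        = p * p - cst d * (f * p) - cst d * (f * p) + cst d * (cst d * (f * f))"
      by (simp add: algebra_simps)
    from arg_cong[OF this, of L]
    have "L ((p - cst d * f) * (p - cst d * f)) = L (p * p) - 2 * d * eval_at p z + d * (d * \<kappa>)"
      unfolding ls ev[OF p] \<open>L (f * f) = \<kappa>\<close> by simp
    also have "\<dots> = K (p * p)"
      using \<kappa> by (simp add: K_def d_def power2_eq_square)
    finally show "K (p * p) \<ge> 0"
      using psd polys_upto_diff[OF p polys_upto_scale[OF f', of d]] by (metis psd_def)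
  qed
  have nullK: "p \<in> null_polys (Suc n) K" if "p \<in> null_polys (Suc n) L" for p
  proof -
    have p: "p \<in> polys_upto (Suc n)" using that by (rule null_polys_memD)
    have "eval_at p z = 0" using ev[OF p] null_polysD'[OF that f'] by simp
    then show ?thesis using that p by (simp add: null_polys_def K_def)
  qed
  have "flat n K"
    using Suc.prems(3) nullK unfolding flat_def by blast
  have eval_e: "eval_at (e i) z = 0" if "0 < i" "i < Suc r" for i
  proof -
    have "\<forall>i<Suc r. \<forall>j<Suc r. L (e i * e j) = (if i = j then 1 else 0)"
      using on unfolding orthonormal_def by (rule conjunct2)
    from this[rule_format, of 0 i] that have "c * L (f * e i) = 0"
      by (simp add: e(2) ml)
    then show ?thesis using ev[OF eP[OF that(2)]] \<kappa> by (simp add: c_def)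
  qed
  have e0: "e 0 \<in> null_polys (Suc n) K"
  proof -
    have "K (e 0 * p) = 0" if "p \<in> polys_upto (Suc n)" for p
      using ev[OF that] \<kappa> by (simp add: K_def e(2) ml \<kappa>_def)
    then show ?thesis using eP[of 0] by (simp add: null_polys_def)
  qed
  have "orthonormal_basis (Suc n) K r (\<lambda>i. e (Suc i))"
    unfolding orthonormal_basis_def
  proof (intro conjI ballI)
    show "orthonormal (Suc n) K r (\<lambda>i. e (Suc i))"
      using on eval_e by (auto simp: orthonormal_def K_def)
    fix p assume p: "p \<in> polys_upto (Suc n)"
    have "p - (\<Sum>i<Suc r. cst (L (p * e i)) * e i) \<in> null_polys (Suc n) K"
      using e(1) p nullK by (simp add: orthonormal_basis_def)
    then have "p - (\<Sum>i<Suc r. cst (L (p * e i)) * e i) + cst (L (p * e 0)) * e 0 \<in> null_polys (Suc n) K"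
      using e0 by (intro null_polys_add[OF K] null_polys_scale[OF K])
    moreover have "p - (\<Sum>i<Suc r. cst (L (p * e i)) * e i) + cst (L (p * e 0)) * e 0
        = p - (\<Sum>i<r. cst (K (p * e (Suc i))) * e (Suc i))"
      using eval_e by (simp add: sum.lessThan_Suc_shift K_def del: sum.lessThan_Suc)
    ultimately show "p - (\<Sum>i<r. cst (K (p * e (Suc i))) * e (Suc i)) \<in> null_polys (Suc n) K"
      by (simp only:)
  qed
  from Suc.IH[OF K psdK \<open>flat n K\<close> this] obtain S w where S: "finite S" "card S \<le> r"
      "\<forall>z\<in>S. w z > 0" "\<And>p. p \<in> polys_upto (2 * Suc n) \<Longrightarrow> K p = (\<Sum>z\<in>S. w z * eval_at p z)"
    by blast
  \<comment> \<open>\<open>z\<close> may already be an atom of \<open>K\<close>; in that case the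
    two masses are added.\<close>
  define w' where "w' = (\<lambda>y. if y \<in> S then w y else 0)"
  define v where "v = (\<lambda>y. w' y + (if y = z then 1 / \<kappa> else 0))"
  have "L p = (\<Sum>y\<in>insert z S. v y * eval_at p y)" if "p \<in> polys_upto (2 * Suc n)" for p
  proof -
    have "(\<Sum>y\<in>insert z S. v y * eval_at p y)
        = (\<Sum>y\<in>insert z S. w' y * eval_at p y) + (\<Sum>y\<in>insert z S. if y = z then 1 / \<kappa> * eval_at p z else 0)"
      unfolding v_def distrib_right sum.distrib by (intro arg_cong2[of _ _ _ _ "(+)"] sum.cong) auto
    also have "(\<Sum>y\<in>insert z S. if y = z then 1 / \<kappa> * eval_at p z else 0) = 1 / \<kappa> * eval_at p z"
      using S(1) by simp
    also have "(\<Sum>y\<in>insert z S. w' y * eval_at p y) = (\<Sum>y\<in>S. w y * eval_at p y)"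
      using S(1) by (intro sum.mono_neutral_cong_right) (auto simp: w'_def)
    finally show ?thesis using S(4)[OF that] by (simp add: K_def)
  qed
  moreover have "\<forall>y\<in>insert z S. v y > 0"
    using S(3) \<kappa> by (auto simp: v_def w'_def add_pos_pos)
  moreover have "card (insert z S) \<le> Suc r"
    using S(1,2) by (simp add: card_insert_if)
  ultimately show ?case
    using S(1) by (intro exI[of _ "insert z S"] exI[of _ v]) auto
qed

subsection \<open>Laurent coordinates modulo a hyperbola\<close>

text \<open>Modulo \<open>Q\<close> every polynomial is a combination of \<open>1, u, u\<^sup>2, \<dots>\<close> and \<open>v, v\<^sup>2, \<dots>\<close>, where
  \<open>u v = c\<close>. The functional \<open>\<rho> k\<close> extracts the coefficient of \<open>u\<^sup>k\<close> if \<open>k \<ge> 0\<close> and that of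
  \<open>v\<^sup>-\<^sup>k\<close> if \<open>k \<le> 0\<close>; \<open>c = 0\<close> is the case of two lines.\<close>

locale hyperbola_coordinates =
  fixes u v :: bipoly and c :: real and Q :: bipoly and \<rho> :: "int \<Rightarrow> bipoly \<Rightarrow> real"
  assumes linear_\<rho>: "linear_functional (\<rho> k)"
    and u_polys_upto: "u \<in> polys_upto 1"
    and v_polys_upto: "v \<in> polys_upto 1"
    and dvd_uv: "Q dvd u * v - cst c"
    and \<rho>_Q: "\<rho> k (Q * p) = 0"
    and \<rho>_u: "\<rho> (k + 1) (u * p) = (if k \<ge> 0 then 1 else c) * \<rho> k p"
    and \<rho>_v: "\<rho> (k - 1) (v * p) = (if k \<le> 0 then 1 else c) * \<rho> k p"
    and \<rho>_1: "\<rho> k 1 = (if k = 0 then 1 else 0)"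
    and \<rho>_degree: "p \<in> polys_upto m \<Longrightarrow> \<bar>k\<bar> > int m \<Longrightarrow> \<rho> k p = 0"
    and decomposition: "p \<in> polys_upto m \<Longrightarrow>
      Q dvd p - cst (\<rho> 0 p) - (\<Sum>k=1..m. cst (\<rho> (int k) p) * u ^ k)
        - (\<Sum>k=1..m. cst (\<rho> (- int k) p) * v ^ k)"
begin

text \<open>Exchanging the roles of \<open>u\<close> and \<open>v\<close> reverses the index of
  \<open>\<rho>\<close>. Through this interpretation each lemma about \<open>u\<close> also serves
  for \<open>v\<close>.\<close>

lemma swapped: "hyperbola_coordinates v u c Q (\<lambda>k. \<rho> (- k))"
proof
  fix k p
  show "\<rho> (- (k + 1)) (v * p) = (if k \<ge> 0 then 1 else c) * \<rho> (- k) p"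
    using \<rho>_v[of "- k" p] by simp
  show "\<rho> (- (k - 1)) (u * p) = (if k \<le> 0 then 1 else c) * \<rho> (- k) p"
    using \<rho>_u[of "- k" p] by (simp add: algebra_simps)
next
  fix p m assume "p \<in> polys_upto m"
  from decomposition[OF this]
  show "Q dvd p - cst (\<rho> (- 0) p) - (\<Sum>k=1..m. cst (\<rho> (- int k) p) * v ^ k)
      - (\<Sum>k=1..m. cst (\<rho> (- (- int k)) p) * u ^ k)"
    by (simp add: algebra_simps)
qed (use dvd_uv u_polys_upto v_polys_upto in
    \<open>simp_all add: linear_\<rho> \<rho>_Q \<rho>_1 \<rho>_degree mult.commute[of v u]\<close>)

lemmas \<rho>_simps = linear_functional_simps[OF linear_\<rho>]

lemma \<rho>_dvd: "Q dvd p \<Longrightarrow> \<rho> k p = 0"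
  by (auto simp: \<rho>_Q)

lemma \<rho>_cong: "Q dvd p - q \<Longrightarrow> \<rho> k p = \<rho> k q"
  using \<rho>_dvd[of "p - q" k] by (simp add: \<rho>_simps)

lemma u_power: "u ^ k \<in> polys_upto k" and v_power: "v ^ k \<in> polys_upto k"
  using polys_upto_power u_polys_upto v_polys_upto by auto

lemma u_power': "k \<le> n \<Longrightarrow> u ^ k \<in> polys_upto n" and v_power': "k \<le> n \<Longrightarrow> v ^ k \<in> polys_upto n"
  using u_power v_power polys_upto_mono by blast+

lemma \<rho>_u_power_mult: "k \<ge> 0 \<Longrightarrow> \<rho> (k + int j) (u ^ j * p) = \<rho> k p"
proof (induction j)
  case (Suc j)
  then show ?case using \<rho>_u[of "k + int j" "u ^ j * p"] by (simp add: algebra_simps)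
qed simp

text \<open>Each factor \<open>u\<close> lowers a power of \<open>v\<close> by one at the price of a
  factor \<open>c\<close>.\<close>

lemma \<rho>_neg_u_power_mult: "k > 0 \<Longrightarrow> \<rho> (- k) (u ^ j * p) = c ^ j * \<rho> (- (k + int j)) p"
proof (induction j arbitrary: k)
  case (Suc j)
  have "\<rho> (- k) (u ^ Suc j * p) = c * \<rho> (- (k + 1)) (u ^ j * p)"
    using \<rho>_u[of "- (k + 1)" "u ^ j * p"] Suc.prems by (simp add: mult.assoc)
  also have "\<dots> = c ^ Suc j * \<rho> (- (k + 1 + int j)) p"
    using Suc.IH[of "k + 1"] Suc.prems by simp
  also have "k + 1 + int j = k + int (Suc j)" by simp
  finally show ?case .
qed simp

lemma \<rho>_u_power: "\<rho> k (u ^ j) = (if k = int j then 1 else 0)"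
proof (induction j arbitrary: k)
  case (Suc j)
  then show ?case using \<rho>_u[of "k - 1" "u ^ j"] by auto
qed (simp add: \<rho>_1)

lemma \<rho>_v_power: "\<rho> k (v ^ j) = (if k = - int j then 1 else 0)"
proof -
  interpret sw: hyperbola_coordinates v u c Q "\<lambda>k. \<rho> (- k)" by (rule swapped)
  show ?thesis using sw.\<rho>_u_power[of "- k" j] by auto
qed

lemma dvd_if_\<rho>_zero:
  assumes "p \<in> polys_upto n" "\<And>k. \<bar>k\<bar> \<le> int n \<Longrightarrow> \<rho> k p = 0"
  shows "Q dvd p"
proof -
  have "(\<Sum>k=1..n. cst (\<rho> (int k) p) * u ^ k) = 0" "(\<Sum>k=1..n. cst (\<rho> (- int k) p) * v ^ k) = 0"
    by (auto intro!: sum.neutral simp: assms(2))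
  then show ?thesis
    using decomposition[OF assms(1)] assms(2)[of 0] by simp
qed

lemma dvd_u_v_power: "k > 0 \<Longrightarrow> Q dvd u * v ^ k - cst c * v ^ (k - 1)"
proof -
  assume "k > 0"
  then have "u * v ^ k - cst c * v ^ (k - 1) = (u * v - cst c) * v ^ (k - 1)"
    by (cases k) (simp_all add: algebra_simps)
  then show ?thesis using dvd_uv by simp
qed

text \<open>Only the \<open>u ^ n\<close> term of \<open>g\<close> is pushed beyond degree
  \<open>n\<close>; on the other side \<open>u * v ^ k\<close> reduces to
  \<open>c * v ^ (k - 1)\<close>.\<close>

lemma u_mult_reduce:
  assumes g: "g \<in> polys_upto n" and n: "n \<ge> 1"
  shows "\<exists>h\<in>polys_upto n. Q dvd u * g - cst (\<rho> (int n) g) * u ^ Suc n - h"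
proof
  let ?h = "cst (\<rho> 0 g) * u + (\<Sum>k=1..n-1. cst (\<rho> (int k) g) * u ^ Suc k)
    + (\<Sum>k=1..n. cst (\<rho> (- int k) g) * (cst c * v ^ (k - 1)))"
  let ?d = "g - cst (\<rho> 0 g) - (\<Sum>k=1..n. cst (\<rho> (int k) g) * u ^ k)
    - (\<Sum>k=1..n. cst (\<rho> (- int k) g) * v ^ k)"
  let ?r = "\<Sum>k=1..n. cst (\<rho> (- int k) g) * (u * v ^ k - cst c * v ^ (k - 1))"
  show "?h \<in> polys_upto n"
  proof -
    have "u \<in> polys_upto n" using u_power'[of 1 n] n by simp
    moreover have "u ^ Suc k \<in> polys_upto n" if "k \<in> {1..n-1}" for k
      using that by (intro u_power') auto
    moreover have "v ^ (k - 1) \<in> polys_upto n" if "k \<in> {1..n}" for k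
      using that by (intro v_power') auto
    ultimately show ?thesis
      by (intro polys_upto_add polys_upto_sum polys_upto_scale) auto
  qed
  obtain n' where n': "n = Suc n'" using n by (cases n) auto
  have "u * g - cst (\<rho> (int n) g) * u ^ Suc n - ?h = u * ?d + ?r"
    by (simp add: n' algebra_simps sum_distrib_left sum_subtractf)
  moreover have "Q dvd ?r"
    by (intro dvd_sum dvd_mult dvd_u_v_power) auto
  ultimately show "Q dvd u * g - cst (\<rho> (int n) g) * u ^ Suc n - ?h"
    using decomposition[OF g] by (simp del: sum.cl_ivl_Suc)
qed

lemma decomposition_top:
  assumes "p \<in> polys_upto (Suc n)"
  shows "\<exists>p0\<in>polys_upto n. Q dvd p - p0 - cst (\<rho> (int (Suc n)) p) * u ^ Suc n
    - cst (\<rho> (- int (Suc n)) p) * v ^ Suc n"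
proof
  let ?p0 = "cst (\<rho> 0 p) + (\<Sum>k=1..n. cst (\<rho> (int k) p) * u ^ k)
    + (\<Sum>k=1..n. cst (\<rho> (- int k) p) * v ^ k)"
  show "?p0 \<in> polys_upto n"
    by (intro polys_upto_add polys_upto_sum polys_upto_scale cst_polys_upto) (auto intro: u_power' v_power')
  show "Q dvd p - ?p0 - cst (\<rho> (int (Suc n)) p) * u ^ Suc n - cst (\<rho> (- int (Suc n)) p) * v ^ Suc n"
    using decomposition[OF assms] by (simp add: algebra_simps)
qed

text \<open>Vanishing on the whole ideal of \<open>Q\<close>, in all degrees, so that congruences
  modulo \<open>Q\<close> can be used without degree bookkeeping.\<close>

definition kills :: "(bipoly \<Rightarrow> real) \<Rightarrow> bool" where
  "kills L \<longleftrightarrow> (\<forall>p. L (Q * p) = 0)"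

lemma kills_\<rho>: "kills (\<rho> k)"
  by (simp add: kills_def \<rho>_Q)

lemma kills_combine: "kills L \<Longrightarrow> kills K \<Longrightarrow> kills (\<lambda>p. L p + a * K p)"
  by (simp add: kills_def)

lemma kills_dvd: "kills L \<Longrightarrow> Q dvd p \<Longrightarrow> L p = 0"
  by (auto simp: kills_def)

lemma kills_cong:
  assumes "linear_functional L" "kills L" "Q dvd p - p'"
  shows "L (p * q) = L (p' * q)"
proof -
  have "Q dvd p * q - p' * q"
    using assms(3) by (metis dvd_mult2 left_diff_distrib)
  then show ?thesis
    using kills_dvd[OF assms(2)] linear_functional_diff[OF assms(1)] by fastforce
qed

text \<open>A null polynomial whose product with \<open>u\<close> has degree at most \<open>n\<close> modulo \<open>Q\<close> stays null. This
  is what recursive generation lacks and what representing measures force.\<close>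

definition u_recursive :: "nat \<Rightarrow> (bipoly \<Rightarrow> real) \<Rightarrow> bool" where
  "u_recursive n L \<longleftrightarrow>
    (\<forall>f\<in>null_polys n L. \<rho> (int n) f = 0 \<longrightarrow> (\<forall>q\<in>polys_upto n. L (u * f * q) = 0))"

context
  fixes L :: "bipoly \<Rightarrow> real" and n :: nat
  assumes lin: "linear_functional L" and kills: "kills L" and n: "n \<ge> 1"
begin

lemma u_mult_reduce_zero:
  assumes "g \<in> polys_upto n" "\<rho> (int n) g = 0"
  obtains h where "h \<in> polys_upto n" "Q dvd u * g - h" "\<And>q. L (u * g * q) = L (h * q)"
  using u_mult_reduce[OF assms(1) n] assms(2) kills_cong[OF lin kills] by auto

text \<open>Subtracting a multiple of \<open>g\<close> removes the \<open>u ^ n\<close> term of the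
  test polynomial \<open>q\<close>. Then \<open>u * f * q\<close> splits into
  \<open>(u * q') * f\<close> and a multiple of \<open>(u * f) * g\<close>, each a reducible factor
  of degree \<open>n\<close> times a null polynomial.\<close>

lemma u_recursive_if_top:
  assumes g: "g \<in> null_polys n L" "\<rho> (int n) g \<noteq> 0"
  shows "u_recursive n L"
  unfolding u_recursive_def
proof (intro ballI impI)
  fix f q assume f: "f \<in> null_polys n L" "\<rho> (int n) f = 0" and q: "q \<in> polys_upto n"
  note gP = null_polys_memD[OF g(1)] and fP = null_polys_memD[OF f(1)]
  obtain h where h: "h \<in> polys_upto n" "\<And>q. L (u * f * q) = L (h * q)"
    using u_mult_reduce_zero[OF fP f(2)] by metis
  define t where "t = \<rho> (int n) q / \<rho> (int n) g"
  define q' where "q' = q - cst t * g"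
  have "q' \<in> polys_upto n"
    unfolding q'_def using q gP by (intro polys_upto_diff polys_upto_scale)
  moreover have "\<rho> (int n) q' = 0"
    using g(2) by (simp add: q'_def t_def \<rho>_simps)
  ultimately obtain h' where h': "h' \<in> polys_upto n" "\<And>q. L (u * q' * q) = L (h' * q)"
    using u_mult_reduce_zero by metis
  have "u * f * q = u * q' * f + cst t * (u * f * g)"
    by (simp add: q'_def algebra_simps)
  then have "L (u * f * q) = L (h' * f) + t * L (h * g)"
    using h'(2)[of f] h(2)[of g] by (simp add: linear_functional_simps[OF lin])
  then show "L (u * f * q) = 0"
    using null_polysD'[OF f(1) h'(1)] null_polysD'[OF g(1) h(1)] by simp
qed

text \<open>\<open>\<alpha>\<close> is the correction at \<open>u ^ (2 * n + 1)\<close> that keeps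
  null polynomials orthogonal to \<open>u ^ Suc n\<close>. One number suffices, since null
  polynomials without \<open>u ^ n\<close> term are already orthogonal and modulo these at most one
  direction remains.\<close>

lemma top_moment_exists:
  assumes "u_recursive n L"
  shows "\<exists>\<alpha>. \<forall>p\<in>null_polys n L. L (u ^ Suc n * p) + \<alpha> * \<rho> (int n) p = 0"
proof -
  have zero: "L (u ^ Suc n * p) = 0" if "p \<in> null_polys n L" "\<rho> (int n) p = 0" for p
  proof -
    have "L (u * p * u ^ n) = 0"
      using assms that u_power unfolding u_recursive_def by blast
    then show ?thesis by (simp add: mult_ac)
  qed
  show ?thesis
  proof (cases "\<exists>g\<in>null_polys n L. \<rho> (int n) g \<noteq> 0")
    case True
    then obtain g where g: "g \<in> null_polys n L" "\<rho> (int n) g \<noteq> 0" by blast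
    have "L (u ^ Suc n * p) + (- L (u ^ Suc n * g) / \<rho> (int n) g) * \<rho> (int n) p = 0"
      if "p \<in> null_polys n L" for p
    proof -
      define t where "t = \<rho> (int n) p / \<rho> (int n) g"
      have "p - cst t * g \<in> null_polys n L"
        using that g(1) by (intro null_polys_diff[OF lin] null_polys_scale[OF lin])
      moreover have "\<rho> (int n) (p - cst t * g) = 0"
        using g(2) by (simp add: t_def \<rho>_simps)
      ultimately have "L (u ^ Suc n * (p - cst t * g)) = 0" by (rule zero)
      then have "L (u ^ Suc n * p) = t * L (u ^ Suc n * g)"
        unfolding right_diff_distrib linear_functional_diff[OF lin] mult_cst_right[OF lin] by simp
      then show ?thesis by (simp add: t_def)
    qed
    then show ?thesis by blast
  next
    case False
    then show ?thesis using zero by (intro exI[of _ 0]) auto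
  qed
qed

text \<open>If no null polynomial has a \<open>u ^ n\<close> term, multiplication by
  \<open>u\<close> preserves the radical modulo \<open>Q\<close> and can be iterated; a nonzero
  \<open>u ^ k\<close> term would be shifted up to \<open>u ^ n\<close>.\<close>

lemma null_polys_coeff_zero:
  assumes rec: "u_recursive n L" and no_top: "\<forall>g\<in>null_polys n L. \<rho> (int n) g = 0"
    and f: "f \<in> null_polys n L" and k: "k \<le> n"
  shows "\<rho> (int k) f = 0"
proof -
  have "\<exists>f'\<in>null_polys n L. Q dvd f' - u ^ j * f" for j
  proof (induction j)
    case 0
    then show ?case using f by (intro bexI[of _ f]) auto
  next
    case (Suc j)
    then obtain f' where f': "f' \<in> null_polys n L" "Q dvd f' - u ^ j * f" by blast
    have z: "\<rho> (int n) f' = 0" using no_top f'(1) by blast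
    obtain h where h: "h \<in> polys_upto n" "Q dvd u * f' - h" "\<And>q. L (u * f' * q) = L (h * q)"
      by (rule u_mult_reduce_zero[OF null_polys_memD[OF f'(1)] z]) blast
    have "L (h * q) = 0" if "q \<in> polys_upto n" for q
      using rec[unfolded u_recursive_def] f'(1) z that h(3)[of q] by auto
    then have "h \<in> null_polys n L"
      using h(1) by (simp add: null_polys_def)
    moreover have "Q dvd u * (f' - u ^ j * f) - (u * f' - h)"
      by (rule dvd_diff[OF dvd_mult[OF f'(2)] h(2)])
    then have "Q dvd h - u ^ Suc j * f"
      by (simp add: algebra_simps)
    ultimately show ?case by blast
  qed
  then obtain f' where f': "f' \<in> null_polys n L" "Q dvd f' - u ^ (n - k) * f" by blast
  have "\<rho> (int k) f = \<rho> (int k + int (n - k)) (u ^ (n - k) * f)"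
    by (rule \<rho>_u_power_mult[symmetric]) simp
  also have "\<dots> = \<rho> (int n) f'"
    using \<rho>_cong[OF f'(2)] k by simp
  finally show ?thesis using no_top f'(1) by simp
qed

text \<open>Scaled to leading coefficient 1, the null polynomial satisfies
  \<open>u * g = u ^ Suc n + h\<close> modulo \<open>Q\<close>, and this is orthogonal to degree
  \<open>n\<close>. Hence \<open>Pu\<close> may be replaced by \<open>- h\<close>, and the defect
  that remains is \<open>L (u * g * v ^ Suc n)\<close>.\<close>

lemma schur_complement_zero:
  assumes top: "\<And>p. p \<in> null_polys n L \<Longrightarrow> L (u ^ Suc n * p) = 0"
    and g0: "g0 \<in> null_polys n L" "\<rho> (int n) g0 \<noteq> 0"
    and Pu: "Pu \<in> polys_upto n" "\<And>p. p \<in> polys_upto n \<Longrightarrow> L (u ^ Suc n * p) = L (Pu * p)"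
    and Pv: "Pv \<in> polys_upto n" "\<And>p. p \<in> polys_upto n \<Longrightarrow> L (v ^ Suc n * p) = L (Pv * p)"
  shows "L (u ^ Suc n * v ^ Suc n) = L (Pu * Pv)"
proof -
  note ls = linear_functional_simps[OF lin]
  define g where "g = cst (1 / \<rho> (int n) g0) * g0"
  have g: "g \<in> null_polys n L" "\<rho> (int n) g = 1"
    using g0 by (simp_all add: g_def null_polys_scale[OF lin] \<rho>_simps)
  note gP = null_polys_memD[OF g(1)]
  obtain h where h: "h \<in> polys_upto n" "Q dvd u * g - u ^ Suc n - h"
    using u_mult_reduce[OF gP n] g(2) by auto
  have ug: "L (u * g * q) = L (u ^ Suc n * q) + L (h * q)" for q
    using kills_cong[OF lin kills, of "u * g" "u ^ Suc n + h" q] h(2)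
    by (simp add: distrib_right ls diff_diff_eq)
  \<comment> \<open>After removing \<open>t * g\<close> from \<open>q\<close>, only the pairing of
    \<open>u * g\<close> with \<open>g\<close> itself is left, and that is where \<open>top\<close>
    enters.\<close>
  have ug0: "L (u * g * q) = 0" if q: "q \<in> polys_upto n" for q
  proof -
    define t where "t = \<rho> (int n) q"
    have "q - cst t * g \<in> polys_upto n" "\<rho> (int n) (q - cst t * g) = 0"
      using q gP g(2) by (auto simp: t_def \<rho>_simps intro!: polys_upto_diff polys_upto_scale)
    then obtain w where w: "w \<in> polys_upto n" "\<And>p. L (u * (q - cst t * g) * p) = L (w * p)"
      using u_mult_reduce_zero by metis
    have "u * g * q = u * (q - cst t * g) * g + cst t * (u * g * g)"
      by (simp add: algebra_simps)
    then have "L (u * g * q) = L (w * g) + t * L (u * g * g)"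
      using w(2) by (simp add: ls)
    also have "\<dots> = 0"
      using ug[of g] top[OF g(1)] null_polysD'[OF g(1) h(1)] null_polysD'[OF g(1) w(1)] by simp
    finally show ?thesis .
  qed
  have "L (Pu * Pv) = L (u * g * Pv) - L (h * Pv)"
    using Pu(2)[OF Pv(1)] ug[of Pv] by simp
  also have "\<dots> = - L (v ^ Suc n * h)"
    using ug0[OF Pv(1)] Pv(2)[OF h(1)] by (simp add: mult.commute)
  also have "\<dots> = L (u ^ Suc n * v ^ Suc n) - L (u * g * v ^ Suc n)"
    using ug[of "v ^ Suc n"] by (simp add: mult.commute)
  \<comment> \<open>One \<open>v\<close> cancels against \<open>u\<close>, leaving
    \<open>c * v ^ n * g\<close>, a null polynomial against degree \<open>n\<close>.\<close>
  also have "L (u * g * v ^ Suc n) = L (u * v * (v ^ n * g))"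
    by (simp add: mult_ac)
  also have "\<dots> = L (cst c * (v ^ n * g))"
    by (rule kills_cong[OF lin kills dvd_uv])
  also have "\<dots> = 0"
    using null_polysD'[OF g(1) v_power] by (simp add: ls)
  finally show ?thesis by simp
qed

end

end

subsection \<open>Extending by one degree\<close>

text \<open>Riesz representation on the quotient by the radical: vanishing there makes
  \<open>K\<close> well defined, and \<open>K (q i)\<close> are the coordinates of its
  representative.\<close>

lemma null_functional_represented:
  assumes lin: "linear_functional L" and psd: "psd n L" and K: "linear_functional K"
    and zero: "\<And>p. p \<in> null_polys n L \<Longrightarrow> K p = 0"
  shows "\<exists>f\<in>polys_upto n. \<forall>p\<in>polys_upto n. K p = L (f * p)"
proof -
  obtain r q where onb: "orthonormal_basis n L r q"
    using orthonormal_basis_exists[OF lin psd] by blast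
  then have q: "q i \<in> polys_upto n" if "i < r" for i
    using that by (simp add: orthonormal_basis_def orthonormal_def)
  define f where "f = (\<Sum>i<r. cst (K (q i)) * q i)"
  have "K p = L (f * p)" if p: "p \<in> polys_upto n" for p
  proof -
    have "K (p - (\<Sum>i<r. cst (L (p * q i)) * q i)) = 0"
      using onb p zero by (simp add: orthonormal_basis_def)
    then have "K p = (\<Sum>i<r. L (p * q i) * K (q i))"
      by (simp add: linear_functional_simps[OF K])
    then show ?thesis
      unfolding f_def mult_sum_left[OF lin]
      by (simp only: mult.commute[of p] mult.commute[of "K _"])
  qed
  moreover have "f \<in> polys_upto n"
    unfolding f_def using q by (auto intro!: polys_upto_sum polys_upto_scale)
  ultimately show ?thesis by blast
qed

context hyperbola_coordinates
begin

definition v_recursive :: "nat \<Rightarrow> (bipoly \<Rightarrow> real) \<Rightarrow> bool" where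
  "v_recursive n L \<longleftrightarrow>
    (\<forall>f\<in>null_polys n L. \<rho> (- int n) f = 0 \<longrightarrow> (\<forall>q\<in>polys_upto n. L (v * f * q) = 0))"

lemma v_recursive_swap: "v_recursive n L \<longleftrightarrow> hyperbola_coordinates.u_recursive v (\<lambda>k. \<rho> (- k)) n L"
  by (simp add: hyperbola_coordinates.u_recursive_def[OF swapped] v_recursive_def)

text \<open>The Schur complement of the moment matrix of order \<open>n\<close> is chosen to be
  \<open>((\<bar>\<tau>\<bar>, \<tau>), (\<tau>, \<bar>\<tau>\<bar>))\<close>: its diagonal is free, and it has rank at most one.\<close>

lemma extension_step:
  assumes lin: "linear_functional M" and kills: "kills M" and psd: "psd n M" and n: "n \<ge> 1"
    and U: "\<And>p. p \<in> null_polys n M \<Longrightarrow> M (u ^ Suc n * p) = 0"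
    and V: "\<And>p. p \<in> null_polys n M \<Longrightarrow> M (v ^ Suc n * p) = 0"
  shows "\<exists>L. linear_functional L \<and> kills L \<and> (\<forall>p\<in>polys_upto (2 * n + 1). L p = M p) \<and> psd (Suc n) L \<and>
    (\<exists>g\<in>null_polys (Suc n) L. \<rho> (int (Suc n)) g \<noteq> 0 \<and> \<rho> (- int (Suc n)) g \<noteq> 0) \<and>
    ((\<exists>g\<in>null_polys n M. \<rho> (int n) g \<noteq> 0 \<or> \<rho> (- int n) g \<noteq> 0) \<longrightarrow> flat n L)"
proof -
  interpret sw: hyperbola_coordinates v u c Q "\<lambda>k. \<rho> (- k)" by (rule swapped)
  let ?U = "u ^ Suc n" and ?V = "v ^ Suc n"
  have UP: "?U \<in> polys_upto (Suc n)" "?V \<in> polys_upto (Suc n)"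
    by (rule u_power, rule v_power)
  \<comment> \<open>\<open>Pu\<close> and \<open>Pv\<close> act as the projections of the two new
    monomials to degree \<open>n\<close>; \<open>U\<close> and \<open>V\<close> are the range
    condition for them to exist.\<close>
  obtain Pu where Pu: "Pu \<in> polys_upto n" "\<And>p. p \<in> polys_upto n \<Longrightarrow> M (?U * p) = M (Pu * p)"
    using null_functional_represented[OF lin psd linear_functional_mult[OF lin] U] by blast
  obtain Pv where Pv: "Pv \<in> polys_upto n" "\<And>p. p \<in> polys_upto n \<Longrightarrow> M (?V * p) = M (Pv * p)"
    using null_functional_represented[OF lin psd linear_functional_mult[OF lin] V] by blast
  define \<tau> where "\<tau> = M (?U * ?V) - M (Pu * Pv)"
  \<comment> \<open>The corrections at \<open>u ^ (2 * n + 2)\<close> and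
    \<open>v ^ (2 * n + 2)\<close> give the residuals \<open>au\<close> and \<open>av\<close> the
    square \<open>\<bar>\<tau>\<bar>\<close>. They vanish on \<open>?U * ?V\<close>, so
    \<open>\<tau>\<close> itself cannot be adjusted.\<close>
  define \<delta> where "\<delta> = M (Pu * Pu) + \<bar>\<tau>\<bar> - M (?U * ?U)"
  define \<delta>' where "\<delta>' = M (Pv * Pv) + \<bar>\<tau>\<bar> - M (?V * ?V)"
  define L where "L = (\<lambda>p. M p + \<delta> * \<rho> (int (2 * n + 2)) p + \<delta>' * \<rho> (- int (2 * n + 2)) p)"
  have linL: "linear_functional L"
    unfolding L_def by (intro linear_functional_combine lin linear_\<rho>)
  note ls = linear_functional_simps[OF linL]
  have killsL: "kills L"
    unfolding L_def by (intro kills_combine kills kills_\<rho>)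
  have agree: "L p = M p" if "p \<in> polys_upto (2 * n + 1)" for p
    using \<rho>_degree[OF that] by (simp add: L_def)
  have UU: "?U * ?U = u ^ (2 * n + 2)" and VV: "?V * ?V = v ^ (2 * n + 2)"
  proof -
    have "2 * n + 2 = Suc n + Suc n" by simp
    then show "?U * ?U = u ^ (2 * n + 2)" "?V * ?V = v ^ (2 * n + 2)"
      by (simp_all only: power_add)
  qed
  have LUU: "L (?U * ?U) = M (Pu * Pu) + \<bar>\<tau>\<bar>"
  proof -
    have "\<rho> (int (2 * n + 2)) (?U * ?U) = 1" "\<rho> (- int (2 * n + 2)) (?U * ?U) = 0"
      unfolding UU \<rho>_u_power by simp_all
    then show ?thesis unfolding L_def \<delta>_def by simp
  qed
  have LVV: "L (?V * ?V) = M (Pv * Pv) + \<bar>\<tau>\<bar>"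
  proof -
    have "\<rho> (int (2 * n + 2)) (?V * ?V) = 0" "\<rho> (- int (2 * n + 2)) (?V * ?V) = 1"
      unfolding VV \<rho>_v_power by simp_all
    then show ?thesis unfolding L_def \<delta>'_def by simp
  qed
  have LUV: "L (?U * ?V) = M (?U * ?V)"
  proof -
    have "\<rho> (int (2 * n + 2)) (?U * ?V) = 0"
      using \<rho>_u_power_mult[of "int (Suc n)" "Suc n" ?V] unfolding \<rho>_v_power by simp
    moreover have "\<rho> (- int (2 * n + 2)) (?U * ?V) = 0"
      using sw.\<rho>_u_power_mult[of "int (Suc n)" "Suc n" ?U] unfolding \<rho>_u_power
      by (simp add: mult.commute)
    ultimately show ?thesis unfolding L_def by simp
  qed
  have low: "L (p * q) = M (p * q)" if "p \<in> polys_upto (Suc n)" "q \<in> polys_upto n" for p q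
    using agree[OF polys_upto_mult'[OF that]] by simp
  define au where "au = ?U - Pu"
  define av where "av = ?V - Pv"
  have Pu': "Pu \<in> polys_upto (Suc n)" and Pv': "Pv \<in> polys_upto (Suc n)"
    by (rule polys_upto_Suc[OF Pu(1)], rule polys_upto_Suc[OF Pv(1)])
  have auP: "au \<in> polys_upto (Suc n)" and avP: "av \<in> polys_upto (Suc n)"
    using UP Pu' Pv' by (auto simp: au_def av_def intro: polys_upto_diff)
  have au0: "L (au * p) = 0" if "p \<in> polys_upto n" for p
    using low[OF UP(1) that] low[OF Pu' that] Pu(2)[OF that] by (simp add: au_def left_diff_distrib ls)
  have av0: "L (av * p) = 0" if "p \<in> polys_upto n" for p
    using low[OF UP(2) that] low[OF Pv' that] Pv(2)[OF that] by (simp add: av_def left_diff_distrib ls)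
  have UPu: "L (?U * Pu) = M (Pu * Pu)" "L (?V * Pv) = M (Pv * Pv)" "L (?V * Pu) = M (Pu * Pv)"
    using low[OF UP(1) Pu(1)] low[OF UP(2) Pv(1)] low[OF UP(2) Pu(1)] Pu(2)[OF Pu(1)] Pv(2)[OF Pv(1)]
      Pv(2)[OF Pu(1)] by (simp_all add: mult.commute)
  have auau: "L (au * au) = \<bar>\<tau>\<bar>"
  proof -
    have "au * au = ?U * ?U - ?U * Pu - au * Pu"
      by (simp add: au_def algebra_simps)
    then show ?thesis using LUU UPu au0[OF Pu(1)] by (simp only: ls)
  qed
  have avav: "L (av * av) = \<bar>\<tau>\<bar>"
  proof -
    have "av * av = ?V * ?V - ?V * Pv - av * Pv"
      by (simp add: av_def algebra_simps)
    then show ?thesis using LVV UPu av0[OF Pv(1)] by (simp only: ls)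
  qed
  have auav: "L (au * av) = \<tau>"
  proof -
    have "au * av = ?U * ?V - ?V * Pu - au * Pv"
      by (simp add: au_def av_def algebra_simps)
    then show ?thesis using LUV UPu au0[OF Pv(1)] \<tau>_def by (simp only: ls)
  qed
  have split: "\<exists>p1\<in>polys_upto n. Q dvd p - (p1 + cst (\<rho> (int (Suc n)) p) * au + cst (\<rho> (- int (Suc n)) p) * av)"
    if p: "p \<in> polys_upto (Suc n)" for p
  proof -
    define s where "s = \<rho> (int (Suc n)) p"
    define t where "t = \<rho> (- int (Suc n)) p"
    obtain p0 where p0: "p0 \<in> polys_upto n" "Q dvd p - p0 - cst s * ?U - cst t * ?V"
      using decomposition_top[OF p] unfolding s_def t_def by blast
    have "p0 + cst s * Pu + cst t * Pv \<in> polys_upto n"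
      using p0(1) Pu(1) Pv(1) by (intro polys_upto_add polys_upto_scale)
    moreover have "p - (p0 + cst s * Pu + cst t * Pv + cst s * au + cst t * av)
        = p - p0 - cst s * ?U - cst t * ?V"
      by (simp add: au_def av_def right_diff_distrib del: power_Suc)
    ultimately show ?thesis using p0(2) unfolding s_def t_def by metis
  qed
  have psdL: "psd (Suc n) L"
    unfolding psd_def
  proof
    fix p assume p: "p \<in> polys_upto (Suc n)"
    define s where "s = \<rho> (int (Suc n)) p"
    define t where "t = \<rho> (- int (Suc n)) p"
    obtain p1 where p1: "p1 \<in> polys_upto n" "Q dvd p - (p1 + cst s * au + cst t * av)"
      using split[OF p] unfolding s_def t_def by blast
    define p2 where "p2 = p1 + cst s * au + cst t * av"
    have "L (p * p) = L (p2 * p)" "L (p * p2) = L (p2 * p2)"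
      using kills_cong[OF linL killsL] p1(2) unfolding p2_def by blast+
    then have "L (p * p) = L (p2 * p2)" by (simp add: mult.commute)
    also have "p2 * p2 = p1 * p1 + cst s * (au * p1) + cst s * (au * p1) + cst t * (av * p1)
        + cst t * (av * p1) + cst s * (cst s * (au * au)) + cst t * (cst t * (av * av))
        + cst s * (cst t * (au * av)) + cst s * (cst t * (au * av))"
      by (simp add: p2_def algebra_simps)
    finally have eq: "L (p * p) = L (p1 * p1) + (s * s * \<bar>\<tau>\<bar> + t * t * \<bar>\<tau>\<bar> + 2 * (s * t) * \<tau>)"
      unfolding ls auau avav auav au0[OF p1(1)] av0[OF p1(1)] by (simp add: algebra_simps)
    have "L (p1 * p1) \<ge> 0"
      using psd p1(1) low[OF polys_upto_mono[OF p1(1)] p1(1)] by (simp add: psd_def)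
    \<comment> \<open>The form equals \<open>\<bar>\<tau>\<bar>\<close> times the square of
      \<open>s + t\<close> or \<open>s - t\<close>, according to the sign of
      \<open>\<tau>\<close>.\<close>
    moreover have "s * s * \<bar>\<tau>\<bar> + t * t * \<bar>\<tau>\<bar> + 2 * (s * t) * \<tau> \<ge> 0"
    proof (cases "\<tau> \<ge> 0")
      case True
      have "s * s * \<bar>\<tau>\<bar> + t * t * \<bar>\<tau>\<bar> + 2 * (s * t) * \<tau> = (s + t) * (s + t) * \<tau>"
        using True by (simp add: algebra_simps)
      then show ?thesis using True by simp
    next
      case False
      have "s * s * \<bar>\<tau>\<bar> + t * t * \<bar>\<tau>\<bar> + 2 * (s * t) * \<tau> = (s - t) * (s - t) * (- \<tau>)"
        using False by (simp add: algebra_simps)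
      moreover have "(s - t) * (s - t) * (- \<tau>) \<ge> 0"
        using False by (intro mult_nonneg_nonneg[OF zero_le_square]) simp
      ultimately show ?thesis by simp
    qed
    ultimately show "L (p * p) \<ge> 0" using eq by simp
  qed
  have null: "\<exists>g\<in>null_polys (Suc n) L. \<rho> (int (Suc n)) g \<noteq> 0 \<and> \<rho> (- int (Suc n)) g \<noteq> 0"
  proof -
    \<comment> \<open>With the sign of \<open>\<tau>\<close>, the vector
      \<open>au - \<sigma> av\<close> is isotropic; \<open>\<sigma>\<close> is nonzero even for
      \<open>\<tau> = 0\<close>, so both top coefficients survive.\<close>
    define \<sigma> :: real where "\<sigma> = (if \<tau> \<ge> 0 then 1 else - 1)"
    have \<sigma>: "\<sigma> * \<sigma> = 1" "\<sigma> * \<tau> = \<bar>\<tau>\<bar>" "\<sigma> \<noteq> 0" by (auto simp: \<sigma>_def)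
    define g where "g = au - cst \<sigma> * av"
    have gP: "g \<in> polys_upto (Suc n)"
      unfolding g_def using auP avP by (intro polys_upto_diff polys_upto_scale)
    have "g * g = au * au - cst \<sigma> * (au * av) - cst \<sigma> * (au * av) + cst \<sigma> * (cst \<sigma> * (av * av))"
      by (simp add: g_def algebra_simps)
    then have "L (g * g) = \<bar>\<tau>\<bar> - \<sigma> * \<tau> - \<sigma> * \<tau> + \<sigma> * \<sigma> * \<bar>\<tau>\<bar>"
      by (simp only: ls auau avav auav mult.assoc)
    then have "L (g * g) = 0" using \<sigma> by simp
    then have gnull: "g \<in> null_polys (Suc n) L"
      by (rule null_polys_psdI[OF linL psdL gP])
    have zero: "\<rho> k Pu = 0" "\<rho> k Pv = 0" if "\<bar>k\<bar> = int (Suc n)" for k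
      using \<rho>_degree Pu(1) Pv(1) that by auto
    have "\<rho> (int (Suc n)) g = 1" "\<rho> (- int (Suc n)) g = - \<sigma>"
      unfolding g_def au_def av_def \<rho>_simps \<rho>_u_power \<rho>_v_power using zero by simp_all
    then show ?thesis using gnull \<sigma>(3) by (intro bexI[of _ g]) auto
  qed
  have flat: "flat n L" if top: "\<exists>g\<in>null_polys n M. \<rho> (int n) g \<noteq> 0 \<or> \<rho> (- int n) g \<noteq> 0"
  proof -
    \<comment> \<open>Then \<open>au\<close> and \<open>av\<close> have square 0 and are null, and
      \<open>split\<close> gives the representatives of degree \<open>n\<close>.\<close>
    have "\<tau> = 0"
    proof -
      obtain g where g: "g \<in> null_polys n M" "\<rho> (int n) g \<noteq> 0 \<or> \<rho> (- int n) g \<noteq> 0"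
        using top by blast
      from g(2) show ?thesis
      proof
        assume "\<rho> (int n) g \<noteq> 0"
        from schur_complement_zero[OF lin kills n U g(1) this Pu Pv] show ?thesis
          by (simp add: \<tau>_def)
      next
        assume "\<rho> (- int n) g \<noteq> 0"
        from sw.schur_complement_zero[OF lin kills n V g(1) this Pv Pu] show ?thesis
          by (simp add: \<tau>_def mult.commute)
      qed
    qed
    then have null': "au \<in> null_polys (Suc n) L" "av \<in> null_polys (Suc n) L"
      using null_polys_psdI[OF linL psdL] auP avP auau avav by auto
    show ?thesis
      unfolding flat_def
    proof
      fix p assume p: "p \<in> polys_upto (Suc n)"
      define s where "s = \<rho> (int (Suc n)) p"
      define t where "t = \<rho> (- int (Suc n)) p"
      obtain p1 where p1: "p1 \<in> polys_upto n" "Q dvd p - (p1 + cst s * au + cst t * av)"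
        using split[OF p] unfolding s_def t_def by blast
      have p1': "p1 \<in> polys_upto (Suc n)" by (rule polys_upto_Suc[OF p1(1)])
      define d where "d = p - (p1 + cst s * au + cst t * av)"
      have "d \<in> polys_upto (Suc n)"
        unfolding d_def using p p1' auP avP by (intro polys_upto_diff polys_upto_add polys_upto_scale)
      moreover have "L (d * q) = 0" for q
        using p1(2) by (intro kills_dvd[OF killsL] dvd_mult2) (simp add: d_def)
      ultimately have "d \<in> null_polys (Suc n) L"
        by (simp add: null_polys_def)
      then have "d + (cst s * au + cst t * av) \<in> null_polys (Suc n) L"
        using null' by (intro null_polys_add[OF linL] null_polys_scale[OF linL])
      then show "\<exists>p'\<in>polys_upto n. p - p' \<in> null_polys (Suc n) L"
        using p1(1) by (intro bexI[of _ p1]) (simp_all add: d_def)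
    qed
  qed
  show ?thesis
    using linL killsL agree psdL null flat by (intro exI[of _ L]) blast
qed

text \<open>Degree \<open>2 n + 1\<close> is settled before degree \<open>2 n + 2\<close>: the odd
  moments make null polynomials orthogonal to the new monomials, as \<open>extension_step\<close>
  requires.\<close>

lemma extension:
  assumes lin: "linear_functional L" and kills: "kills L" and psd: "psd n L" and n: "n \<ge> 1"
    and u: "u_recursive n L" and v: "v_recursive n L"
  shows "\<exists>L'. linear_functional L' \<and> kills L' \<and> (\<forall>p\<in>polys_upto (2 * n). L' p = L p) \<and> psd (Suc n) L' \<and>
    (\<exists>g\<in>null_polys (Suc n) L'. \<rho> (int (Suc n)) g \<noteq> 0 \<and> \<rho> (- int (Suc n)) g \<noteq> 0) \<and>
    ((\<exists>g\<in>null_polys n L. \<rho> (int n) g \<noteq> 0 \<or> \<rho> (- int n) g \<noteq> 0) \<longrightarrow> flat n L')"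
proof -
  interpret sw: hyperbola_coordinates v u c Q "\<lambda>k. \<rho> (- k)" by (rule swapped)
  obtain \<alpha> where \<alpha>: "\<And>p. p \<in> null_polys n L \<Longrightarrow> L (u ^ Suc n * p) + \<alpha> * \<rho> (int n) p = 0"
    using top_moment_exists[OF lin kills n u] by blast
  obtain \<alpha>' where \<alpha>': "\<And>p. p \<in> null_polys n L \<Longrightarrow> L (v ^ Suc n * p) + \<alpha>' * \<rho> (- int n) p = 0"
    using sw.top_moment_exists[OF lin kills n v[unfolded v_recursive_swap]] by blast
  \<comment> \<open>On \<open>u ^ Suc n * p\<close> the first correction equals
    \<open>\<alpha> * \<rho> n p\<close> and the second vanishes, and symmetrically for
    \<open>v\<close>; below degree \<open>2 n + 1\<close> nothing changes.\<close>
  define M where "M = (\<lambda>p. L p + \<alpha> * \<rho> (int (2 * n + 1)) p + \<alpha>' * \<rho> (- int (2 * n + 1)) p)"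
  have linM: "linear_functional M"
    unfolding M_def by (intro linear_functional_combine lin linear_\<rho>)
  have killsM: "kills M"
    unfolding M_def by (intro kills_combine kills kills_\<rho>)
  have agree: "M p = L p" if "p \<in> polys_upto (2 * n)" for p
    using \<rho>_degree[OF that] by (simp add: M_def)
  have null: "null_polys n M = null_polys n L" and psdM: "psd n M"
    using null_polys_cong[of n M L] psd_cong[of n M L] agree psd by auto
  have U: "M (u ^ Suc n * p) = 0" if p: "p \<in> null_polys n M" for p
  proof -
    have pP: "p \<in> polys_upto n" using p by (rule null_polys_memD)
    have "\<rho> (int (2 * n + 1)) (u ^ Suc n * p) = \<rho> (int n) p"
      using \<rho>_u_power_mult[of "int n" "Suc n" p] by (simp add: algebra_simps)
    moreover have "\<rho> (- int (2 * n + 1)) (u ^ Suc n * p) = 0"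
      using \<rho>_neg_u_power_mult[of "int (2 * n + 1)" "Suc n" p] \<rho>_degree[OF pP, of "- (int (2 * n + 1) + int (Suc n))"]
      by simp
    ultimately show ?thesis using \<alpha>[of p] p null by (simp add: M_def)
  qed
  have V: "M (v ^ Suc n * p) = 0" if p: "p \<in> null_polys n M" for p
  proof -
    have pP: "p \<in> polys_upto n" using p by (rule null_polys_memD)
    have "\<rho> (- int (2 * n + 1)) (v ^ Suc n * p) = \<rho> (- int n) p"
      using sw.\<rho>_u_power_mult[of "int n" "Suc n" p] by (simp add: algebra_simps)
    moreover have "\<rho> (int (2 * n + 1)) (v ^ Suc n * p) = 0"
    proof -
      have "\<rho> (int (2 * n + 1) + int (Suc n)) p = 0"
        by (rule \<rho>_degree[OF pP]) simp
      with sw.\<rho>_neg_u_power_mult[of "int (2 * n + 1)" "Suc n" p] show ?thesis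
        unfolding minus_minus by (simp only: mult_zero_right)
    qed
    ultimately show ?thesis using \<alpha>'[of p] p null by (simp add: M_def)
  qed
  from extension_step[OF linM killsM psdM n U V] obtain L' where L': "linear_functional L'" "kills L'"
    "\<forall>p\<in>polys_upto (2 * n + 1). L' p = M p" "psd (Suc n) L'"
    "\<exists>g\<in>null_polys (Suc n) L'. \<rho> (int (Suc n)) g \<noteq> 0 \<and> \<rho> (- int (Suc n)) g \<noteq> 0"
    "(\<exists>g\<in>null_polys n M. \<rho> (int n) g \<noteq> 0 \<or> \<rho> (- int n) g \<noteq> 0) \<longrightarrow> flat n L'"
    by blast
  have "L' p = L p" if "p \<in> polys_upto (2 * n)" for p
    using L'(3) agree[OF that] polys_upto_mono[OF that, of "2 * n + 1"] by simp
  then show ?thesis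
    using L' null by (intro exI[of _ L']) auto
qed

end

subsection \<open>Rank and atoms\<close>

definition atomic :: "(real \<times> real) set \<Rightarrow> (real \<times> real \<Rightarrow> real) \<Rightarrow> bipoly \<Rightarrow> real" where
  "atomic S w p = (\<Sum>z\<in>S. w z * eval_at p z)"

lemma linear_functional_atomic: "linear_functional (atomic S w)"
  by (simp add: linear_functional_def atomic_def sum.distrib sum_distrib_left algebra_simps)

lemma eval2_sum: "eval2 (sum f I) x y = (\<Sum>i\<in>I. eval2 (f i) x y)"
  by (rule linear_functional_sum[OF linear_functional_eval2])

lemma orthonormal_basis_cong:
  assumes agree: "\<And>p. p \<in> polys_upto (2 * n) \<Longrightarrow> L p = K p" and onb: "orthonormal_basis n L r q"
  shows "orthonormal_basis n K r q"
proof -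
  have eq: "K (p * p') = L (p * p')" if "p \<in> polys_upto n" "p' \<in> polys_upto n" for p p'
    using agree polys_upto_mult'[OF that, of "2 * n"] by simp
  have q: "q i \<in> polys_upto n" if "i < r" for i
    using onb that by (simp add: orthonormal_basis_def orthonormal_def)
  have "(\<Sum>i<r. cst (K (p * q i)) * q i) = (\<Sum>i<r. cst (L (p * q i)) * q i)"
    if "p \<in> polys_upto n" for p
    using eq[OF that q] by (intro sum.cong) auto
  then show ?thesis
    using onb null_polys_cong[of n L K] agree eq q
    by (simp add: orthonormal_basis_def orthonormal_def)
qed

lemma card_symmetric_interval: "card {- int n..int n} = 2 * n + 1"
  by (simp add: nat_eq_iff)

text \<open>Every polynomial of degree \<open>Suc n\<close> has a representative of degree
  \<open>n\<close> with the same Fourier coefficients.\<close>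

lemma flat_orthonormal_basis:
  assumes lin: "linear_functional L" and psd: "psd (Suc n) L" and flat: "flat n L"
    and onb: "orthonormal_basis n L r q"
  shows "orthonormal_basis (Suc n) L r q"
proof -
  have up: "p \<in> polys_upto n \<Longrightarrow> p \<in> polys_upto (Suc n)" for p
    by (rule polys_upto_Suc)
  have on: "orthonormal n L r q" using onb by (simp add: orthonormal_basis_def)
  then have q: "q i \<in> polys_upto (Suc n)" if "i < r" for i
    using that up by (simp add: orthonormal_def)
  have "p - (\<Sum>i<r. cst (L (p * q i)) * q i) \<in> null_polys (Suc n) L" if p: "p \<in> polys_upto (Suc n)" for p
  proof -
    obtain p' where p': "p' \<in> polys_upto n" "p - p' \<in> null_polys (Suc n) L"
      using flat p unfolding flat_def by blast
    have "L (p * q i) = L (p' * q i)" if "i < r" for i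
      using null_polysD[OF p'(2) q[OF that]] by (simp add: left_diff_distrib linear_functional_diff[OF lin])
    then have eq: "(\<Sum>i<r. cst (L (p * q i)) * q i) = (\<Sum>i<r. cst (L (p' * q i)) * q i)"
      by (intro sum.cong) auto
    have "p' - (\<Sum>i<r. cst (L (p' * q i)) * q i) \<in> null_polys n L"
      using onb p'(1) by (simp add: orthonormal_basis_def)
    then have "p' - (\<Sum>i<r. cst (L (p' * q i)) * q i) \<in> null_polys (Suc n) L"
      by (rule null_polys_psd_mono[OF lin psd le_SucI[OF order_refl]])
    from null_polys_add[OF lin p'(2) this] show ?thesis
      by (simp add: eq)
  qed
  then show ?thesis
    using on up by (auto simp: orthonormal_basis_def orthonormal_def)
qed

lemma flat_atomic:
  assumes lin: "linear_functional L" and psd: "psd (Suc n) L" and flat: "flat n L"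
    and onb: "orthonormal_basis n L r q"
  obtains S w where "finite S" "\<forall>z\<in>S. w z > 0" "card S \<le> r"
    "\<And>p. p \<in> polys_upto (2 * Suc n) \<Longrightarrow> L p = atomic S w p"
    "mrank (Suc n) (moments (atomic S w)) = r"
proof -
  note onb' = flat_orthonormal_basis[OF assms]
  from flat_finitely_atomic[OF lin psd flat onb'] obtain S w where S: "finite S" "card S \<le> r"
    "\<forall>z\<in>S. w z > 0" "\<And>p. p \<in> polys_upto (2 * Suc n) \<Longrightarrow> L p = atomic S w p"
    unfolding atomic_def by blast
  moreover have "mrank (Suc n) (moments (atomic S w)) = r"
    using mrank_moments[OF lin onb'] mrank_moments_cong[of "Suc n" L "atomic S w"] S(4) by simp
  ultimately show ?thesis using that by blast
qed

text \<open>The quotient by the radical has dimension \<open>r\<close>, and evaluation at the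
  \<open>r\<close> points is well defined on it and onto; hence it is also injective.\<close>

lemma null_if_interpolated:
  assumes lin: "linear_functional L" and onb: "orthonormal_basis n L r q"
    and S: "finite S" "card S = r" "\<And>z g. z \<in> S \<Longrightarrow> g \<in> null_polys n L \<Longrightarrow> eval_at g z = 0"
    and sep: "\<And>s. s \<in> S \<Longrightarrow> \<exists>p\<in>polys_upto n. eval_at p s \<noteq> 0 \<and> (\<forall>t\<in>S - {s}. eval_at p t = 0)"
    and p: "p \<in> polys_upto n" "\<And>z. z \<in> S \<Longrightarrow> eval_at p z = 0"
  shows "p \<in> null_polys n L"
proof -
  note ls = linear_functional_simps[OF lin]
  obtain f where f: "\<And>s. s \<in> S \<Longrightarrow> f s \<in> polys_upto n" "\<And>s. s \<in> S \<Longrightarrow> eval_at (f s) s \<noteq> 0"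
      "\<And>s t. s \<in> S \<Longrightarrow> t \<in> S \<Longrightarrow> t \<noteq> s \<Longrightarrow> eval_at (f s) t = 0"
    using sep by (metis Diff_iff singletonD)
  \<comment> \<open>The \<open>r + 1\<close> polynomials \<open>p\<close> (index
    \<open>None\<close>) and \<open>f s\<close> have a null combination; evaluating it at the points
    removes every \<open>f s\<close>.\<close>
  define F where "F = (\<lambda>i. case i of None \<Rightarrow> p | Some s \<Rightarrow> f s)"
  let ?I = "insert None (Some ` S)"
  have "card ?I = Suc r"
    using S(1,2) by (subst card_insert_disjoint) (auto simp: card_image)
  then obtain x where x: "\<exists>i\<in>?I. x i \<noteq> 0" "\<And>j. j < r \<Longrightarrow> (\<Sum>i\<in>?I. x i * L (F i * q j)) = 0"
    using exists_dependency[of ?I "{..<r}" "\<lambda>i j. L (F i * q j)"] S(1) by auto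
  define g where "g = (\<Sum>i\<in>?I. cst (x i) * F i)"
  have g: "g = cst (x None) * p + (\<Sum>s\<in>S. cst (x (Some s)) * f s)"
    unfolding g_def using S(1) by (subst sum.insert) (auto simp: F_def sum.reindex)
  have "g \<in> null_polys n L"
  proof (rule orthonormal_basis_null[OF lin onb])
    show "g \<in> polys_upto n"
      unfolding g using p(1) f(1) by (intro polys_upto_add polys_upto_sum polys_upto_scale)
    show "L (g * q j) = 0" if "j < r" for j
      using x(2)[OF that] by (simp only: g_def mult_sum_left[OF lin])
  qed
  have "x (Some t) = 0" if t: "t \<in> S" for t
  proof -
    have "eval_at g t = x None * eval_at p t + (\<Sum>s\<in>S. x (Some s) * eval_at (f s) t)"
      by (simp add: g eval2_sum)
    also have "(\<Sum>s\<in>S. x (Some s) * eval_at (f s) t) = (\<Sum>s\<in>S. if s = t then x (Some t) * eval_at (f t) t else 0)"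
      using f(3) t by (intro sum.cong) auto
    finally show ?thesis
      using S(1) S(3)[OF t \<open>g \<in> null_polys n L\<close>] p(2)[OF t] f(2)[OF t] t by simp
  qed
  then have "g = cst (x None) * p" and "x None \<noteq> 0"
    using x(1) by (auto simp: g)
  then have "p = cst (1 / x None) * g"
    by (simp flip: mult.assoc cst_simps(4))
  then show ?thesis
    using null_polys_scale[OF lin \<open>g \<in> null_polys n L\<close>] by metis
qed

context hyperbola_coordinates
begin

lemma rank_le:
  assumes "linear_functional L" and kills: "kills L" and "orthonormal n L r q"
  shows "r \<le> 2 * n + 1"
  unfolding card_symmetric_interval[symmetric]
proof (rule orthonormal_le_card[OF assms(1,3)])
  fix h p assume h: "h \<in> polys_upto n" "\<And>k. k \<in> {- int n..int n} \<Longrightarrow> \<rho> k h = 0"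
  have "Q dvd h" by (rule dvd_if_\<rho>_zero[OF h]) auto
  then show "L (h * p) = 0" by (intro kills_dvd[OF kills] dvd_mult2)
qed (simp_all add: linear_\<rho>)

text \<open>\<open>g\<close> is independent of the orthonormal system modulo \<open>Q\<close>, and
  only \<open>2 * n + 1\<close> coordinates are available.\<close>

lemma rank_le_if_nontrivial_null:
  assumes lin: "linear_functional L" and kills: "kills L" and on: "orthonormal n L r q"
    and g: "g \<in> null_polys n L" "\<rho> k0 g \<noteq> 0"
  shows "r \<le> 2 * n"
proof (rule ccontr)
  assume r: "\<not> r \<le> 2 * n"
  define q' where "q' = q(r := g)"
  from r have "card {- int n..int n} < card {..<Suc r}"
    unfolding card_symmetric_interval by simp
  from exists_dependency[OF finite_lessThan finite_atLeastAtMost_int this, of "\<lambda>i k. \<rho> k (q' i)"]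
  obtain x where "(\<exists>i\<in>{..<Suc r}. x i \<noteq> 0) \<and> (\<forall>k\<in>{- int n..int n}. (\<Sum>i<Suc r. x i * \<rho> k (q' i)) = 0)"
    by (elim exE)
  then have x: "\<exists>i<Suc r. x i \<noteq> 0"
      "\<And>k. k \<in> {- int n..int n} \<Longrightarrow> (\<Sum>i<Suc r. x i * \<rho> k (q' i)) = 0"
    by blast+
  have q': "(\<Sum>i<Suc r. cst (x i) * q' i) = (\<Sum>i<r. cst (x i) * q i) + cst (x r) * g"
    by (simp add: q'_def)
  have "(\<Sum>i<r. cst (x i) * q i) + cst (x r) * g \<in> polys_upto n"
    using on null_polys_memD[OF g(1)]
    by (auto simp: orthonormal_def intro!: polys_upto_add polys_upto_sum polys_upto_scale)
  then have dvd: "Q dvd (\<Sum>i<r. cst (x i) * q i) + cst (x r) * g"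
  proof (rule dvd_if_\<rho>_zero)
    fix k assume "\<bar>k\<bar> \<le> int n"
    then have "(\<Sum>i<Suc r. x i * \<rho> k (q' i)) = 0" by (intro x(2)) auto
    then have "\<rho> k (\<Sum>i<Suc r. cst (x i) * q' i) = 0" by (simp only: \<rho>_simps)
    then show "\<rho> k ((\<Sum>i<r. cst (x i) * q i) + cst (x r) * g) = 0" by (simp only: q')
  qed
  have "x j = 0" if "j < r" for j
  proof -
    have "L (((\<Sum>i<r. cst (x i) * q i) + cst (x r) * g) * q j) = 0"
      by (rule kills_dvd[OF kills dvd_mult2[OF dvd]])
    moreover have "L (g * q j) = 0"
      using g(1) on that by (intro null_polysD) (auto simp: orthonormal_def)
    ultimately show ?thesis
      using orthonormal_coeff[OF lin on that, of x]
      by (simp add: distrib_right linear_functional_add[OF lin] mult_cst_left[OF lin])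
  qed
  moreover from this have "Q dvd cst (x r) * g"
    using dvd by simp
  then have "x r = 0"
    using \<rho>_dvd[of "cst (x r) * g" k0] g(2) by (simp add: \<rho>_simps)
  ultimately show False using x(1) by (metis less_Suc_eq)
qed

text \<open>If the radical contains only multiples of \<open>Q\<close>, the \<open>2 * n + 1\<close>
  powers of \<open>u\<close> and \<open>v\<close> are independent in the quotient.\<close>

lemma rank_ge:
  assumes lin: "linear_functional L" and onb: "orthonormal_basis n L r q"
    and triv: "\<And>f. f \<in> null_polys n L \<Longrightarrow> Q dvd f"
  shows "2 * n + 1 \<le> r"
proof (rule ccontr)
  assume r: "\<not> 2 * n + 1 \<le> r"
  define e where "e = (\<lambda>k. if k \<ge> 0 then u ^ nat k else v ^ nat (- k))"
  let ?I = "{- int n..int n}"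
  from r have "card {..<r} < card ?I"
    unfolding card_symmetric_interval by simp
  from exists_dependency[OF finite_atLeastAtMost_int finite_lessThan this, of "\<lambda>k j. L (e k * q j)"]
  obtain x where "(\<exists>k\<in>?I. x k \<noteq> 0) \<and> (\<forall>j\<in>{..<r}. (\<Sum>k\<in>?I. x k * L (e k * q j)) = 0)"
    by (elim exE)
  then have x: "\<exists>k\<in>?I. x k \<noteq> 0" "\<And>j. j < r \<Longrightarrow> (\<Sum>k\<in>?I. x k * L (e k * q j)) = 0"
    by blast+
  define g where "g = (\<Sum>k\<in>?I. cst (x k) * e k)"
  have "g \<in> null_polys n L"
  proof (rule orthonormal_basis_null[OF lin onb])
    show "g \<in> polys_upto n"
      unfolding g_def e_def
      by (auto intro!: polys_upto_sum polys_upto_scale u_power' v_power')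
    show "L (g * q j) = 0" if "j < r" for j
      using x(2)[OF that] by (simp only: g_def mult_sum_left[OF lin])
  qed
  then have zero: "\<rho> k g = 0" for k by (intro \<rho>_dvd triv)
  have "\<rho> k g = (\<Sum>j\<in>?I. if j = k then x j else 0)" for k
    unfolding g_def \<rho>_simps e_def by (intro sum.cong) (auto simp: \<rho>_u_power \<rho>_v_power)
  then have "x k = 0" if "k \<in> ?I" for k
    using that zero[of k] by (simp add: sum.delta[OF finite_atLeastAtMost_int])
  then show False using x(1) by blast
qed

text \<open>The lower bound on the rank of order \<open>Suc n\<close> is recorded because it shows
  that this order already exhausts the atoms, so that continuing with the moments of the atomic
  measure is flat from there on.\<close>

theorem recursive_atomic:
  assumes lin: "linear_functional L" and kills: "kills L" and psd: "psd n L" and n: "n \<ge> 1"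
    and u: "u_recursive n L" and v: "v_recursive n L" and onb: "orthonormal_basis n L r q"
  obtains S w where "finite S" "\<forall>z\<in>S. w z > 0"
    "\<And>p. p \<in> polys_upto (2 * n) \<Longrightarrow> L p = atomic S w p"
    "card S \<le> mrank (Suc n) (moments (atomic S w))" "card S \<le> Suc r" "r \<le> 2 * n \<Longrightarrow> card S \<le> r"
proof -
  interpret sw: hyperbola_coordinates v u c Q "\<lambda>k. \<rho> (- k)" by (rule swapped)
  have on: "orthonormal n L r q" using onb by (simp add: orthonormal_basis_def)
  obtain L1 where L1: "linear_functional L1" "kills L1" "psd (Suc n) L1"
      and agree: "\<And>p. p \<in> polys_upto (2 * n) \<Longrightarrow> L1 p = L p"
      and g1: "\<exists>g\<in>null_polys (Suc n) L1. \<rho> (int (Suc n)) g \<noteq> 0 \<and> \<rho> (- int (Suc n)) g \<noteq> 0"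
      and flat1: "(\<exists>g\<in>null_polys n L. \<rho> (int n) g \<noteq> 0 \<or> \<rho> (- int n) g \<noteq> 0) \<Longrightarrow> flat n L1"
    using extension[OF lin kills psd n u v] by blast
  show ?thesis
  proof (cases "\<exists>g\<in>null_polys n L. \<rho> (int n) g \<noteq> 0 \<or> \<rho> (- int n) g \<noteq> 0")
    case True
    have "orthonormal_basis n L1 r q"
      using onb agree by (intro orthonormal_basis_cong[of n L L1]) auto
    from flat_atomic[OF L1(1,3) flat1[OF True] this] obtain S w where S: "finite S" "\<forall>z\<in>S. w z > 0"
      "card S \<le> r" "\<And>p. p \<in> polys_upto (2 * Suc n) \<Longrightarrow> L1 p = atomic S w p"
      "mrank (Suc n) (moments (atomic S w)) = r" by metis
    have "L p = atomic S w p" if "p \<in> polys_upto (2 * n)" for p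
      using S(4) agree[OF that] polys_upto_mono[OF that, of "2 * Suc n"] by simp
    then show ?thesis
      by (rule that[OF S(1,2)]) (use S in auto)
  next
    case False
    \<comment> \<open>No null polynomial has a top term, so \<open>null_polys_coeff_zero\<close> on
      both sides removes all coordinates and the rank is full.\<close>
    have "Q dvd f" if f: "f \<in> null_polys n L" for f
    proof (rule dvd_if_\<rho>_zero[OF null_polys_memD[OF f]])
      fix k :: int assume k: "\<bar>k\<bar> \<le> int n"
      show "\<rho> k f = 0"
      proof (cases "k \<ge> 0")
        case True
        then show ?thesis
          using null_polys_coeff_zero[OF lin kills n u _ f, of "nat k"] False k by auto
      next
        case neg: False
        then show ?thesis
          using sw.null_polys_coeff_zero[OF lin kills n v[unfolded v_recursive_swap] _ f, of "nat (- k)"] False k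
          by auto
      qed
    qed
    then have r: "r = 2 * n + 1"
      using rank_ge[OF lin onb] rank_le[OF lin kills on] by force
    have n1: "Suc n \<ge> 1" by simp
    \<comment> \<open>The null polynomial of \<open>g1\<close> has both top coefficients nonzero: it
      gives both recursions for \<open>L1\<close>, and it triggers flatness of the second
      extension.\<close>
    have "u_recursive (Suc n) L1" "v_recursive (Suc n) L1"
      unfolding v_recursive_swap
      using g1 u_recursive_if_top[OF L1(1,2) n1] sw.u_recursive_if_top[OF L1(1,2) n1] by blast+
    from extension[OF L1(1,2,3) n1 this] obtain L2 where L2: "linear_functional L2" "psd (Suc (Suc n)) L2"
      and agree2: "\<And>p. p \<in> polys_upto (2 * Suc n) \<Longrightarrow> L2 p = L1 p" and flat2: "flat (Suc n) L2"
      using g1 by blast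
    obtain r1 q1 where onb1: "orthonormal_basis (Suc n) L2 r1 q1"
      using orthonormal_basis_exists[OF L2(1) psd_mono[OF L2(2)]] by (metis le_SucI order_refl)
    have "orthonormal (Suc n) L1 r1 q1"
      using onb1 agree2 polys_upto_mult'[of _ "Suc n" _ "Suc n" "2 * Suc n"]
      by (auto simp: orthonormal_basis_def orthonormal_def)
    \<comment> \<open>In full rank \<open>2 * Suc n = Suc r\<close>, so the rank grows by at most
      one.\<close>
    then have r1: "r1 \<le> 2 * Suc n"
      using rank_le_if_nontrivial_null[OF L1(1,2)] g1 by blast
    from flat_atomic[OF L2 flat2 onb1] obtain S w where S: "finite S" "\<forall>z\<in>S. w z > 0"
      "card S \<le> r1" "\<And>p. p \<in> polys_upto (2 * Suc (Suc n)) \<Longrightarrow> L2 p = atomic S w p" by metis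
    have agree12: "L1 p = atomic S w p" if "p \<in> polys_upto (2 * Suc n)" for p
      using S(4) agree2[OF that] polys_upto_mono[OF that, of "2 * Suc (Suc n)"] by simp
    have "mrank (Suc n) (moments (atomic S w)) = r1"
      using mrank_moments[OF L2(1) onb1] mrank_moments_cong[of "Suc n" L2 "atomic S w"] agree2 agree12
      by simp
    moreover have "L p = atomic S w p" if "p \<in> polys_upto (2 * n)" for p
      using agree12 agree[OF that] polys_upto_mono[OF that, of "2 * Suc n"] by simp
    ultimately show ?thesis
      using S(1-3) r r1 by (intro that[of S w]) auto
  qed
qed

end

subsection \<open>Recursiveness from an extension or from the variety\<close>

text \<open>Multiples of \<open>Q\<close> of degree at most \<open>m\<close> are null; a monomial of
  degree \<open>2 * m - 2\<close> splits into one of degree \<open>m - 2\<close> absorbed by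
  \<open>Q\<close> and a test monomial of degree \<open>m\<close>.\<close>

lemma multiplicative_null_vanish:
  assumes lin: "linear_functional L" and Q: "Q \<in> polys_upto 2" "Q \<in> null_polys m L"
    and mult: "multiplicative_null m L" and m: "m \<ge> 2" and r: "r \<in> polys_upto (2 * m - 2)"
  shows "L (Q * r) = 0"
proof (rule linear_functional_eqI[OF linear_functional_mult[OF lin] _ r])
  show "linear_functional (\<lambda>_. 0)" by (simp add: linear_functional_def)
  fix i j assume ij: "i + j \<le> 2 * m - 2"
  then have "i + j \<le> (m - 2) + m" using m by simp
  then obtain k l k' l' where "mon i j = mon k l * mon k' l'" and kl: "k + l \<le> m - 2" "k' + l' \<le> m"
    by (rule mon_split)
  moreover have "Q * mon k l \<in> null_polys m L"
  proof -
    have "Q * mon k l \<in> polys_upto m"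
      using m by (intro polys_upto_mult'[OF Q(1) mon_polys_upto[OF kl(1)]]) auto
    moreover have "mon k l \<in> polys_upto m" using kl(1) by (intro mon_polys_upto) simp
    ultimately show ?thesis using mult Q(2) unfolding multiplicative_null_def by blast
  qed
  ultimately show "L (Q * mon i j) = 0"
    using null_polysD[OF _ mon_polys_upto[OF kl(2)]] by (metis mult.assoc)
qed

context hyperbola_coordinates
begin

text \<open>One order higher \<open>f * u\<close> lies within the degree bound, so recursive
  generation of the extension applies to the product itself.\<close>

lemma u_recursive_if_extension:
  assumes lin: "linear_functional L" and kills: "kills L" and n: "n \<ge> 1"
    and lin': "linear_functional L'" and kills': "kills L'" and psd': "psd (Suc n) L'"
    and mult: "multiplicative_null (Suc n) L'"
    and agree: "\<And>p. p \<in> polys_upto (2 * n) \<Longrightarrow> L' p = L p"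
  shows "u_recursive n L"
  unfolding u_recursive_def
proof (intro ballI impI)
  fix f q assume f: "f \<in> null_polys n L" "\<rho> (int n) f = 0" and q: "q \<in> polys_upto n"
  note fP = null_polys_memD[OF f(1)]
  obtain h where h: "h \<in> polys_upto n" "Q dvd u * f - h" "\<And>q. L (u * f * q) = L (h * q)"
    by (rule u_mult_reduce_zero[OF lin kills n fP f(2)]) blast
  have "f \<in> null_polys n L'"
    using f(1) null_polys_cong[of n L' L] agree by simp
  then have "f \<in> null_polys (Suc n) L'"
    by (rule null_polys_psd_mono[OF lin' psd' le_SucI[OF order_refl]])
  moreover have "u \<in> polys_upto (Suc n)" "f * u \<in> polys_upto (Suc n)"
    using polys_upto_mono[OF u_polys_upto] polys_upto_mult'[OF fP u_polys_upto] by auto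
  ultimately have "f * u \<in> null_polys (Suc n) L'"
    using mult unfolding multiplicative_null_def by blast
  then have "L' (f * u * q) = 0"
    by (rule null_polysD) (rule polys_upto_Suc[OF q])
  moreover have "L' (f * u * q) = L' (h * q)"
    using kills_cong[OF lin' kills' h(2), of q] by (simp add: mult.commute[of f u])
  moreover have "L' (h * q) = L (h * q)"
    using agree polys_upto_mult'[OF h(1) q, of "2 * n"] by simp
  ultimately show "L (u * f * q) = 0" using h(3) by simp
qed

lemma recursive_if_extension:
  assumes "linear_functional L" "kills L" "n \<ge> 1" "linear_functional L'" "kills L'" "psd (Suc n) L'"
    "multiplicative_null (Suc n) L'" "\<And>p. p \<in> polys_upto (2 * n) \<Longrightarrow> L' p = L p"
  shows "u_recursive n L" "v_recursive n L"
  unfolding v_recursive_swap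
  using u_recursive_if_extension[OF assms]
    hyperbola_coordinates.u_recursive_if_extension[OF swapped assms] by blast+

lemma eval_cong: "Q dvd p - q \<Longrightarrow> eval_at Q z = 0 \<Longrightarrow> eval_at p z = eval_at q z"
proof -
  assume "Q dvd p - q" "eval_at Q z = 0"
  then obtain r where "p - q = Q * r" by (elim dvdE)
  then have "eval_at (p - q) z = 0" using \<open>eval_at Q z = 0\<close> by (simp only: eval2_simps)
  then show ?thesis by simp
qed

lemma eval_uv: "eval_at Q z = 0 \<Longrightarrow> eval_at u z * eval_at v z = c"
  using eval_cong[OF dvd_uv] by simp

lemma eval_decomposition:
  assumes "p \<in> polys_upto m" "eval_at Q z = 0"
  shows "eval_at p z = \<rho> 0 p + (\<Sum>k=1..m. \<rho> (int k) p * eval_at u z ^ k)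
    + (\<Sum>k=1..m. \<rho> (- int k) p * eval_at v z ^ k)"
proof -
  have "Q dvd p - (cst (\<rho> 0 p) + (\<Sum>k=1..m. cst (\<rho> (int k) p) * u ^ k)
      + (\<Sum>k=1..m. cst (\<rho> (- int k) p) * v ^ k))"
    using decomposition[OF assms(1)] by (simp add: diff_diff_eq)
  from eval_cong[OF this assms(2)] show ?thesis by (simp add: eval2_sum)
qed

lemma point_eqI:
  assumes z: "eval_at Q z = 0" "eval_at Q z' = 0"
    and eq: "eval_at u z = eval_at u z'" "eval_at v z = eval_at v z'"
  shows "z = z'"
proof -
  have "eval_at p z = eval_at p z'" if "p \<in> polys_upto 1" for p
    using eval_decomposition[OF that z(1)] eval_decomposition[OF that z(2)] eq by simp
  from this[of "mon 0 1"] this[of "mon 1 0"] show ?thesis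
    by (simp add: mon_polys_upto prod_eq_iff)
qed

text \<open>If the radical is the set of polynomials vanishing on points of the curve, it is stable
  under multiplication by \<open>u\<close>: the reduced product agrees with \<open>u * f\<close> on
  the curve.\<close>

lemma u_recursive_if_vanishing:
  assumes lin: "linear_functional L" and kills: "kills L" and n: "n \<ge> 1"
    and S: "\<And>z. z \<in> S \<Longrightarrow> eval_at Q z = 0" "\<And>z g. z \<in> S \<Longrightarrow> g \<in> null_polys n L \<Longrightarrow> eval_at g z = 0"
    and null: "\<And>p. p \<in> polys_upto n \<Longrightarrow> (\<And>z. z \<in> S \<Longrightarrow> eval_at p z = 0) \<Longrightarrow> p \<in> null_polys n L"
  shows "u_recursive n L"
  unfolding u_recursive_def
proof (intro ballI impI)
  fix f q assume f: "f \<in> null_polys n L" "\<rho> (int n) f = 0" and q: "q \<in> polys_upto n"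
  obtain h where h: "h \<in> polys_upto n" "Q dvd u * f - h" "\<And>q. L (u * f * q) = L (h * q)"
    by (rule u_mult_reduce_zero[OF lin kills n null_polys_memD[OF f(1)] f(2)]) blast
  have "eval_at h z = 0" if "z \<in> S" for z
    using eval_cong[OF h(2) S(1)[OF that]] S(2)[OF that f(1)] by simp
  then have "h \<in> null_polys n L" by (rule null[OF h(1)])
  then show "L (u * f * q) = 0" using h(3) null_polysD[OF _ q] by simp
qed

text \<open>In the coordinates \<open>u\<close>, \<open>v\<close> the lines below pass through the points \<open>(x\<^sub>1, c / x\<^sub>1)\<close> and
  \<open>(x\<^sub>2, c / x\<^sub>2)\<close> of the hyperbola, respectively through \<open>(a, 0)\<close> and \<open>(0, b)\<close>.\<close>

lemma separating_poly_nondegenerate: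
  assumes c: "c \<noteq> 0" and s: "eval_at Q s = 0"
  shows "finite T \<Longrightarrow> card T \<le> 2 * n \<Longrightarrow> s \<notin> T \<Longrightarrow> (\<And>t. t \<in> T \<Longrightarrow> eval_at Q t = 0) \<Longrightarrow>
    \<exists>p\<in>polys_upto n. eval_at p s \<noteq> 0 \<and> (\<forall>t\<in>T. eval_at p t = 0)"
proof (induction n arbitrary: T)
  case 0
  then show ?case by (intro bexI[of _ 1]) auto
next
  case (Suc n)
  show ?case
  proof (cases "T = {}")
    case True
    then show ?thesis by (intro bexI[of _ 1]) auto
  next
    case False
    then obtain t1 where t1: "t1 \<in> T" by blast
    \<comment> \<open>Each line disposes of two points; if only \<open>t1\<close> is left,
      \<open>t2 = t1\<close> is taken.\<close>
    obtain t2 where t2: "t2 \<in> T" "card (T - {t1, t2}) \<le> 2 * n"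
    proof (cases "T - {t1} = {}")
      case True
      then have "T - {t1, t1} = {}" by simp
      then have "card (T - {t1, t1}) \<le> 2 * n" by (simp only: card.empty)
      then show ?thesis by (rule that[OF t1])
    next
      case ne: False
      then obtain t2 where "t2 \<in> T - {t1}" by blast
      then have "card (T - {t1, t2}) \<le> 2 * n"
        using Suc.prems(1,2) t1 by (subst card_Diff_subset) auto
      then show ?thesis using that \<open>t2 \<in> T - {t1}\<close> by blast
    qed
    obtain p where p: "p \<in> polys_upto n" "eval_at p s \<noteq> 0" "\<forall>t\<in>T - {t1, t2}. eval_at p t = 0"
      using Suc.IH[of "T - {t1, t2}"] Suc.prems t2(2) by auto
    define x1 where "x1 = eval_at u t1"
    define x2 where "x2 = eval_at u t2"
    define l where "l = cst (x1 * x2) * v + cst c * u - cst (c * (x1 + x2))"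
    have "l \<in> polys_upto 1"
      unfolding l_def
      by (intro polys_upto_add polys_upto_diff polys_upto_scale cst_polys_upto u_polys_upto v_polys_upto)
    then have l: "l * p \<in> polys_upto (Suc n)"
      by (rule polys_upto_mult'[OF _ p(1)]) simp
    \<comment> \<open>Multiplying by \<open>u\<close>, nonzero on the curve as \<open>c\<close> is
      nonzero, turns the restriction of the line into a quadratic with roots \<open>x1\<close> and
      \<open>x2\<close>.\<close>
    have el: "eval_at u z * eval_at l z = c * (eval_at u z - x1) * (eval_at u z - x2)"
      if "eval_at Q z = 0" for z
    proof -
      have "eval_at u z * eval_at l z = x1 * x2 * (eval_at u z * eval_at v z)
          + c * eval_at u z * eval_at u z - c * (x1 + x2) * eval_at u z"
        by (simp add: l_def algebra_simps)
      then show ?thesis by (simp add: eval_uv[OF that] algebra_simps)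
    qed
    have u0: "eval_at u z \<noteq> 0" if "eval_at Q z = 0" for z
      using eval_uv[OF that] c by auto
    have "eval_at l t1 = 0" "eval_at l t2 = 0"
      using el[OF Suc.prems(4)[OF t1]] u0[OF Suc.prems(4)[OF t1]]
        el[OF Suc.prems(4)[OF t2(1)]] u0[OF Suc.prems(4)[OF t2(1)]]
      by (simp_all add: x1_def x2_def)
    moreover have "eval_at u s \<noteq> eval_at u t" if t: "t \<in> T" for t
    proof
      assume eq: "eval_at u s = eval_at u t"
      have "eval_at u s * eval_at v s = eval_at u t * eval_at v t"
        using eval_uv[OF s] eval_uv[OF Suc.prems(4)[OF t]] by simp
      then have "eval_at v s = eval_at v t" using eq u0[OF s] by simp
      then show False using point_eqI[OF s Suc.prems(4)[OF t] eq] t Suc.prems(3) by simp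
    qed
    then have "eval_at l s \<noteq> 0"
      using el[OF s] c t1 t2(1) by (auto simp: x1_def x2_def)
    ultimately show ?thesis
      using p l by (intro bexI[of _ "l * p"]) auto
  qed
qed

text \<open>A line through \<open>(a, 0)\<close> and \<open>(0, b)\<close> removes at least one
  point from each nonempty branch, so each branch may carry \<open>n\<close> points. As
  \<open>v\<close> vanishes at \<open>s\<close>, the line avoids \<open>s\<close> when
  \<open>a\<close> differs from \<open>u(s)\<close> and \<open>b\<close> is nonzero.\<close>

lemma separating_poly_degenerate:
  assumes c: "c = 0" and s: "eval_at Q s = 0" "eval_at v s = 0"
  shows "finite T \<Longrightarrow> card {t \<in> T. eval_at v t = 0} \<le> n \<Longrightarrow> card {t \<in> T. eval_at v t \<noteq> 0} \<le> n \<Longrightarrow>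
    s \<notin> T \<Longrightarrow> (\<And>t. t \<in> T \<Longrightarrow> eval_at Q t = 0) \<Longrightarrow>
    \<exists>p\<in>polys_upto n. eval_at p s \<noteq> 0 \<and> (\<forall>t\<in>T. eval_at p t = 0)"
proof (induction n arbitrary: T)
  case 0
  then have "{t \<in> T. eval_at v t = 0} = {}" "{t \<in> T. eval_at v t \<noteq> 0} = {}"
    by auto
  then have "T = {}" by auto
  then show ?case by (intro bexI[of _ 1]) auto
next
  case (Suc n)
  let ?A = "{t \<in> T. eval_at v t = 0}" and ?B = "{t \<in> T. eval_at v t \<noteq> 0}"
  \<comment> \<open>A point of \<open>?A\<close> differs from \<open>s\<close> while
    \<open>v\<close> is 0 at both, so they differ in \<open>u\<close>; with \<open>?A\<close> empty
    any other value will do.\<close>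
  obtain a where a: "a \<noteq> eval_at u s" "?A = {} \<or> (\<exists>t\<in>?A. eval_at u t = a)"
  proof (cases "?A = {}")
    case True
    then show ?thesis using that[of "eval_at u s + 1"] by simp
  next
    case False
    then obtain t where t: "t \<in> ?A" by blast
    then have "eval_at u s \<noteq> eval_at u t"
      using point_eqI[OF s(1), of t] s(2) Suc.prems(4,5) by force
    then show ?thesis using that[of "eval_at u t"] t by force
  qed
  obtain b where b: "b \<noteq> 0" "?B = {} \<or> (\<exists>t\<in>?B. eval_at v t = b)"
    using that[of 1] by blast
  define l where "l = cst b * u + cst a * v - cst (a * b)"
  define T' where "T' = {t \<in> T. eval_at l t \<noteq> 0}"
  have uB: "eval_at u t = 0" if "t \<in> ?B" for t
    using eval_uv[of t] Suc.prems(5) that c by auto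
  have "card {t \<in> T'. eval_at v t = 0} \<le> n"
  proof (cases "?A = {}")
    case True
    then have "{t \<in> T'. eval_at v t = 0} = {}" by (auto simp: T'_def)
    then show ?thesis by (metis card.empty le0)
  next
    case False
    then obtain t where t: "t \<in> ?A" "eval_at u t = a" using a(2) by blast
    then have "{t \<in> T'. eval_at v t = 0} \<subseteq> ?A - {t}"
      by (auto simp: T'_def l_def)
    then have "card {t \<in> T'. eval_at v t = 0} \<le> card (?A - {t})"
      using Suc.prems(1) by (intro card_mono) auto
    also have "\<dots> = card ?A - 1" using t(1) by (rule card_Diff_singleton)
    finally show ?thesis using Suc.prems(2) by simp
  qed
  moreover have "card {t \<in> T'. eval_at v t \<noteq> 0} \<le> n"
  proof (cases "?B = {}")
    case True
    then have "{t \<in> T'. eval_at v t \<noteq> 0} = {}" by (auto simp: T'_def)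
    then show ?thesis by (metis card.empty le0)
  next
    case False
    then obtain t where t: "t \<in> ?B" "eval_at v t = b" using b(2) by blast
    then have "eval_at l t = 0" using uB[OF t(1)] by (simp add: l_def)
    then have "{t \<in> T'. eval_at v t \<noteq> 0} \<subseteq> ?B - {t}"
      by (auto simp: T'_def)
    then have "card {t \<in> T'. eval_at v t \<noteq> 0} \<le> card (?B - {t})"
      using Suc.prems(1) by (intro card_mono) auto
    also have "\<dots> = card ?B - 1" using t(1) by (rule card_Diff_singleton)
    finally show ?thesis using Suc.prems(3) by simp
  qed
  ultimately obtain p where p: "p \<in> polys_upto n" "eval_at p s \<noteq> 0" "\<forall>t\<in>T'. eval_at p t = 0"
    using Suc.IH[of T'] Suc.prems(1,4,5) by (auto simp: T'_def)
  have "l \<in> polys_upto 1"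
    unfolding l_def
    by (intro polys_upto_add polys_upto_diff polys_upto_scale cst_polys_upto u_polys_upto v_polys_upto)
  then have "l * p \<in> polys_upto (Suc n)"
    by (rule polys_upto_mult'[OF _ p(1)]) simp
  moreover have "eval_at l s = b * (eval_at u s - a)"
    using s(2) by (simp add: l_def algebra_simps)
  ultimately have "eval_at (l * p) s \<noteq> 0"
    using p(2) a(1) b(1) by simp
  moreover have "eval_at (l * p) t = 0" if "t \<in> T" for t
    using p(3) that by (cases "eval_at l t = 0") (simp_all add: T'_def)
  ultimately show ?case
    using \<open>l * p \<in> polys_upto (Suc n)\<close> by blast
qed

text \<open>If the null polynomials vanish on one line of the degenerate hyperbola, the variety is infinite and
  its cardinality says nothing about the other line; there recursive generation takes over.\<close>

lemma recursive_if_vanishing_on_line: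
  assumes lin: "linear_functional L" and kills: "kills L" and n: "n \<ge> 1" and c: "c = 0"
    and mult: "multiplicative_null n L"
    and zero: "\<And>g k. g \<in> null_polys n L \<Longrightarrow> k \<ge> 0 \<Longrightarrow> \<rho> k g = 0"
  shows "u_recursive n L" "v_recursive n L"
proof -
  interpret sw: hyperbola_coordinates v u c Q "\<lambda>k. \<rho> (- k)" by (rule swapped)
  \<comment> \<open>\<open>f\<close> has only negative coordinates, that is positive powers of
    \<open>v\<close>, and \<open>u * v\<close> is 0 modulo \<open>Q\<close>.\<close>
  have dvd: "Q dvd u * f" if f: "f \<in> null_polys n L" for f
  proof (rule dvd_if_\<rho>_zero)
    show "u * f \<in> polys_upto (1 + n)"
      by (rule polys_upto_mult[OF u_polys_upto null_polys_memD[OF f]])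
    show "\<rho> k (u * f) = 0" for k
      using \<rho>_u[of "k - 1" f] zero[OF f, of "k - 1"] c by auto
  qed
  then show "u_recursive n L"
    unfolding u_recursive_def using kills_dvd[OF kills] by (simp add: dvd_mult2)
  show "v_recursive n L"
  proof (cases "\<exists>g\<in>null_polys n L. \<rho> (- int n) g \<noteq> 0")
    case True
    then show ?thesis
      unfolding v_recursive_swap using sw.u_recursive_if_top[OF lin kills n] by blast
  next
    case False
    have "\<rho> (- int d) f = 0" if f: "f \<in> null_polys n L" and d: "d \<le> n" for f d
      using d
    proof (induction "n - d" arbitrary: d rule: less_induct)
      case less
      note fP = null_polys_memD[OF f]
      show ?case
      proof (cases "d = n \<or> d = 0")
        case True
        then show ?thesis using False f zero[OF f, of 0] by auto
      next
        case d: False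
        \<comment> \<open>Coefficients beyond \<open>d\<close> already vanish, so \<open>h\<close>
          represents \<open>f\<close> with actual degree at most \<open>d\<close>; recursive
          generation then applies to \<open>h * v ^ (n - d)\<close>, whose top coefficient is that
          of \<open>v ^ d\<close>.\<close>
        define h where "h = (\<Sum>k=1..d. cst (\<rho> (- int k) f) * v ^ k)"
        have hP: "h \<in> polys_upto d"
          unfolding h_def by (auto intro!: polys_upto_sum polys_upto_scale v_power')
        have "(\<Sum>k=1..n. cst (\<rho> (int k) f) * u ^ k) = 0"
          using zero[OF f] by (intro sum.neutral) auto
        moreover have "(\<Sum>k=1..n. cst (\<rho> (- int k) f) * v ^ k) = h"
          unfolding h_def using less d
          by (intro sum.mono_neutral_right) auto
        ultimately have fh: "Q dvd f - h"
          using decomposition[OF fP] zero[OF f, of 0] by simp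
        have "h \<in> null_polys n L"
          using polys_upto_mono[OF hP less.prems] kills_cong[OF lin kills fh] null_polysD[OF f]
          by (simp add: null_polys_def)
        moreover have "h * v ^ (n - d) \<in> polys_upto n"
          using less.prems by (intro polys_upto_mult'[OF hP v_power]) simp
        moreover have "v ^ (n - d) \<in> polys_upto n" by (rule v_power') simp
        ultimately have "h * v ^ (n - d) \<in> null_polys n L"
          using mult unfolding multiplicative_null_def by blast
        then have "\<rho> (- int n) (h * v ^ (n - d)) = 0"
          using False by blast
        moreover have "\<rho> (- int n) (h * v ^ (n - d)) = \<rho> (- int d) h"
          using sw.\<rho>_u_power_mult[of "int d" "n - d" h] less.prems by (simp add: mult.commute)
        ultimately show ?thesis
          using \<rho>_cong[OF fh] by simp
      qed
    qed
    then have "Q dvd f" if "f \<in> null_polys n L" for f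
    proof (intro dvd_if_\<rho>_zero[OF null_polys_memD[OF that]])
      fix k :: int assume "\<bar>k\<bar> \<le> int n"
      then show "\<rho> k f = 0"
        using zero[OF that, of k] \<open>\<And>f d. f \<in> null_polys n L \<Longrightarrow> d \<le> n \<Longrightarrow> \<rho> (- int d) f = 0\<close>[OF that, of "nat (- k)"]
        by (cases "k \<ge> 0") auto
    qed
    then show ?thesis
      unfolding v_recursive_def using kills_dvd[OF kills] by (simp add: dvd_mult dvd_mult2)
  qed
qed

text \<open>On the line where \<open>v\<close> vanishes, \<open>g\<close> is a polynomial in
  \<open>u\<close> with coefficients \<open>\<rho> i g\<close>, nonzero and of degree at most
  \<open>n\<close>, and \<open>u\<close> separates the points.\<close>

lemma card_line_points_le:
  assumes g: "g \<in> polys_upto n" "k \<ge> 0" "\<rho> k g \<noteq> 0"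
    and S: "finite S" "\<And>z. z \<in> S \<Longrightarrow> eval_at Q z = 0" "\<And>z. z \<in> S \<Longrightarrow> eval_at g z = 0"
  shows "card {z \<in> S. eval_at v z = 0} \<le> n"
proof -
  define P where "P = (\<Sum>i\<le>n. monom (\<rho> (int i) g) i)"
  have coeff: "coeff P i = (if i \<le> n then \<rho> (int i) g else 0)" for i
    by (simp add: P_def coeff_sum)
  have "k \<le> int n"
    using \<rho>_degree[OF g(1), of k] g(2,3) by (cases "k \<le> int n") auto
  then have "coeff P (nat k) \<noteq> 0"
    using g(2,3) coeff[of "nat k"] by auto
  then have "P \<noteq> 0" by auto
  have deg: "degree P \<le> n"
    by (rule degree_le) (simp add: coeff)
  let ?A = "{z \<in> S. eval_at v z = 0}"
  have "inj_on (\<lambda>z. eval_at u z) ?A"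
  proof (rule inj_onI)
    fix z z' assume "z \<in> ?A" "z' \<in> ?A" and eq: "eval_at u z = eval_at u z'"
    then show "z = z'" by (intro point_eqI[OF S(2) S(2) eq]) auto
  qed
  then have "card ?A = card ((\<lambda>z. eval_at u z) ` ?A)"
    by (rule card_image[symmetric])
  also have "(\<lambda>z. eval_at u z) ` ?A \<subseteq> {x. poly P x = 0}"
  proof (rule image_subsetI)
    fix z assume "z \<in> ?A"
    then have zS: "z \<in> S" and z: "eval_at v z = 0" by auto
    have "poly P (eval_at u z) = (\<Sum>i\<le>n. \<rho> (int i) g * eval_at u z ^ i)"
      by (simp add: P_def poly_sum poly_monom)
    also have "\<dots> = \<rho> 0 g + (\<Sum>i=1..n. \<rho> (int i) g * eval_at u z ^ i)"
      by (simp add: atMost_atLeast0 sum.atLeast_Suc_atMost)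
    also have "\<dots> = eval_at g z"
      using eval_decomposition[OF g(1) S(2)[OF zS]] z by simp
    finally show "eval_at u z \<in> {x. poly P x = 0}" using S(3)[OF zS] by simp
  qed
  then have "card ((\<lambda>z. eval_at u z) ` ?A) \<le> card {x. poly P x = 0}"
    using poly_roots_finite[OF \<open>P \<noteq> 0\<close>] by (intro card_mono)
  also have "\<dots> \<le> n"
    using poly_roots_degree[OF \<open>P \<noteq> 0\<close>] deg by simp
  finally show ?thesis .
qed

theorem recursive_if_variety:
  assumes lin: "linear_functional L" and kills: "kills L" and n: "n \<ge> 1"
    and onb: "orthonormal_basis n L r q" and mult: "multiplicative_null n L"
    and S: "finite S" "card S = r" "\<And>z. z \<in> S \<Longrightarrow> eval_at Q z = 0"
      "\<And>z g. z \<in> S \<Longrightarrow> g \<in> null_polys n L \<Longrightarrow> eval_at g z = 0"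
  shows "u_recursive n L" "v_recursive n L"
proof -
  interpret sw: hyperbola_coordinates v u c Q "\<lambda>k. \<rho> (- k)" by (rule swapped)
  have sep: "u_recursive n L \<and> v_recursive n L"
    if separated: "\<And>s. s \<in> S \<Longrightarrow> \<exists>p\<in>polys_upto n. eval_at p s \<noteq> 0 \<and> (\<forall>t\<in>S - {s}. eval_at p t = 0)"
  proof -
    have "p \<in> null_polys n L" if "p \<in> polys_upto n" "\<And>z. z \<in> S \<Longrightarrow> eval_at p z = 0" for p
      using null_if_interpolated[OF lin onb S(1,2,4) separated that] .
    then show ?thesis
      unfolding v_recursive_swap
      using u_recursive_if_vanishing[OF lin kills n S(3,4)]
        sw.u_recursive_if_vanishing[OF lin kills n S(3,4)] by blast
  qed
  \<comment> \<open>For two lines the question is whether the radical vanishes identically on one of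
    them; only if it does on neither is the number of points on each line bounded.\<close>
  consider "c \<noteq> 0" | "c = 0" "\<And>g k. g \<in> null_polys n L \<Longrightarrow> k \<ge> 0 \<Longrightarrow> \<rho> k g = 0"
    | "c = 0" "\<And>g k. g \<in> null_polys n L \<Longrightarrow> k \<ge> 0 \<Longrightarrow> \<rho> (- k) g = 0"
    | g g' k k' where "c = 0" "g \<in> null_polys n L" "k \<ge> 0" "\<rho> k g \<noteq> 0"
        "g' \<in> null_polys n L" "k' \<ge> 0" "\<rho> (- k') g' \<noteq> 0"
    by blast
  then have "u_recursive n L \<and> v_recursive n L"
  proof cases
    case 1
    \<comment> \<open>All points but one number at most \<open>2 * n\<close>: two for each of
      \<open>n\<close> lines.\<close>
    have "r \<le> 2 * n + 1"
      using rank_le[OF lin kills] onb by (auto simp: orthonormal_basis_def)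
    then have "card (S - {s}) \<le> 2 * n" if "s \<in> S" for s
      using S(1,2) that by simp
    then show ?thesis
      using separating_poly_nondegenerate[OF 1 S(3), of _ "S - {_}"] S(1,3) by (intro sep) auto
  next
    case 2
    then show ?thesis
      using recursive_if_vanishing_on_line[OF lin kills n 2(1) mult] by blast
  next
    case 3
    have "sw.v_recursive n L = u_recursive n L" "sw.u_recursive n L = v_recursive n L"
      by (simp_all add: sw.v_recursive_def u_recursive_def v_recursive_swap)
    then show ?thesis
      using sw.recursive_if_vanishing_on_line[OF lin kills n 3(1) mult] 3(2) by blast
  next
    case 4
    have A: "card {z \<in> S. eval_at v z = 0} \<le> n"
      using card_line_points_le[OF null_polys_memD[OF 4(2)] 4(3,4) S(1,3)] S(4) 4(2) by blast
    have B: "card {z \<in> S. eval_at u z = 0} \<le> n"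
      using sw.card_line_points_le[OF null_polys_memD[OF 4(5)] 4(6,7) S(1,3)] S(4) 4(5) by blast
    have uv: "eval_at u z = 0 \<or> eval_at v z = 0" if "z \<in> S" for z
      using eval_uv[OF S(3)[OF that]] 4(1) by simp
    have sub: "card {t \<in> S - {s}. R t} \<le> n" if "\<And>t. t \<in> S \<Longrightarrow> R t \<Longrightarrow> R' t" "card {t \<in> S. R' t} \<le> n"
      for R R' :: "real \<times> real \<Rightarrow> bool" and s
      using card_mono[of "{t \<in> S. R' t}" "{t \<in> S - {s}. R t}"] S(1) that by fastforce
    have c1: "card {t \<in> S - {s}. eval_at v t = 0} \<le> n" for s
      by (rule sub[OF _ A])
    have c2: "card {t \<in> S - {s}. eval_at v t \<noteq> 0} \<le> n" for s
      by (rule sub[OF _ B]) (use uv in blast)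
    have c3: "card {t \<in> S - {s}. eval_at u t = 0} \<le> n" for s
      by (rule sub[OF _ B])
    have c4: "card {t \<in> S - {s}. eval_at u t \<noteq> 0} \<le> n" for s
      by (rule sub[OF _ A]) (use uv in blast)
    show ?thesis
    proof (rule sep)
      fix s assume s: "s \<in> S"
      show "\<exists>p\<in>polys_upto n. eval_at p s \<noteq> 0 \<and> (\<forall>t\<in>S - {s}. eval_at p t = 0)"
      proof (cases "eval_at v s = 0")
        case True
        show ?thesis
          by (rule separating_poly_degenerate[OF 4(1) S(3)[OF s] True _ c1 c2]) (use S(1,3) in auto)
      next
        case False
        then have "eval_at u s = 0" using uv[OF s] by simp
        show ?thesis
          by (rule sw.separating_poly_degenerate[OF 4(1) S(3)[OF s] \<open>eval_at u s = 0\<close> _ c3 c4])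
            (use S(1,3) in auto)
      qed
    qed
  qed
  then show "u_recursive n L" "v_recursive n L" by blast+
qed

text \<open>The given \<open>L\<close> vanishes on multiples of \<open>Q\<close> only in degree at
  most \<open>2 * m\<close>. It is rebuilt from its values on powers of \<open>u\<close> and
  \<open>v\<close>; agreement uses that the quotient by \<open>Q\<close> has degree at most
  \<open>2 * m - 2\<close>, which divisibility alone would not tell.\<close>

lemma kills_normalization:
  assumes lin: "linear_functional L"
    and decomp: "\<And>p. p \<in> polys_upto (2 * m) \<Longrightarrow> \<exists>r\<in>polys_upto (2 * m - 2).
      p - cst (\<rho> 0 p) - (\<Sum>k=1..2*m. cst (\<rho> (int k) p) * u ^ k)
        - (\<Sum>k=1..2*m. cst (\<rho> (- int k) p) * v ^ k) = Q * r"
    and low: "\<And>r. r \<in> polys_upto (2 * m - 2) \<Longrightarrow> L (Q * r) = 0"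
  obtains L' where "linear_functional L'" "kills L'" "\<And>p. p \<in> polys_upto (2 * m) \<Longrightarrow> L' p = L p"
proof -
  note ls = linear_functional_simps[OF lin]
  define L' where "L' = (\<lambda>p. \<rho> 0 p * L 1 + (\<Sum>k=1..2*m. \<rho> (int k) p * L (u ^ k))
    + (\<Sum>k=1..2*m. \<rho> (- int k) p * L (v ^ k)))"
  have "linear_functional L'"
    unfolding linear_functional_def L'_def
    by (simp add: \<rho>_simps distrib_right sum.distrib sum_distrib_left distrib_left mult.assoc)
  moreover have "kills L'"
    by (simp add: kills_def L'_def \<rho>_Q)
  moreover have "L' p = L p" if p: "p \<in> polys_upto (2 * m)" for p
  proof -
    obtain r where r: "r \<in> polys_upto (2 * m - 2)"
        "p - cst (\<rho> 0 p) - (\<Sum>k=1..2*m. cst (\<rho> (int k) p) * u ^ k)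
          - (\<Sum>k=1..2*m. cst (\<rho> (- int k) p) * v ^ k) = Q * r"
      using decomp[OF p] by blast
    have one: "cst (\<rho> 0 p) = cst (\<rho> 0 p) * 1" by simp
    have "L (p - cst (\<rho> 0 p) * 1 - (\<Sum>k=1..2*m. cst (\<rho> (int k) p) * u ^ k)
          - (\<Sum>k=1..2*m. cst (\<rho> (- int k) p) * v ^ k)) = 0"
      using low[OF r(1)] r(2) by simp
    then show ?thesis unfolding ls L'_def by simp
  qed
  ultimately show ?thesis using that by blast
qed

end

subsection \<open>Existence of the coordinates\<close>

text \<open>The positive discriminant splits the quadratic part into two independent real linear
  forms; their constant terms absorb the linear part, leaving
  \<open>\<kappa> Q = u v - c\<close>.\<close>

lemma quadratic_form_factorization:
  fixes A B C D E F :: real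
  assumes "B\<^sup>2 - 4 * A * C > 0"
  obtains a1 b1 e1 a2 b2 e2 c \<kappa> where "a1 * b2 - a2 * b1 \<noteq> 0" "\<kappa> \<noteq> 0"
    "\<kappa> * A = a1 * a2" "\<kappa> * B = a1 * b2 + a2 * b1" "\<kappa> * C = b1 * b2"
    "\<kappa> * D = a1 * e2 + a2 * e1" "\<kappa> * E = b1 * e2 + b2 * e1" "\<kappa> * F = e1 * e2 - c"
proof (cases "A = 0")
  case True
  then have "B \<noteq> 0" using assms by auto
  show ?thesis
    \<comment> \<open>Here \<open>Q / B\<close> has quadratic part
      \<open>y (x + (C / B) y)\<close>.\<close>
    by (rule that[of 0 "C / B" 1 1 "1 / B" "E / B - D / B * (C / B)" "D / B"
          "D / B * (E / B - D / B * (C / B)) - F / B"])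
      (use True \<open>B \<noteq> 0\<close> in \<open>simp_all add: field_simps\<close>)
next
  case False
  define s where "s = sqrt (B\<^sup>2 - 4 * A * C)"
  have s: "s * s = B\<^sup>2 - 4 * A * C" "s > 0"
    using assms by (simp_all add: s_def)
  define r1 where "r1 = (- B + s) / (2 * A)"
  define r2 where "r2 = (- B - s) / (2 * A)"
  have sum: "r1 + r2 = - B / A"
    using False by (simp add: r1_def r2_def field_simps)
  have "r1 * r2 = (B * B - s * s) / (4 * (A * A))"
    using False by (simp add: r1_def r2_def field_simps)
  then have prod: "r1 * r2 = C / A"
    using False by (simp add: s(1) power2_eq_square field_simps)
  have diff: "r1 - r2 \<noteq> 0"
    using False s(2) by (simp add: r1_def r2_def diff_divide_distrib[symmetric])
  \<comment> \<open>\<open>e1\<close> and \<open>e2\<close> solve \<open>e1 + e2 = D / A\<close> and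
    \<open>- r1 * e2 - r2 * e1 = E / A\<close>, a system with determinant \<open>r1 - r2\<close> up
    to sign.\<close>
  define e1 where "e1 = (E / A + r1 * (D / A)) / (r1 - r2)"
  define e2 where "e2 = D / A - e1"
  have "e1 * (r1 - r2) = E / A + r1 * (D / A)"
    using diff by (simp add: e1_def)
  then have "E / A = - r1 * e2 + - r2 * e1"
    by (simp add: e2_def algebra_simps)
  then show ?thesis
    using False sum prod diff
    by (intro that[of 1 "- r2" 1 "- r1" "1 / A" e2 e1 "e1 * e2 - F / A"]) (simp_all add: e2_def)
qed

definition affine_poly :: "real \<Rightarrow> real \<Rightarrow> real \<Rightarrow> bipoly" where
  "affine_poly a b e = cst a * mon 0 1 + cst b * mon 1 0 + cst e"

lemma affine_poly_polys_upto: "affine_poly a b e \<in> polys_upto 1"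
  unfolding affine_poly_def
  by (intro polys_upto_add polys_upto_scale cst_polys_upto mon_polys_upto) auto

lemma affine_poly_mult_mon:
  "affine_poly a b e * mon i j = cst a * mon i (Suc j) + cst b * mon (Suc i) j + cst e * mon i j"
  using mon_mult[of 0 1 i j] mon_mult[of 1 0 i j] by (simp add: affine_poly_def distrib_right mult.assoc)

lemma affine_poly_mult: "affine_poly a b e * affine_poly a' b' e' = cst (a * a') * mon 0 2 + cst (a * b' + a' * b) * mon 1 1
    + cst (b * b') * mon 2 0 + cst (a * e' + a' * e) * mon 0 1 + cst (b * e' + b' * e) * mon 1 0 + cst (e * e')"
proof -
  have "mon 0 2 = mon 0 1 * mon 0 1" "mon 1 1 = mon 0 1 * mon 1 0" "mon 2 0 = mon 1 0 * mon 1 0"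
    by (simp_all add: mon_mult numeral_2_eq_2)
  then show ?thesis by (simp add: affine_poly_def algebra_simps)
qed

lemma quadratic_bipoly:
  "[:[:F, D, A:], [:E, B:], [:C:]:] = cst A * mon 0 2 + cst B * mon 1 1 + cst C * mon 2 0
    + cst D * mon 0 1 + cst E * mon 1 0 + cst F"
  by (simp add: cst_def mon_def monom_Suc monom_0 numeral_2_eq_2)

lemma affine_poly_combination:
  "cst a * affine_poly x y z + cst b * affine_poly x' y' z' + cst e
    = affine_poly (a * x + b * x') (a * y + b * y') (a * z + b * z' + e)"
  by (simp add: affine_poly_def algebra_simps)

text \<open>Cramer's rule, used in both directions: the first two equations describe the
  substitution that turns \<open>u\<close>, \<open>v\<close> into \<open>x\<close>,
  \<open>y\<close>, the last two express \<open>x\<close>, \<open>y\<close> through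
  \<open>u\<close>, \<open>v\<close>.\<close>

lemma affine_poly_inverse:
  assumes "a1 * b2 - a2 * b1 \<noteq> 0"
  obtains x1 y1 z1 x2 y2 z2 where
    "cst a1 * affine_poly x1 y1 z1 + cst b1 * affine_poly x2 y2 z2 + cst e1 = mon 0 1"
    "cst a2 * affine_poly x1 y1 z1 + cst b2 * affine_poly x2 y2 z2 + cst e2 = mon 1 0"
    "cst x1 * affine_poly a1 b1 e1 + cst y1 * affine_poly a2 b2 e2 + cst z1 = mon 0 1"
    "cst x2 * affine_poly a1 b1 e1 + cst y2 * affine_poly a2 b2 e2 + cst z2 = mon 1 0"
proof -
  define \<Delta> where "\<Delta> = a1 * b2 - a2 * b1"
  have \<Delta>: "\<Delta> \<noteq> 0" using assms by (simp add: \<Delta>_def)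
  have unit: "affine_poly 1 0 0 = mon 0 1" "affine_poly 0 1 0 = mon 1 0"
    by (simp_all add: affine_poly_def)
  show ?thesis
    by (rule that[of "b2 / \<Delta>" "- b1 / \<Delta>" "(b1 * e2 - b2 * e1) / \<Delta>"
          "- a2 / \<Delta>" "a1 / \<Delta>" "(a2 * e1 - a1 * e2) / \<Delta>"];
        unfold affine_poly_combination unit[symmetric]; rule arg_cong3[where f = affine_poly];
        use \<Delta> in \<open>simp add: field_simps\<close>; simp add: \<Delta>_def algebra_simps)
qed

text \<open>Coordinates for the model curve \<open>x y = c\<close>: there \<open>y^i x^j\<close>
  becomes \<open>c ^ min i j\<close> times a pure power of \<open>x\<close> or of \<open>y\<close>,
  indexed by \<open>j - i\<close>.\<close>

definition laurent_coeff :: "real \<Rightarrow> int \<Rightarrow> bipoly \<Rightarrow> real" where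
  "laurent_coeff c k = riesz (\<lambda>i j. if int j - int i = k then c ^ min i j else 0)"

lemma linear_laurent_coeff: "linear_functional (laurent_coeff c k)"
  unfolding laurent_coeff_def by (rule linear_functional_riesz)

lemma laurent_coeff_mon: "laurent_coeff c k (mon i j) = (if int j - int i = k then c ^ min i j else 0)"
  by (simp add: laurent_coeff_def)

lemma linear_functional_cmult: "linear_functional L \<Longrightarrow> linear_functional (\<lambda>p. a * L p)"
  by (simp add: linear_functional_def algebra_simps)

lemma linear_functional_ext:
  assumes "linear_functional L" "linear_functional K" "\<And>i j. L (mon i j) = K (mon i j)"
  shows "L p = K p"
proof -
  obtain n where "p \<in> polys_upto n" using exists_polys_upto by blast
  from linear_functional_eqI[OF assms(1,2) this] show ?thesis using assms(3) by simp
qed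

lemma laurent_coeff_x:
  "laurent_coeff c (k + 1) (mon 0 1 * p) = (if k \<ge> 0 then 1 else c) * laurent_coeff c k p"
proof (rule linear_functional_ext)
  show "linear_functional (\<lambda>p. laurent_coeff c (k + 1) (mon 0 1 * p))"
    by (rule linear_functional_mult[OF linear_laurent_coeff])
  show "linear_functional (\<lambda>p. (if k \<ge> 0 then 1 else c) * laurent_coeff c k p)"
    by (rule linear_functional_cmult[OF linear_laurent_coeff])
  fix i j
  have "min i (Suc j) = i \<and> min i j = i" if "j \<ge> i" for i j :: nat using that by simp
  moreover have "min i (Suc j) = Suc j \<and> min i j = j" if "j < i" for i j :: nat using that by simp
  ultimately show "laurent_coeff c (k + 1) (mon 0 1 * mon i j)
      = (if k \<ge> 0 then 1 else c) * laurent_coeff c k (mon i j)"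
    by (cases "i \<le> j") (auto simp: mon_mult laurent_coeff_mon)
qed

lemma laurent_coeff_y:
  "laurent_coeff c (k - 1) (mon 1 0 * p) = (if k \<le> 0 then 1 else c) * laurent_coeff c k p"
proof (rule linear_functional_ext)
  show "linear_functional (\<lambda>p. laurent_coeff c (k - 1) (mon 1 0 * p))"
    by (rule linear_functional_mult[OF linear_laurent_coeff])
  show "linear_functional (\<lambda>p. (if k \<le> 0 then 1 else c) * laurent_coeff c k p)"
    by (rule linear_functional_cmult[OF linear_laurent_coeff])
  fix i j
  have "min (Suc i) j = j \<and> min i j = j" if "j \<le> i" for i j :: nat using that by simp
  moreover have "min (Suc i) j = Suc i \<and> min i j = i" if "i < j" for i j :: nat using that by simp
  ultimately show "laurent_coeff c (k - 1) (mon 1 0 * mon i j)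
      = (if k \<le> 0 then 1 else c) * laurent_coeff c k (mon i j)"
    by (cases "j \<le> i") (auto simp: mon_mult laurent_coeff_mon)
qed

lemma laurent_coeff_degree:
  assumes "p \<in> polys_upto m" "\<bar>k\<bar> > int m"
  shows "laurent_coeff c k p = 0"
proof (rule linear_functional_eqI[OF linear_laurent_coeff _ assms(1)])
  show "linear_functional (\<lambda>_. 0)" by (simp add: linear_functional_def)
  show "laurent_coeff c k (mon i j) = 0" if "i + j \<le> m" for i j
    using that assms(2) by (auto simp: laurent_coeff_mon)
qed

text \<open>For \<open>m < 2\<close> truncated subtraction would admit constants; there only 0 is
  meant.\<close>

definition lower_by_two :: "nat \<Rightarrow> bipoly set" where
  "lower_by_two m = {r. r = 0 \<or> 2 \<le> m \<and> r \<in> polys_upto (m - 2)}"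

lemma lower_by_two_add: "p \<in> lower_by_two m \<Longrightarrow> q \<in> lower_by_two m \<Longrightarrow> p + q \<in> lower_by_two m"
  by (auto simp: lower_by_two_def intro: polys_upto_add)

lemma lower_by_two_scale: "p \<in> lower_by_two m \<Longrightarrow> cst a * p \<in> lower_by_two m"
  by (auto simp: lower_by_two_def intro: polys_upto_scale)

lemma lower_by_two_Suc: "p \<in> lower_by_two m \<Longrightarrow> p \<in> lower_by_two (Suc m)"
  by (auto simp: lower_by_two_def intro: polys_upto_mono)

lemma lower_by_two_mult: "l \<in> polys_upto 1 \<Longrightarrow> p \<in> lower_by_two m \<Longrightarrow> l * p \<in> lower_by_two (Suc m)"
  by (auto simp: lower_by_two_def intro!: polys_upto_mult'[of l 1 p "m - 2"])

text \<open>Normal forms together with a multiple of \<open>Q\<close> whose cofactor has controlled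
  degree; the induction carries this bound through each multiplication by \<open>u\<close> or
  \<open>v\<close>.\<close>

inductive_set normal_forms :: "bipoly \<Rightarrow> bipoly \<Rightarrow> bipoly \<Rightarrow> nat \<Rightarrow> bipoly set"
  for u v Q :: bipoly and m :: nat where
  zero: "0 \<in> normal_forms u v Q m"
| u_power: "k \<le> m \<Longrightarrow> cst a * u ^ k \<in> normal_forms u v Q m"
| v_power: "k \<le> m \<Longrightarrow> cst a * v ^ k \<in> normal_forms u v Q m"
| multiple: "r \<in> lower_by_two m \<Longrightarrow> Q * r \<in> normal_forms u v Q m"
| add: "p \<in> normal_forms u v Q m \<Longrightarrow> q \<in> normal_forms u v Q m \<Longrightarrow> p + q \<in> normal_forms u v Q m"

lemma normal_forms_swap: "p \<in> normal_forms u v Q m \<Longrightarrow> p \<in> normal_forms v u Q m"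
  by (induction rule: normal_forms.induct) (auto intro: normal_forms.intros)

lemma normal_forms_Suc: "p \<in> normal_forms u v Q m \<Longrightarrow> p \<in> normal_forms u v Q (Suc m)"
  by (induction rule: normal_forms.induct) (auto intro: normal_forms.intros lower_by_two_Suc)

lemma normal_forms_scale: "p \<in> normal_forms u v Q m \<Longrightarrow> cst a * p \<in> normal_forms u v Q m"
proof (induction rule: normal_forms.induct)
  case (u_power k b)
  then show ?case using normal_forms.u_power[of k m "a * b"] by (simp add: mult.assoc)
next
  case (v_power k b)
  then show ?case using normal_forms.v_power[of k m "a * b"] by (simp add: mult.assoc)
next
  case (multiple r)
  then show ?case
    using normal_forms.multiple[OF lower_by_two_scale[OF multiple, of a]] by (simp add: mult.left_commute)
qed (simp_all add: normal_forms.zero normal_forms.add distrib_left)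

lemma normal_forms_mult_u:
  assumes u: "u \<in> polys_upto 1" and v: "v \<in> polys_upto 1" and rel: "u * v = cst c + Q * cst \<kappa>"
  shows "p \<in> normal_forms u v Q m \<Longrightarrow> u * p \<in> normal_forms u v Q (Suc m)"
proof (induction rule: normal_forms.induct)
  case zero
  then show ?case by (simp add: normal_forms.zero)
next
  case (u_power k a)
  then show ?case using normal_forms.u_power[of "Suc k" "Suc m" a] by (simp add: mult.left_commute)
next
  case (v_power k a)
  show ?case
  proof (cases k)
    case 0
    then show ?thesis using normal_forms.u_power[of 1 "Suc m" a] by (simp add: mult.commute)
  next
    case (Suc k')
    \<comment> \<open>One application of \<open>rel\<close> lowers the power of \<open>v\<close> and
      leaves a multiple of \<open>Q\<close> with cofactor of degree
      \<open>k' \<le> Suc m - 2\<close>.\<close>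
    have "u * (cst a * v ^ k) = cst a * (u * v * v ^ k')"
      by (simp add: Suc mult_ac)
    also have "\<dots> = cst (a * c) * v ^ k' + Q * (cst (a * \<kappa>) * v ^ k')"
      by (simp add: rel algebra_simps)
    also have "\<dots> \<in> normal_forms u v Q (Suc m)"
    proof (rule normal_forms.add)
      show "cst (a * c) * v ^ k' \<in> normal_forms u v Q (Suc m)"
        using v_power Suc by (intro normal_forms.v_power) simp
      have "v ^ k' \<in> polys_upto (Suc m - 2)"
        using polys_upto_mono[OF polys_upto_power[OF v], of k' "Suc m - 2"] v_power Suc by simp
      moreover have "2 \<le> Suc m" using v_power Suc by simp
      ultimately show "Q * (cst (a * \<kappa>) * v ^ k') \<in> normal_forms u v Q (Suc m)"
        by (intro normal_forms.multiple lower_by_two_scale) (simp add: lower_by_two_def)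
    qed
    finally show ?thesis .
  qed
next
  case (multiple r)
  then show ?case
    using normal_forms.multiple[OF lower_by_two_mult[OF u multiple]] by (simp add: mult.left_commute)
next
  case (add p q)
  then show ?case by (simp add: distrib_left normal_forms.add)
qed

lemma polys_upto_normal_forms:
  assumes u: "u \<in> polys_upto 1" and v: "v \<in> polys_upto 1" and rel: "u * v = cst c + Q * cst \<kappa>"
    and x: "mon 0 1 = cst a1 * u + cst b1 * v + cst e1" and y: "mon 1 0 = cst a2 * u + cst b2 * v + cst e2"
    and p: "p \<in> polys_upto m"
  shows "p \<in> normal_forms u v Q m"
proof -
  have step: "(cst a * u + cst b * v + cst e) * q \<in> normal_forms u v Q (Suc m)"
    if q: "q \<in> normal_forms u v Q m" for a b e q m
  proof -
    have "u * q \<in> normal_forms u v Q (Suc m)"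
      by (rule normal_forms_mult_u[OF u v rel q])
    moreover have "v * u = cst c + Q * cst \<kappa>" using rel by (simp add: mult.commute)
    then have "v * q \<in> normal_forms u v Q (Suc m)"
      by (rule normal_forms_swap[OF normal_forms_mult_u[OF v u _ normal_forms_swap[OF q]]])
    ultimately have "cst a * (u * q) + cst b * (v * q) + cst e * q \<in> normal_forms u v Q (Suc m)"
      using normal_forms_Suc[OF q] by (intro normal_forms.add normal_forms_scale)
    then show ?thesis by (simp add: distrib_right mult.assoc)
  qed
  have mon: "mon i j \<in> normal_forms u v Q m" if "i + j \<le> m" for i j
    using that
  proof (induction m arbitrary: i j)
    case 0
    then show ?case using normal_forms.u_power[of 0 0 1] by simp
  next
    case (Suc m)
    show ?case
    proof (cases "i + j = 0")
      case True
      then show ?thesis using normal_forms.u_power[of 0 "Suc m" 1] by simp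
    next
      case False
      then consider j' where "j = Suc j'" | i' where "i = Suc i'"
        by (cases i; cases j) auto
      then show ?thesis
      proof cases
        case 1
        then have "mon i j' \<in> normal_forms u v Q m" using Suc.IH Suc.prems by simp
        from step[OF this, of a1 b1 e1] show ?thesis
          using mon_mult[of 0 1 i j'] 1 by (simp flip: x)
      next
        case 2
        then have "mon i' j \<in> normal_forms u v Q m" using Suc.IH Suc.prems by simp
        from step[OF this, of a2 b2 e2] show ?thesis
          using mon_mult[of 1 0 i' j] 2 by (simp flip: y)
      qed
    qed
  qed
  from p show ?thesis
    by (induction rule: polys_upto_induct)
      (auto intro: normal_forms.zero normal_forms.add normal_forms_scale mon)
qed

theorem hyperbola_coordinates_exist:
  assumes "hyperbola_poly Q"
  obtains u v c \<rho> where "hyperbola_coordinates u v c Q \<rho>" "Q \<in> polys_upto 2"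
    "\<And>m p. 2 \<le> m \<Longrightarrow> p \<in> polys_upto m \<Longrightarrow> \<exists>r\<in>polys_upto (m - 2).
      p - cst (\<rho> 0 p) - (\<Sum>k=1..m. cst (\<rho> (int k) p) * u ^ k)
        - (\<Sum>k=1..m. cst (\<rho> (- int k) p) * v ^ k) = Q * r"
proof -
  obtain A B C D E F where Q: "Q = [:[:F, D, A:], [:E, B:], [:C:]:]" and disc: "B\<^sup>2 - 4 * A * C > 0"
    using assms by (auto simp: hyperbola_poly_def)
  obtain a1 b1 e1 a2 b2 e2 c \<kappa> where det: "a1 * b2 - a2 * b1 \<noteq> 0" and \<kappa>: "\<kappa> \<noteq> 0"
    and coeffs: "\<kappa> * A = a1 * a2" "\<kappa> * B = a1 * b2 + a2 * b1" "\<kappa> * C = b1 * b2"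
      "\<kappa> * D = a1 * e2 + a2 * e1" "\<kappa> * E = b1 * e2 + b2 * e1" "\<kappa> * F = e1 * e2 - c"
    by (rule quadratic_form_factorization[OF disc])
  define u where "u = affine_poly a1 b1 e1"
  define v where "v = affine_poly a2 b2 e2"
  have u: "u \<in> polys_upto 1" and v: "v \<in> polys_upto 1"
    by (simp_all only: u_def v_def affine_poly_polys_upto)
  have uv: "u * v = cst c + Q * cst \<kappa>"
  proof -
    have "Q * cst \<kappa> = cst (\<kappa> * A) * mon 0 2 + cst (\<kappa> * B) * mon 1 1 + cst (\<kappa> * C) * mon 2 0
        + cst (\<kappa> * D) * mon 0 1 + cst (\<kappa> * E) * mon 1 0 + cst (\<kappa> * F)"
      unfolding Q quadratic_bipoly by (simp add: algebra_simps)
    then show ?thesis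
      unfolding u_def v_def affine_poly_mult coeffs by (simp only: cst_simps)
  qed
  have QP: "Q \<in> polys_upto 2"
    unfolding Q quadratic_bipoly
    by (intro polys_upto_add polys_upto_scale cst_polys_upto mon_polys_upto) auto
  obtain x1 y1 z1 x2 y2 z2 where inv:
    "cst a1 * affine_poly x1 y1 z1 + cst b1 * affine_poly x2 y2 z2 + cst e1 = mon 0 1"
    "cst a2 * affine_poly x1 y1 z1 + cst b2 * affine_poly x2 y2 z2 + cst e2 = mon 1 0"
    "cst x1 * u + cst y1 * v + cst z1 = mon 0 1" "cst x2 * u + cst y2 * v + cst z2 = mon 1 0"
    unfolding u_def v_def by (rule affine_poly_inverse[OF det])
  define U where "U = affine_poly x1 y1 z1"
  define V where "V = affine_poly x2 y2 z2"
  have UV: "U \<in> polys_upto 1" "V \<in> polys_upto 1"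
    "cst a1 * U + cst b1 * V + cst e1 = mon 0 1" "cst a2 * U + cst b2 * V + cst e2 = mon 1 0"
    using inv(1,2) by (simp_all only: U_def V_def affine_poly_polys_upto)
  \<comment> \<open>Substitute \<open>x = U\<close> and \<open>y = V\<close>, which carries
    \<open>u\<close>, \<open>v\<close> to \<open>x\<close>, \<open>y\<close>, then read off
    coordinates on the model curve.\<close>
  define \<rho> where "\<rho> = (\<lambda>k. riesz (\<lambda>i j. laurent_coeff c k (V ^ i * U ^ j)))"
  have \<rho>_lin: "linear_functional (\<rho> k)" for k
    unfolding \<rho>_def by (rule linear_functional_riesz)
  note \<rho>_simps = linear_functional_simps[OF \<rho>_lin]
  have \<rho>_mon: "\<rho> k (mon i j) = laurent_coeff c k (V ^ i * U ^ j)" for k i j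
    by (simp add: \<rho>_def)
  have \<rho>_affine: "\<rho> k (affine_poly a b e * mon i j) = laurent_coeff c k ((cst a * U + cst b * V + cst e) * (V ^ i * U ^ j))"
    for k a b e i j
    unfolding affine_poly_mult_mon \<rho>_simps \<rho>_mon distrib_right linear_functional_simps[OF linear_laurent_coeff] mult.assoc
    by (simp add: mult_ac)
  have \<rho>_u: "\<rho> (k + 1) (u * p) = (if k \<ge> 0 then 1 else c) * \<rho> k p" for k p
  proof (rule linear_functional_ext[OF linear_functional_mult[OF \<rho>_lin] linear_functional_cmult[OF \<rho>_lin]])
    show "\<rho> (k + 1) (u * mon i j) = (if k \<ge> 0 then 1 else c) * \<rho> k (mon i j)" for i j
      unfolding u_def \<rho>_affine UV(3) laurent_coeff_x \<rho>_mon ..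
  qed
  have \<rho>_v: "\<rho> (k - 1) (v * p) = (if k \<le> 0 then 1 else c) * \<rho> k p" for k p
  proof (rule linear_functional_ext[OF linear_functional_mult[OF \<rho>_lin] linear_functional_cmult[OF \<rho>_lin]])
    show "\<rho> (k - 1) (v * mon i j) = (if k \<le> 0 then 1 else c) * \<rho> k (mon i j)" for i j
      unfolding v_def \<rho>_affine UV(4) laurent_coeff_y \<rho>_mon ..
  qed
  have \<rho>_1: "\<rho> k 1 = (if k = 0 then 1 else 0)" for k
    using \<rho>_mon[of k 0 0] laurent_coeff_mon[of c k 0 0] by simp
  \<comment> \<open>Exactly one of the two multiplications crosses towards index 0 and contributes
    \<open>c\<close>, for every \<open>k\<close>. As \<open>Q\<close> is a multiple of
    \<open>u v - c\<close>, all \<open>\<rho> k\<close> vanish on its ideal.\<close>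
  have \<rho>_uv: "\<rho> k (u * v * p) = c * \<rho> k p" for k p
    using \<rho>_u[of "k - 1" "v * p"] \<rho>_v[of k p] by (auto simp: mult.assoc split: if_splits)
  have \<rho>_Q: "\<rho> k (Q * p) = 0" for k p
  proof -
    have "\<rho> k (cst c * p + cst \<kappa> * (Q * p)) = c * \<rho> k p"
      using \<rho>_uv[of k p] unfolding uv by (simp add: algebra_simps)
    then show ?thesis using \<kappa> unfolding \<rho>_simps by simp
  qed
  have \<rho>_degree: "\<rho> k p = 0" if "p \<in> polys_upto m" "\<bar>k\<bar> > int m" for k p m
  proof (rule linear_functional_eqI[OF \<rho>_lin _ that(1)])
    show "linear_functional (\<lambda>_. 0)" by (simp add: linear_functional_def)
    fix i j assume ij: "i + j \<le> m"
    have "V ^ i * U ^ j \<in> polys_upto m"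
      by (rule polys_upto_mult'[OF polys_upto_power[OF UV(2)] polys_upto_power[OF UV(1)] ij])
    then show "\<rho> k (mon i j) = 0"
      unfolding \<rho>_mon by (rule laurent_coeff_degree[OF _ that(2)])
  qed
  have \<rho>_u_power: "\<rho> k (u ^ j) = (if k = int j then 1 else 0)" for k j
  proof (induction j arbitrary: k)
    case (Suc j)
    then show ?case using \<rho>_u[of "k - 1" "u ^ j"] by auto
  qed (simp add: \<rho>_1)
  have \<rho>_v_power: "\<rho> k (v ^ j) = (if k = - int j then 1 else 0)" for k j
  proof (induction j arbitrary: k)
    case (Suc j)
    then show ?case using \<rho>_v[of "k + 1" "v ^ j"] by auto
  qed (simp add: \<rho>_1)
  \<comment> \<open>The normal form map: it fixes powers of \<open>u\<close> and \<open>v\<close>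
    and kills multiples of \<open>Q\<close>, so \<open>p - N m p\<close> is the multiple of
    \<open>Q\<close> found in \<open>normal_forms\<close>.\<close>
  define N where "N = (\<lambda>m p. cst (\<rho> 0 p) + (\<Sum>k=1..m. cst (\<rho> (int k) p) * u ^ k)
    + (\<Sum>k=1..m. cst (\<rho> (- int k) p) * v ^ k))"
  have N_add: "N m (p + q) = N m p + N m q" for m p q
    by (simp add: N_def \<rho>_simps distrib_right sum.distrib)
  have N_scale: "N m (cst a * p) = cst a * N m p" for m a p
    by (simp add: N_def \<rho>_simps distrib_left sum_distrib_left mult.assoc)
  have pick: "(\<Sum>k=1..m. cst (if k = j then 1 else 0) * w ^ k) = (if j = 0 then 0 else w ^ j)"
    if "j \<le> m" for m j and w :: bipoly
  proof -
    have "(\<Sum>k=1..m. cst (if k = j then 1 else 0) * w ^ k) = (\<Sum>k=1..m. if k = j then w ^ j else 0)"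
      by (intro sum.cong) auto
    then show ?thesis using that by auto
  qed
  have N_u: "N m (u ^ j) = u ^ j" if "j \<le> m" for m j
  proof -
    have "(\<Sum>k=1..m. cst (\<rho> (- int k) (u ^ j)) * v ^ k) = 0"
      by (intro sum.neutral) (auto simp: \<rho>_u_power)
    then show ?thesis using pick[OF that, of u] by (auto simp: N_def \<rho>_u_power)
  qed
  have N_v: "N m (v ^ j) = v ^ j" if "j \<le> m" for m j
  proof -
    have "(\<Sum>k=1..m. cst (\<rho> (int k) (v ^ j)) * u ^ k) = 0"
      by (intro sum.neutral) (auto simp: \<rho>_v_power)
    then show ?thesis using pick[OF that, of v] by (auto simp: N_def \<rho>_v_power)
  qed
  have N_Q: "N m (Q * r) = 0" for m r
    by (simp add: N_def \<rho>_Q)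
  have normal: "\<exists>r\<in>lower_by_two m. p - N m p = Q * r" if "p \<in> normal_forms u v Q m" for p m
    using that
  proof (induction rule: normal_forms.induct)
    case zero
    then show ?case using N_Q[of m 0] by (intro bexI[of _ 0]) (auto simp: lower_by_two_def)
  next
    case (u_power k a)
    then show ?case by (intro bexI[of _ 0]) (auto simp: lower_by_two_def N_scale N_u)
  next
    case (v_power k a)
    then show ?case by (intro bexI[of _ 0]) (auto simp: lower_by_two_def N_scale N_v)
  next
    case (multiple r)
    then show ?case by (intro bexI[of _ r]) (auto simp: N_Q)
  next
    case (add p q)
    then obtain r s where "r \<in> lower_by_two m" "p - N m p = Q * r" "s \<in> lower_by_two m" "q - N m q = Q * s"
      by blast
    then show ?case
      by (intro bexI[of _ "r + s"]) (auto simp: N_add distrib_left lower_by_two_add add_diff_add)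
  qed
  have decomposition: "\<exists>r\<in>lower_by_two m. p - N m p = Q * r" if "p \<in> polys_upto m" for p m
    by (rule normal[OF polys_upto_normal_forms[OF u v uv inv(3,4)[symmetric] that]])
  have coordinates: "hyperbola_coordinates u v c Q \<rho>"
  proof
    show "Q dvd u * v - cst c" by (simp add: uv)
    fix p m assume "p \<in> polys_upto m"
    then obtain r where "p - N m p = Q * r" using decomposition by blast
    then show "Q dvd p - cst (\<rho> 0 p) - (\<Sum>k=1..m. cst (\<rho> (int k) p) * u ^ k)
        - (\<Sum>k=1..m. cst (\<rho> (- int k) p) * v ^ k)"
      by (simp add: N_def diff_diff_eq)
  qed (fact \<rho>_lin u v \<rho>_Q \<rho>_u \<rho>_v \<rho>_1 \<rho>_degree)+
  show ?thesis
  proof (rule that[OF coordinates QP])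
    fix m :: nat and p assume "2 \<le> m" "p \<in> polys_upto m"
    then obtain r where "r \<in> lower_by_two m" "p - N m p = Q * r" using decomposition by blast
    then show "\<exists>r\<in>polys_upto (m - 2). p - cst (\<rho> 0 p) - (\<Sum>k=1..m. cst (\<rho> (int k) p) * u ^ k)
        - (\<Sum>k=1..m. cst (\<rho> (- int k) p) * v ^ k) = Q * r"
      by (intro bexI[of _ r]) (auto simp: N_def diff_diff_eq lower_by_two_def)
  qed
qed

subsection \<open>Representing measures\<close>

lemma continuous_eval_at: "continuous_on UNIV (eval_at p)"
proof -
  obtain n where "p \<in> polys_upto n" using exists_polys_upto by blast
  then show ?thesis
    by (induction rule: polys_upto_induct) (auto intro!: continuous_intros)
qed

lemma monomial_function: "(\<lambda>(x :: real, y :: real). y ^ i * x ^ j) = (\<lambda>z. snd z ^ i * fst z ^ j)"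
  by (simp add: fun_eq_iff)

lemma representing_measure_riesz:
  assumes \<mu>: "representing_measure n \<beta> \<mu>" and p: "p \<in> polys_upto (2 * n)"
  shows "integrable \<mu> (eval_at p)" "riesz \<beta> p = (\<integral>z. eval_at p z \<partial>\<mu>)"
proof -
  note lin = linear_functional_simps[OF linear_functional_riesz]
  have moment: "integrable \<mu> (\<lambda>z. snd z ^ i * fst z ^ j)" "\<beta> i j = (\<integral>z. snd z ^ i * fst z ^ j \<partial>\<mu>)"
    if "i + j \<le> 2 * n" for i j
    using \<mu> that unfolding representing_measure_def convergent_moments_def monomial_function by auto
  have "integrable \<mu> (eval_at p) \<and> riesz \<beta> p = (\<integral>z. eval_at p z \<partial>\<mu>)"
    using p
  proof (induction rule: polys_upto_induct)
    case (mon a i j)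
    then show ?case using moment[of i j] by (simp add: lin)
  qed (auto simp: lin)
  then show "integrable \<mu> (eval_at p)" "riesz \<beta> p = (\<integral>z. eval_at p z \<partial>\<mu>)" by auto
qed

lemma representing_measure_null_AE:
  assumes \<mu>: "representing_measure n \<beta> \<mu>" and p: "p \<in> null_polys n (riesz \<beta>)"
  shows "AE z in \<mu>. eval_at p z = 0"
proof -
  note pP = null_polys_memD[OF p]
  have pp: "p * p \<in> polys_upto (2 * n)" using polys_upto_mult'[OF pP pP] by simp
  have "(\<integral>z. eval_at (p * p) z \<partial>\<mu>) = 0"
    using representing_measure_riesz(2)[OF \<mu> pp] null_polysD[OF p pP] by simp
  then have "AE z in \<mu>. eval_at (p * p) z = 0"
    using integral_nonneg_eq_0_iff_AE[OF representing_measure_riesz(1)[OF \<mu> pp]] by simp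
  then show ?thesis by simp
qed

lemma supp_subset_if_AE:
  fixes \<mu> :: "(real \<times> real) measure"
  assumes sets: "sets \<mu> = sets borel" and ae: "AE z in \<mu>. eval_at p z = 0"
  shows "supp \<mu> \<subseteq> {z. eval_at p z = 0}"
proof
  fix z assume z: "z \<in> supp \<mu>"
  let ?U = "{z. eval_at p z \<noteq> 0}"
  have U: "open ?U"
  proof -
    have "open (eval_at p -` (- {0}))"
      by (rule open_vimage[OF _ continuous_eval_at]) auto
    then show ?thesis by (simp add: vimage_def)
  qed
  have "?U \<in> sets \<mu>" using sets U by simp
  then have "emeasure \<mu> ?U = 0"
    using ae AE_iff_measurable[of ?U \<mu> "\<lambda>z. eval_at p z = 0"] sets_eq_imp_space_eq[OF sets] by simp
  then show "z \<in> {z. eval_at p z = 0}"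
    using z U unfolding supp_def by fastforce
qed

text \<open>The complement of the support is a union of open null sets; by Lindelof countably many
  of them suffice.\<close>

lemma AE_in_supp:
  fixes \<mu> :: "'a::second_countable_topology measure"
  assumes sets: "sets \<mu> = sets borel"
  shows "AE z in \<mu>. z \<in> supp \<mu>"
proof -
  let ?F = "{U. open U \<and> emeasure \<mu> U = 0}"
  have eq: "- supp \<mu> = \<Union>?F"
    by (auto simp: supp_def zero_less_iff_neq_zero)
  obtain F' where F': "F' \<subseteq> ?F" "countable F'" "\<Union>F' = \<Union>?F"
    using Lindelof[of ?F] by auto
  have "\<Union>F' \<in> null_sets \<mu>"
  proof (intro null_sets_UN'[where N = "\<lambda>U. U", simplified] F'(2))
    fix U assume "U \<in> F'"
    then show "U \<in> null_sets \<mu>"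
      using F'(1) sets by (auto intro!: null_setsI)
  qed
  then show ?thesis
    by (rule AE_I') (use eq F'(3) in auto)
qed

lemma supp_subset_variety:
  assumes "representing_measure n \<beta> \<mu>"
  shows "supp \<mu> \<subseteq> variety n \<beta>"
proof clarify
  fix x y assume "(x, y) \<in> supp \<mu>"
  then show "(x, y) \<in> variety n \<beta>"
    unfolding variety_iff
    using supp_subset_if_AE[OF _ representing_measure_null_AE[OF assms]] assms
    by (force simp: representing_measure_def)
qed

text \<open>The measure lives on its support, which lies in the variety, so evaluations at the
  points of the variety separate polynomials modulo the radical.\<close>

lemma rank_le_card_variety:
  assumes \<mu>: "representing_measure n \<beta> \<mu>" and psd: "psd n (riesz \<beta>)"
  shows "enat (mrank n \<beta>) \<le> ecard (variety n \<beta>)"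
proof (cases "finite (variety n \<beta>)")
  case True
  let ?L = "riesz \<beta>"
  note lin = linear_functional_riesz[of \<beta>]
  obtain r q where onb: "orthonormal_basis n ?L r q"
    using orthonormal_basis_exists[OF lin psd] by blast
  then have on: "orthonormal n ?L r q" by (simp add: orthonormal_basis_def)
  have "r \<le> card (variety n \<beta>)"
  proof (rule orthonormal_le_card[OF lin on True linear_functional_eval2])
    fix h p assume hP: "h \<in> polys_upto n" and hV: "\<And>z. z \<in> variety n \<beta> \<Longrightarrow> eval_at h z = 0"
      and p: "p \<in> polys_upto n"
    have "sets \<mu> = sets borel"
      using \<mu> by (simp add: representing_measure_def)
    from AE_in_supp[OF this] have "AE z in \<mu>. eval_at (h * p) z = 0"
      by eventually_elim (simp add: hV[OF subsetD[OF supp_subset_variety[OF \<mu>]]])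
    then have "(\<integral>z. eval_at (h * p) z \<partial>\<mu>) = 0"
      by (rule integral_eq_zero_AE)
    then show "riesz \<beta> (h * p) = 0"
      using polys_upto_mult'[OF hP p] representing_measure_riesz(2)[OF \<mu>, of "h * p"] by simp
  qed
  then show ?thesis
    using mrank_riesz[OF onb] True by (simp add: ecard_def)
qed (simp add: ecard_def)

lemma atomic_measure_exists:
  assumes S: "finite S" and w: "\<forall>z\<in>S. w z > 0"
  obtains \<mu> where "supp \<mu> = S" "\<And>m. representing_measure m (moments (atomic S w)) \<mu>"
proof -
  define N where "N = point_measure S (\<lambda>z. ennreal (w z))"
  \<comment> \<open>The point measure lives on the power set of \<open>S\<close>; its image has the
    Borel sets of the plane, as a representing measure must.\<close>
  define \<mu> where "\<mu> = distr N borel (\<lambda>z. z)"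
  have meas: "(\<lambda>z. z) \<in> measurable N borel"
    by (simp add: N_def)
  have emeasure: "emeasure \<mu> U = (\<Sum>z\<in>U \<inter> S. ennreal (w z))" if "U \<in> sets borel" for U
  proof -
    have "emeasure \<mu> U = emeasure N ((\<lambda>z. z) -` U \<inter> space N)"
      unfolding \<mu>_def by (rule emeasure_distr[OF meas that])
    also have "(\<lambda>z. z) -` U \<inter> space N = U \<inter> S"
      by (auto simp: N_def space_point_measure)
    finally show ?thesis
      using S by (simp add: N_def emeasure_point_measure_finite)
  qed
  have supp: "supp \<mu> = S"
  proof (intro equalityI subsetI)
    fix z assume z: "z \<in> supp \<mu>"
    show "z \<in> S"
    proof (rule ccontr)
      assume "z \<notin> S"
      moreover have "open (- S)" by (rule open_Compl[OF finite_imp_closed[OF S]])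
      ultimately have "emeasure \<mu> (- S) > 0"
        using z by (simp add: supp_def)
      then show False using emeasure[of "- S"] \<open>open (- S)\<close> by simp
    qed
  next
    fix z assume z: "z \<in> S"
    have "emeasure \<mu> U > 0" if U: "open U" "z \<in> U" for U
    proof -
      have "0 < ennreal (w z)" using w z by simp
      also have "\<dots> \<le> (\<Sum>z\<in>U \<inter> S. ennreal (w z))"
        using S z U by (intro member_le_sum) auto
      finally show ?thesis using emeasure[of U] U by simp
    qed
    then show "z \<in> supp \<mu>" by (simp add: supp_def)
  qed
  have int: "integrable \<mu> (eval_at p)" "(\<integral>z. eval_at p z \<partial>\<mu>) = atomic S w p" for p
  proof -
    have borel: "eval_at p \<in> borel_measurable borel"
      by (rule borel_measurable_continuous_onI[OF continuous_eval_at])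
    have "integrable N (eval_at p)"
      unfolding N_def by (rule integrable_point_measure_finite[OF S])
    then show "integrable \<mu> (eval_at p)"
      unfolding \<mu>_def by (subst integrable_distr_eq[OF meas borel]) simp
    have "(\<integral>z. eval_at p z \<partial>\<mu>) = (\<integral>z. eval_at p z \<partial>N)"
      unfolding \<mu>_def by (rule integral_distr[OF meas borel])
    also have "\<dots> = (\<Sum>z\<in>S. w z *\<^sub>R eval_at p z)"
      unfolding N_def using w by (intro lebesgue_integral_point_measure_finite[OF S]) (auto intro: less_imp_le)
    finally show "(\<integral>z. eval_at p z \<partial>\<mu>) = atomic S w p" by (simp add: atomic_def)
  qed
  have "representing_measure m (moments (atomic S w)) \<mu>" for m
    using int[of "mon _ _"] unfolding representing_measure_def convergent_moments_def monomial_function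
    by (simp add: \<mu>_def moments_def)
  with supp show ?thesis by (rule that)
qed

lemma representing_measure_cong:
  assumes "\<And>i j. i + j \<le> 2 * n \<Longrightarrow> \<beta> i j = \<beta>' i j"
  shows "representing_measure n \<beta> \<mu> \<longleftrightarrow> representing_measure n \<beta>' \<mu>"
  using assms by (auto simp: representing_measure_def)

subsection \<open>Atomic functionals\<close>

context
  fixes S :: "(real \<times> real) set" and w :: "real \<times> real \<Rightarrow> real"
  assumes S: "finite S" and w: "\<forall>z\<in>S. w z > 0"
begin

lemma weight_nonneg: "z \<in> S \<Longrightarrow> w z \<ge> 0"
  using w by (simp add: less_imp_le)

lemma psd_atomic: "psd n (atomic S w)"
  by (auto simp: psd_def atomic_def weight_nonneg intro!: sum_nonneg)

lemma null_polys_atomic: "p \<in> null_polys n (atomic S w) \<longleftrightarrow> p \<in> polys_upto n \<and> (\<forall>z\<in>S. eval_at p z = 0)"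
proof
  assume p: "p \<in> null_polys n (atomic S w)"
  note pP = null_polys_memD[OF p]
  have "(\<Sum>z\<in>S. w z * (eval_at p z * eval_at p z)) = 0"
    using null_polysD[OF p pP] by (simp add: atomic_def)
  then have "\<forall>z\<in>S. w z * (eval_at p z * eval_at p z) = 0"
    by (subst (asm) sum_nonneg_eq_0_iff[OF S]) (simp_all add: weight_nonneg)
  then show "p \<in> polys_upto n \<and> (\<forall>z\<in>S. eval_at p z = 0)"
    using pP w by fastforce
qed (simp add: null_polys_def atomic_def)

lemma multiplicative_null_atomic: "multiplicative_null n (atomic S w)"
  by (simp add: multiplicative_null_def null_polys_atomic)

lemma mrank_atomic_le_card: "mrank n (moments (atomic S w)) \<le> card S"
proof -
  note lin = linear_functional_atomic[of S w]
  obtain r q where onb: "orthonormal_basis n (atomic S w) r q"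
    using orthonormal_basis_exists[OF lin psd_atomic] by blast
  then have on: "orthonormal n (atomic S w) r q" by (simp add: orthonormal_basis_def)
  have "r \<le> card S"
    by (rule orthonormal_le_card[OF lin on S, where \<phi> = "\<lambda>z p. eval_at p z"])
      (simp_all add: linear_functional_eval2 atomic_def)
  then show ?thesis using mrank_moments[OF lin onb] by simp
qed

lemma mrank_atomic_Suc: "mrank n (moments (atomic S w)) \<le> mrank (Suc n) (moments (atomic S w))"
proof -
  note lin = linear_functional_atomic[of S w]
  obtain r q where onb: "orthonormal_basis n (atomic S w) r q"
    using orthonormal_basis_exists[OF lin psd_atomic] by blast
  then have "orthonormal (Suc n) (atomic S w) r q"
    by (auto simp: orthonormal_basis_def orthonormal_def intro: polys_upto_Suc)
  then obtain r' q' where "orthonormal_basis (Suc n) (atomic S w) r' q'" "r \<le> r'"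
    using orthonormal_extend[OF lin psd_atomic] by blast
  then show ?thesis
    using mrank_moments[OF lin] onb by metis
qed

end

subsection \<open>The truncated hyperbolic moment problem\<close>

text \<open>One witness for the measure statements and the extension statements alike; the bound by
  the rank of order \<open>Suc n\<close> is what yields flatness.\<close>

definition atomic_solution :: "nat \<Rightarrow> (nat \<Rightarrow> nat \<Rightarrow> real) \<Rightarrow> (real \<times> real) set \<Rightarrow> (real \<times> real \<Rightarrow> real) \<Rightarrow> bool" where
  "atomic_solution n \<beta> S w \<longleftrightarrow> finite S \<and> (\<forall>z\<in>S. w z > 0) \<and>
    (\<forall>p\<in>polys_upto (2 * n). riesz \<beta> p = atomic S w p) \<and>
    card S \<le> mrank (Suc n) (moments (atomic S w)) \<and> card S \<le> Suc (mrank n \<beta>) \<and>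
    (mrank n \<beta> \<le> 2 * n \<longrightarrow> card S \<le> mrank n \<beta>)"

lemma atomic_solution_measure:
  assumes "atomic_solution n \<beta> S w"
  obtains \<mu> where "representing_measure n \<beta> \<mu>" "convergent_moments (2 * n + 2) \<mu>"
    "ecard (supp \<mu>) \<le> enat (1 + mrank n \<beta>)" "mrank n \<beta> \<le> 2 * n \<Longrightarrow> ecard (supp \<mu>) = enat (mrank n \<beta>)"
proof -
  have S: "finite S" "\<forall>z\<in>S. w z > 0" and agree: "\<And>p. p \<in> polys_upto (2 * n) \<Longrightarrow> riesz \<beta> p = atomic S w p"
    and card: "card S \<le> Suc (mrank n \<beta>)" "mrank n \<beta> \<le> 2 * n \<Longrightarrow> card S \<le> mrank n \<beta>"
    using assms by (auto simp: atomic_solution_def)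
  obtain \<mu> where supp: "supp \<mu> = S" and rep: "\<And>m. representing_measure m (moments (atomic S w)) \<mu>"
    by (rule atomic_measure_exists[OF S]) blast
  have "\<beta> i j = moments (atomic S w) i j" if "i + j \<le> 2 * n" for i j
    using agree[OF mon_polys_upto[OF that]] by (simp add: moments_def)
  then have "representing_measure n \<beta> \<mu>"
    using rep[of n] representing_measure_cong by blast
  moreover have "convergent_moments (2 * n + 2) \<mu>"
    using rep[of "Suc n"] by (simp add: representing_measure_def)
  moreover have "mrank n \<beta> \<le> card S"
    using mrank_atomic_le_card[OF S, of n] mrank_moments_cong[of n "riesz \<beta>" "atomic S w"] agree
    by (simp add: moments_riesz)
  ultimately show ?thesis
    using that[of \<mu>] card S(1) by (simp add: ecard_def supp order_antisym)
qed

text \<open>Ranks increase with the order and never exceed \<open>card S\<close>; once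
  \<open>card S\<close> is reached, at order \<open>n + 1\<close> or already at \<open>n\<close>,
  they stay constant.\<close>

lemma atomic_solution_extension:
  assumes "atomic_solution n \<beta> S w"
  defines "\<beta>' \<equiv> moments (atomic S w)"
  shows "extends_moments n \<beta> \<beta>'" "positive_semidefinite (moment_matrix m \<beta>')" "recursively_generated m \<beta>'"
    "mrank (n + 1) \<beta>' \<le> 1 + mrank n \<beta>" "flat_extension (n + 1) \<beta>' \<beta>'"
    "mrank n \<beta> \<le> 2 * n \<Longrightarrow> flat_extension n \<beta> \<beta>'"
proof -
  have S: "finite S" "\<forall>z\<in>S. w z > 0" and agree: "\<And>p. p \<in> polys_upto (2 * n) \<Longrightarrow> riesz \<beta> p = atomic S w p"
    and card: "card S \<le> mrank (Suc n) \<beta>'" "card S \<le> Suc (mrank n \<beta>)"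
      "mrank n \<beta> \<le> 2 * n \<Longrightarrow> card S \<le> mrank n \<beta>"
    using assms(1) by (auto simp: atomic_solution_def \<beta>'_def)
  have riesz: "riesz \<beta>' = atomic S w"
    unfolding \<beta>'_def by (rule riesz_moments[OF linear_functional_atomic])
  have le: "mrank k \<beta>' \<le> card S" and Suc: "mrank k \<beta>' \<le> mrank (Suc k) \<beta>'" for k
    unfolding \<beta>'_def by (rule mrank_atomic_le_card[OF S], rule mrank_atomic_Suc[OF S])
  have eq: "mrank n \<beta> = mrank n \<beta>'"
    using mrank_moments_cong[of n "riesz \<beta>" "atomic S w"] agree by (simp add: moments_riesz \<beta>'_def)
  show ext: "extends_moments n \<beta> \<beta>'"
    using agree[OF mon_polys_upto] by (simp add: extends_moments_def \<beta>'_def moments_def)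
  show psd: "positive_semidefinite (moment_matrix m \<beta>')" for m
    unfolding positive_semidefinite_iff riesz by (rule psd_atomic[OF S])
  show "recursively_generated m \<beta>'"
    unfolding recursively_generated_iff riesz by (rule multiplicative_null_atomic[OF S])
  show "mrank (n + 1) \<beta>' \<le> 1 + mrank n \<beta>"
    using le[of "Suc n"] card(2) by simp
  have "mrank (Suc (Suc n)) \<beta>' = mrank (Suc n) \<beta>'"
    using le[of "Suc (Suc n)"] Suc[of "Suc n"] card(1) by simp
  then show "flat_extension (n + 1) \<beta>' \<beta>'"
    using psd by (simp add: flat_extension_def extends_moments_def)
  show "flat_extension n \<beta> \<beta>'" if "mrank n \<beta> \<le> 2 * n"
    using ext psd le[of "Suc n"] Suc[of n] card(3)[OF that] eq by (simp add: flat_extension_def)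
qed

text \<open>\<open>R\<close> is a hub, instantiated with the existence of an atomic solution; the
  substantial inputs are \<open>P4 \<Longrightarrow> R\<close> and
  \<open>P6 \<Longrightarrow> R\<close>.\<close>

lemma all_equivalent_six:
  assumes "P1 \<Longrightarrow> P6" "P2 \<Longrightarrow> P1" "P3 \<Longrightarrow> P1" "P5 \<Longrightarrow> P4" "P4 \<Longrightarrow> R" "P6 \<Longrightarrow> R"
    "R \<Longrightarrow> P1" "R \<Longrightarrow> P2" "R \<Longrightarrow> P3" "R \<Longrightarrow> P5"
  shows "all_equivalent [P1, P2, P3, P4, P5, P6]"
proof -
  have "P1 = R" "P2 = R" "P3 = R" "P4 = R" "P5 = R" "P6 = R"
    using assms by blast+
  then show ?thesis by (simp add: all_equivalent_def)
qed

lemma exists_subset_of_ecard: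
  assumes "enat k \<le> ecard V"
  obtains S where "S \<subseteq> V" "finite S" "card S = k"
proof (cases "finite V")
  case True
  then have "k \<le> card V" using assms by (simp add: ecard_def)
  then show ?thesis using obtain_subset_with_card_n that by metis
next
  case False
  then show ?thesis using infinite_arbitrarily_large[of V k] that by blast
qed

theorem theorem1p5:
  fixes n :: nat and Q :: bipoly and \<beta> :: "nat \<Rightarrow> nat \<Rightarrow> real"
  assumes "n \<ge> 2"
    and "hyperbola_poly Q"
    and "\<beta> 0 0 > 0"
    and "positive_semidefinite (moment_matrix n \<beta>)"
    and "recursively_generated n \<beta>"
    and "poly_column n \<beta> Q = zero_vec (msize n)"
  shows "mrank n \<beta> \<le> 2 * n + 1 \<and>
    (\<forall>\<mu>. representing_measure n \<beta> \<mu> \<longrightarrow> supp \<mu> \<subseteq> zero_set Q) \<and>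
    all_equivalent
     [\<exists>\<mu>. representing_measure n \<beta> \<mu>,
      \<exists>\<mu>. representing_measure n \<beta> \<mu> \<and> convergent_moments (2 * n + 2) \<mu>,
      (\<exists>\<mu>. representing_measure n \<beta> \<mu> \<and> ecard (supp \<mu>) \<le> enat (1 + mrank n \<beta>)) \<and>
        (mrank n \<beta> \<le> 2 * n \<longrightarrow>
          (\<exists>\<mu>. representing_measure n \<beta> \<mu> \<and> ecard (supp \<mu>) = enat (mrank n \<beta>))),
      \<exists>\<beta>'. extends_moments n \<beta> \<beta>' \<and>
        positive_semidefinite (moment_matrix (n + 1) \<beta>') \<and> recursively_generated (n + 1) \<beta>',
      (\<exists>\<beta>'. extends_moments n \<beta> \<beta>' \<and>
        positive_semidefinite (moment_matrix (n + 1) \<beta>') \<and> recursively_generated (n + 1) \<beta>' \<and>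
        mrank (n + 1) \<beta>' \<le> 1 + mrank n \<beta> \<and>
        (\<exists>\<beta>''. flat_extension (n + 1) \<beta>' \<beta>'')) \<and>
        (mrank n \<beta> \<le> 2 * n \<longrightarrow> (\<exists>\<beta>'. flat_extension n \<beta> \<beta>')),
      enat (mrank n \<beta>) \<le> ecard (variety n \<beta>)]"
proof -
  have n: "n \<ge> 1" using assms(1) by simp
  note lin = linear_functional_riesz[of \<beta>]
  have psd: "psd n (riesz \<beta>)" using assms(4) by (simp add: positive_semidefinite_iff)
  have mult: "multiplicative_null n (riesz \<beta>)"
    using assms(5) by (simp add: recursively_generated_iff)
  obtain u v c \<rho> where "hyperbola_coordinates u v c Q \<rho>" and QP: "Q \<in> polys_upto 2"
    and decomp: "\<And>m p. 2 \<le> m \<Longrightarrow> p \<in> polys_upto m \<Longrightarrow> \<exists>r\<in>polys_upto (m - 2).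
      p - cst (\<rho> 0 p) - (\<Sum>k=1..m. cst (\<rho> (int k) p) * u ^ k)
        - (\<Sum>k=1..m. cst (\<rho> (- int k) p) * v ^ k) = Q * r"
    using hyperbola_coordinates_exist[OF assms(2)] by blast
  then interpret hyperbola_coordinates u v c Q \<rho> by blast
  have Qnull: "Q \<in> null_polys n (riesz \<beta>)"
    using polys_upto_mono[OF QP assms(1)] assms(6)
    by (simp add: column_relation_def flip: column_relation_iff)
  \<comment> \<open>Values above degree \<open>2 * m\<close> are replaced so that the functional
    vanishes on the whole ideal of \<open>Q\<close>.\<close>
  have normalize: "\<exists>L'. linear_functional L' \<and> kills L' \<and> (\<forall>p\<in>polys_upto (2 * m). L' p = L p)"
    if m: "m \<ge> 2" and L: "linear_functional L" "Q \<in> null_polys m L" "multiplicative_null m L" for m L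
  proof -
    have "\<exists>r\<in>polys_upto (2 * m - 2). p - cst (\<rho> 0 p) - (\<Sum>k=1..2*m. cst (\<rho> (int k) p) * u ^ k)
        - (\<Sum>k=1..2*m. cst (\<rho> (- int k) p) * v ^ k) = Q * r" if "p \<in> polys_upto (2 * m)" for p
      using decomp[OF _ that] m by simp
    then obtain L' where "linear_functional L'" "kills L'" "\<And>p. p \<in> polys_upto (2 * m) \<Longrightarrow> L' p = L p"
      using kills_normalization[OF L(1) _ multiplicative_null_vanish[OF L(1) QP L(2,3) m]] by blast
    then show ?thesis by blast
  qed
  obtain L where L: "linear_functional L" "kills L" and agree: "\<And>p. p \<in> polys_upto (2 * n) \<Longrightarrow> L p = riesz \<beta> p"
    using normalize[OF assms(1) lin Qnull mult] by blast
  have psdL: "psd n L" and multL: "multiplicative_null n L"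
    and nullL: "null_polys n L = null_polys n (riesz \<beta>)"
    using psd mult psd_cong[of n L] multiplicative_null_cong[of n L] null_polys_cong[of n L] agree by auto
  obtain r q where onb: "orthonormal_basis n L r q"
    using orthonormal_basis_exists[OF L(1) psdL] by blast
  have rank: "mrank n \<beta> = r"
    using mrank_moments[OF L(1) onb] mrank_moments_cong[of n L "riesz \<beta>"] agree by (simp add: moments_riesz)
  define A where "A \<longleftrightarrow> (\<exists>S w. atomic_solution n \<beta> S w)"
  have solution: A if rec: "u_recursive n L" "v_recursive n L"
  proof -
    obtain S w where "finite S" "\<forall>z\<in>S. w z > 0" "\<And>p. p \<in> polys_upto (2 * n) \<Longrightarrow> L p = atomic S w p"
      "card S \<le> mrank (Suc n) (moments (atomic S w))" "card S \<le> Suc r" "r \<le> 2 * n \<Longrightarrow> card S \<le> r"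
      by (rule recursive_atomic[OF L psdL n rec onb]) blast
    then have "atomic_solution n \<beta> S w"
      using agree by (simp add: atomic_solution_def rank)
    then show A by (auto simp: A_def)
  qed
  have "r \<le> 2 * n + 1"
    using rank_le[OF L] onb by (auto simp: orthonormal_basis_def)
  moreover have "supp \<mu> \<subseteq> zero_set Q" if "representing_measure n \<beta> \<mu>" for \<mu>
    using supp_subset_if_AE[OF _ representing_measure_null_AE[OF that Qnull]] that
    by (auto simp: representing_measure_def zero_set_def)
  moreover have A if V: "enat r \<le> ecard (variety n \<beta>)"
  proof -
    obtain S where S: "S \<subseteq> variety n \<beta>" "finite S" "card S = r"
      by (rule exists_subset_of_ecard[OF V]) blast
    have zero: "eval_at g z = 0" if "z \<in> S" "g \<in> null_polys n L" for z g
      using S(1) that nullL variety_iff[of "fst z" "snd z" n \<beta>] by auto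
    have "eval_at Q z = 0" if "z \<in> S" for z
      using zero[OF that] Qnull nullL by simp
    from recursive_if_variety[OF L n onb multL S(2,3) this zero] show A
      by (intro solution)
  qed
  moreover have A if \<beta>': "extends_moments n \<beta> \<beta>'" "positive_semidefinite (moment_matrix (n + 1) \<beta>')"
    "recursively_generated (n + 1) \<beta>'" for \<beta>'
  proof -
    note lin' = linear_functional_riesz[of \<beta>']
    have psd': "psd (Suc n) (riesz \<beta>')" and mult': "multiplicative_null (Suc n) (riesz \<beta>')"
      using \<beta>'(2,3) by (simp_all add: positive_semidefinite_iff recursively_generated_iff)
    have agree': "riesz \<beta>' p = riesz \<beta> p" if "p \<in> polys_upto (2 * n)" for p
      by (rule riesz_cong[OF \<beta>'(1) that])
    \<comment> \<open>By positivity \<open>Q\<close> stays null one order higher, so the extended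
      functional can be normalized as well.\<close>
    have "Q \<in> null_polys n (riesz \<beta>')"
      using Qnull null_polys_cong[of n "riesz \<beta>'" "riesz \<beta>"] agree' by simp
    then have "Q \<in> null_polys (Suc n) (riesz \<beta>')"
      by (rule null_polys_psd_mono[OF lin' psd' le_SucI[OF order_refl]])
    then obtain L' where L': "linear_functional L'" "kills L'"
      and eq: "\<And>p. p \<in> polys_upto (2 * Suc n) \<Longrightarrow> L' p = riesz \<beta>' p"
      using normalize[OF le_SucI[OF assms(1)] lin' _ mult'] by blast
    have "psd (Suc n) L'" "multiplicative_null (Suc n) L'"
      using psd' mult' psd_cong[of "Suc n" L'] multiplicative_null_cong[of "Suc n" L'] eq by auto
    moreover have "L' p = L p" if "p \<in> polys_upto (2 * n)" for p
      using eq[OF polys_upto_mono[OF that]] agree'[OF that] agree[OF that] by simp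
    ultimately show A
      using recursive_if_extension[OF L n L'] by (intro solution) auto
  qed
  moreover note rank_le_card_variety[OF _ psd]
  moreover have "A \<Longrightarrow> \<exists>\<mu>. representing_measure n \<beta> \<mu> \<and> convergent_moments (2 * n + 2) \<mu> \<and>
      ecard (supp \<mu>) \<le> enat (1 + mrank n \<beta>) \<and> (mrank n \<beta> \<le> 2 * n \<longrightarrow> ecard (supp \<mu>) = enat (mrank n \<beta>))"
    unfolding A_def using atomic_solution_measure by (metis (no_types, lifting))
  moreover have "\<exists>\<beta>'. extends_moments n \<beta> \<beta>' \<and> positive_semidefinite (moment_matrix (n + 1) \<beta>') \<and>
      recursively_generated (n + 1) \<beta>' \<and> mrank (n + 1) \<beta>' \<le> 1 + mrank n \<beta> \<and>
      flat_extension (n + 1) \<beta>' \<beta>' \<and> (mrank n \<beta> \<le> 2 * n \<longrightarrow> flat_extension n \<beta> \<beta>')"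
    if solvable: A
  proof -
    obtain S w where "atomic_solution n \<beta> S w"
      using solvable by (auto simp: A_def)
    note ext = atomic_solution_extension[OF this]
    show ?thesis
      by (intro exI[of _ "moments (atomic S w)"] conjI impI ext)
  qed
  ultimately show ?thesis
    unfolding rank by (intro conjI allI impI all_equivalent_six[where R = A]) blast+
qed

end
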